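(* Representatives of $\Lambda/4\Lambda$ of minimal norm may be found among Leech vectors of type up to $16$, according to the weighted equality $$\begin{aligned}4^{24}=\,&1+|O_2|+|O_3|+|O_4|+|O_5|+|O_{6a}|+|O_{6b}|+|O_7|+\tfrac12|O_{8a}|+|O_{8b}|+|O_{8c}|+|O_{9a}|+|O_{9b}|+|O_{10a}|\\&+\tfrac12|O_{10b}|+|O_{10c}|+\tfrac12|O_{11a}|+|O_{11b}|+\tfrac12|O_{12a}|+|O_{12c}|+\tfrac14|O_{12d}|+\tfrac12|O_{12e}|+|O_{12f}|\\&+\tfrac12|O_{13b}|+\tfrac13|O_{13c}|+\tfrac16|O_{14b}|+\tfrac14|O_{14d}|+\tfrac18|O_{14e}|+\tfrac1{14}(|O_{15b}|+|O_{15d}|)+\tfrac1{48}|O_{16a}|+\tfrac1{32}|O_{16e}|,\end{aligned}$$ in which each orbit appearing consists of vectors of minimal norm in their class modulo $4\Lambda$, and the weight (the reciprocal of the coefficient) of each orbit is the $4$-weight of the vectors in that orbit. Moreover: (i) $O_{15b}$ and $O_{15d}$ are conjugate modulo $4\Lambda$, but they are not conjugate modulo $4\Lambda$ to the other orbits of type $15$; (ii) every orbit $O_x$ appearing in the equality and not of type $15$ is not conjugate modulo $4\Lambda$ to any other orbit $O_y$ of type $y\le x$; hence the $4$-weight of $O_x$ coincides with the $4$-weight of any vector in $O_x$; (iii) the $4$-weights of the orbits $O_{15b}$ and $O_{15d}$ are $2$ and $12$ respectively, which differ from the $4$-weight of any vector in $O_{15b}$ or $O_{15d}$, namely $14$.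
   Context: Let $\Lambda$ be the Leech lattice with bilinear form $(\cdot,\cdot)$ and $\operatorname{Co}_0$ its automorphism group. The type of $v\in\Lambda$ is $\frac12(v,v)$. For $t\ge1$, the $t$-weight of a vector $v\in\Lambda$ is $\#\{u\in\Lambda:u\in v+t\Lambda,\ (u,u)=(v,v)\}$, and the $t$-weight of an orbit $\operatorname{Co}_0v$ is $\#\{u\in\operatorname{Co}_0v:u\in v+t\Lambda\}$. Two orbits $\operatorname{Co}_0v$, $\operatorname{Co}_0u$ are conjugate modulo $t\Lambda$ if $v-\sigma(u)\in t\Lambda$ for some $\sigma\in\operatorname{Co}_0$. Let $p=65520$. The $\operatorname{Co}_0$-orbits of type $\le16$ are $O_0=\{0\}$ and (subscript = type, cardinality in parentheses, distinct within each type): $O_2$ ($3p$), $O_3$ ($256p$), $O_4$ ($6075p$), $O_5$ ($70656p$), $O_{6a}$ ($518400p$), $O_{6b}$ ($6900p$), $O_7$ ($2861568p$), $O_{8a}$ ($3p$), $O_{8b}$ ($12295800p$), $O_{8c}$ ($141312p$), $O_{9a}$ ($12441600p$), $O_{9b}$ ($32972800p$), $O_{10a}$ ($143078400p$), $O_{10b}$ ($279450p$), $O_{10c}$ ($1430784p$), $O_{11a}$ ($19430400p$), $O_{11b}$ ($393465600p$), $O_{12a}$ ($256p$), $O_{12b}$ ($141312p$), $O_{12c}$ ($12441600p$), $O_{12d}$ ($2049300p$), $O_{12e}$ ($393465600p$), $O_{12f}$ ($667699200p$), $O_{13a}$ ($12441600p$), $O_{13b}$ ($1007271936p$), $O_{13c}$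 ($1573862400p$), $O_{14a}$ ($286156800p$), $O_{14b}$ ($5508518400p$), $O_{14c}$ ($13800p$), $O_{14d}$ ($19430400p$), $O_{14e}$ ($49183200p$), $O_{15a}$ ($2861568p$), $O_{15b}$ ($1335398400p$), $O_{15c}$ ($19430400p$), $O_{15d}$ ($8012390400p$), $O_{15e}$ ($3147724800p$), $O_{16a}$ ($6075p$), $O_{16b}$ ($12441600p$), $O_{16c}$ ($286156800p$), $O_{16d}$ ($98366400p$), $O_{16e}$ ($5901984000p$), $O_{16f}$ ($16024780800p$), $O_{16g}$ ($3147724800p$). $|O|$ denotes the cardinality of $O$. *)

theory Defs
  imports "HOL-Analysis.Analysis"
begin

text \<open>
  The coordinates of the ambient Euclidean space are indexed by the projective line over the
  field with 23 elements; \<open>None\<close> is the point at infinity, and arithmetic in the type \<open>23\<close>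
  is arithmetic modulo 23.
\<close>

type_synonym pl23 = "23 option"
type_synonym vec24 = "(real, pl23) vec"

definition golay_gen :: "23 \<Rightarrow> pl23 set" where
  "golay_gen i = insert None {Some (n + i) | n. \<nexists>y. n = y ^ 2}"

text \<open>
  The binary Golay code as the extended quadratic residue code: the binary span of the translates
  of the set consisting of infinity and the quadratic non-residues (0 counts as a square).
  Codewords are identified with their supports, so addition is symmetric difference.
\<close>

inductive_set golay_code :: "pl23 set set" where
  zero: "{} \<in> golay_code"
| add: "S \<in> golay_code \<Longrightarrow> (S - golay_gen i) \<union> (golay_gen i - S) \<in> golay_code"

text \<open>
  Conway's coordinates. With the scaling by \<open>1 / sqrt 8\<close> the bilinear form of the lattice is the
  standard inner product.
\<close>

definition leech :: "vec24 set" where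
  "leech = {(1 / sqrt 8) *\<^sub>R (\<chi> i. real_of_int (x i)) | x :: pl23 \<Rightarrow> int.
     \<exists>m :: int. (\<forall>i. x i mod 2 = m mod 2) \<and>
        (\<Sum>i\<in>UNIV. x i) mod 8 = 4 * m mod 8 \<and>
        (\<forall>k :: int. {i. x i mod 4 = k mod 4} \<in> golay_code)}"

text \<open>
  The lattice spans the ambient space, so its automorphisms are the restrictions of the
  orthogonal transformations preserving it.
\<close>

definition Co0 :: "(vec24 \<Rightarrow> vec24) set" where
  "Co0 = {\<sigma>. orthogonal_transformation \<sigma> \<and> \<sigma> ` leech = leech}"

definition leech_type :: "vec24 \<Rightarrow> real" where
  "leech_type v = (v \<bullet> v) / 2"

definition co0_orbit :: "vec24 \<Rightarrow> vec24 set" where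
  "co0_orbit v = {\<sigma> v | \<sigma>. \<sigma> \<in> Co0}"

definition mult_leech :: "nat \<Rightarrow> vec24 set" where
  "mult_leech t = (\<lambda>w. real t *\<^sub>R w) ` leech"

definition vector_weight :: "nat \<Rightarrow> vec24 \<Rightarrow> nat" where
  "vector_weight t v = card {u \<in> leech. u - v \<in> mult_leech t \<and> u \<bullet> u = v \<bullet> v}"

text \<open>The weight modulo \<open>t\<close> of the orbit of \<open>v\<close>.\<close>

definition orbit_weight :: "nat \<Rightarrow> vec24 \<Rightarrow> nat" where
  "orbit_weight t v = card {u \<in> co0_orbit v. u - v \<in> mult_leech t}"

text \<open>Conjugacy modulo \<open>t\<close> of the orbits of \<open>v\<close> and \<open>u\<close>.\<close>

definition orbits_conjugate :: "nat \<Rightarrow> vec24 \<Rightarrow> vec24 \<Rightarrow> bool" where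
  "orbits_conjugate t v u \<longleftrightarrow> (\<exists>\<sigma>\<in>Co0. v - \<sigma> u \<in> mult_leech t)"

definition minimal_in_class :: "nat \<Rightarrow> vec24 \<Rightarrow> bool" where
  "minimal_in_class t v \<longleftrightarrow> v \<in> leech \<and>
     (\<forall>u\<in>leech. u - v \<in> mult_leech t \<longrightarrow> v \<bullet> v \<le> u \<bullet> u)"

datatype orbit_label =
  O0 | O2 | O3 | O4 | O5 | O6a | O6b | O7 | O8a | O8b | O8c | O9a | O9b | O10a | O10b | O10c
  | O11a | O11b | O12a | O12b | O12c | O12d | O12e | O12f | O13a | O13b | O13c | O14a | O14b
  | O14c | O14d | O14e | O15a | O15b | O15c | O15d | O15e | O16a | O16b | O16c | O16d | O16e
  | O16f | O16g

primrec label_type :: "orbit_label \<Rightarrow> nat" where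
  "label_type O0 = 0" | "label_type O2 = 2" | "label_type O3 = 3" | "label_type O4 = 4"
  | "label_type O5 = 5" | "label_type O6a = 6" | "label_type O6b = 6" | "label_type O7 = 7"
  | "label_type O8a = 8" | "label_type O8b = 8" | "label_type O8c = 8" | "label_type O9a = 9"
  | "label_type O9b = 9" | "label_type O10a = 10" | "label_type O10b = 10"
  | "label_type O10c = 10" | "label_type O11a = 11" | "label_type O11b = 11"
  | "label_type O12a = 12" | "label_type O12b = 12" | "label_type O12c = 12"
  | "label_type O12d = 12" | "label_type O12e = 12" | "label_type O12f = 12"
  | "label_type O13a = 13" | "label_type O13b = 13" | "label_type O13c = 13"
  | "label_type O14a = 14" | "label_type O14b = 14" | "label_type O14c = 14"
  | "label_type O14d = 14" | "label_type O14e = 14" | "label_type O15a = 15"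
  | "label_type O15b = 15" | "label_type O15c = 15" | "label_type O15d = 15"
  | "label_type O15e = 15" | "label_type O16a = 16" | "label_type O16b = 16"
  | "label_type O16c = 16" | "label_type O16d = 16" | "label_type O16e = 16"
  | "label_type O16f = 16" | "label_type O16g = 16"

primrec label_card :: "orbit_label \<Rightarrow> nat" where
  "label_card O0 = 1" | "label_card O2 = 3 * 65520" | "label_card O3 = 256 * 65520"
  | "label_card O4 = 6075 * 65520" | "label_card O5 = 70656 * 65520"
  | "label_card O6a = 518400 * 65520" | "label_card O6b = 6900 * 65520"
  | "label_card O7 = 2861568 * 65520" | "label_card O8a = 3 * 65520"
  | "label_card O8b = 12295800 * 65520" | "label_card O8c = 141312 * 65520"
  | "label_card O9a = 12441600 * 65520" | "label_card O9b = 32972800 * 65520"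
  | "label_card O10a = 143078400 * 65520" | "label_card O10b = 279450 * 65520"
  | "label_card O10c = 1430784 * 65520" | "label_card O11a = 19430400 * 65520"
  | "label_card O11b = 393465600 * 65520" | "label_card O12a = 256 * 65520"
  | "label_card O12b = 141312 * 65520" | "label_card O12c = 12441600 * 65520"
  | "label_card O12d = 2049300 * 65520" | "label_card O12e = 393465600 * 65520"
  | "label_card O12f = 667699200 * 65520" | "label_card O13a = 12441600 * 65520"
  | "label_card O13b = 1007271936 * 65520" | "label_card O13c = 1573862400 * 65520"
  | "label_card O14a = 286156800 * 65520" | "label_card O14b = 5508518400 * 65520"
  | "label_card O14c = 13800 * 65520" | "label_card O14d = 19430400 * 65520"
  | "label_card O14e = 49183200 * 65520" | "label_card O15a = 2861568 * 65520"
  | "label_card O15b = 1335398400 * 65520" | "label_card O15c = 19430400 * 65520"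
  | "label_card O15d = 8012390400 * 65520" | "label_card O15e = 3147724800 * 65520"
  | "label_card O16a = 6075 * 65520" | "label_card O16b = 12441600 * 65520"
  | "label_card O16c = 286156800 * 65520" | "label_card O16d = 98366400 * 65520"
  | "label_card O16e = 5901984000 * 65520" | "label_card O16f = 16024780800 * 65520"
  | "label_card O16g = 3147724800 * 65520"

text \<open>
  \<open>Orb\<close> enumerates the \<open>Co0\<close>-orbits of type at most 16. Two orbits of the same type have
  different cardinalities, so at most one \<open>Orb\<close> has this property.
\<close>

definition leech_orbit_table :: "(orbit_label \<Rightarrow> vec24 set) \<Rightarrow> bool" where
  "leech_orbit_table Orb \<longleftrightarrow>
     bij_betw Orb UNIV {co0_orbit v | v. v \<in> leech \<and> leech_type v \<le> 16} \<and>
     (\<forall>x. (\<forall>v\<in>Orb x. leech_type v = real (label_type x)) \<and> card (Orb x) = label_card x)"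

text \<open>
  The orbits occurring in the weighted equality, with the reciprocals of their coefficients;
  the summand 1 stands for \<open>O0\<close>. Orbits not occurring are mapped to \<open>None\<close>.
\<close>

primrec eq_weight :: "orbit_label \<Rightarrow> nat option" where
  "eq_weight O0 = Some 1" | "eq_weight O2 = Some 1" | "eq_weight O3 = Some 1"
  | "eq_weight O4 = Some 1" | "eq_weight O5 = Some 1" | "eq_weight O6a = Some 1"
  | "eq_weight O6b = Some 1" | "eq_weight O7 = Some 1" | "eq_weight O8a = Some 2"
  | "eq_weight O8b = Some 1" | "eq_weight O8c = Some 1" | "eq_weight O9a = Some 1"
  | "eq_weight O9b = Some 1" | "eq_weight O10a = Some 1" | "eq_weight O10b = Some 2"
  | "eq_weight O10c = Some 1" | "eq_weight O11a = Some 2" | "eq_weight O11b = Some 1"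
  | "eq_weight O12a = Some 2" | "eq_weight O12b = None" | "eq_weight O12c = Some 1"
  | "eq_weight O12d = Some 4" | "eq_weight O12e = Some 2" | "eq_weight O12f = Some 1"
  | "eq_weight O13a = None" | "eq_weight O13b = Some 2" | "eq_weight O13c = Some 3"
  | "eq_weight O14a = None" | "eq_weight O14b = Some 6" | "eq_weight O14c = None"
  | "eq_weight O14d = Some 4" | "eq_weight O14e = Some 8" | "eq_weight O15a = None"
  | "eq_weight O15b = Some 14" | "eq_weight O15c = None" | "eq_weight O15d = Some 14"
  | "eq_weight O15e = None" | "eq_weight O16a = Some 48" | "eq_weight O16b = None"
  | "eq_weight O16c = None" | "eq_weight O16d = None" | "eq_weight O16e = Some 32"
  | "eq_weight O16f = None" | "eq_weight O16g = None"

end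

theory Submission
  imports Defs
begin

text \<open>
  If \<open>u \<equiv> v\<close> modulo \<open>4\<Lambda>\<close> and \<open>u\<close> is at most as long as \<open>v\<close>, of type at most 16, then
  \<open>u = v - 4 s\<close> with \<open>v \<bullet> s \<ge> 2 (s \<bullet> s)\<close>, and Cauchy--Schwarz leaves only \<open>s\<close> of type 2, 3 or 4.
  So minimality and 4-weight of \<open>v\<close> are governed by the numbers of such \<open>s\<close> with given inner
  product, which depend only on the orbit of \<open>v\<close>.

  Counting pairs \<open>(v, s)\<close> in two ways and translating by \<open>2 s\<close> expresses the sum over all orbits
  of one type, weighted by their sizes, by inner product counts of a fixed \<open>s\<close> with vectors of
  type at most 7. The latter follow from the second and fourth moments of the shells, which are
  computed from transitivity on the vectors of types 2 and 4. The few resulting linear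
  Diophantine equations, together with a Cauchy--Schwarz bound for each count, determine
  everything except the weights of \<open>O\<^sub>1\<^sub>5\<^sub>b\<close>, \<open>O\<^sub>1\<^sub>5\<^sub>d\<close>, \<open>O\<^sub>1\<^sub>6\<^sub>a\<close> and \<open>O\<^sub>1\<^sub>6\<^sub>e\<close>.

  For the last two, Gram matrix arguments in dimension 24 give the upper bounds 48 and 32. As
  \<open>\<Lambda>/4\<Lambda>\<close> has at most \<open>4\<^sup>2\<^sup>4\<close> elements, the weighted sum of the orbit sizes leaves no slack:
  these bounds are attained, the remaining two weights are forced, and every class contains a
  vector of the list.
\<close>

section \<open>The lattice as a subgroup\<close>

text \<open>The table gives types and sizes of orbits but no representatives, so no orbit can be
  inspected directly: every count has to come from an average over a whole shell. Evenness of norms,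
  integrality of inner products and the minimum norm 4 are also read off the table. They are
  therefore available only where some vector has norm at most 32, and this limit shapes many
  hypotheses. The vectors written in coordinates have all entries divisible by 4 before scaling;
  they have types 2 and 4, where the action is transitive, and this is enough to give the moments
  against a minimal vector the values of a spherical 4-design.

  Linear equations stop working at two places. The sizes of \<open>O15d\<close> and
  \<open>O15b\<close> have ratio 6, so their equation for inner product 8 has several solutions. For
  type 16 and inner product 8 with a minimal vector, the Cauchy--Schwarz bound is void, because 8^2
  = 4 * 16 * (2 - 1). There the size of a class itself is bounded, through the rank of its Gram
  matrix.\<close>

lemma golay_code_symdiff:
  assumes "S \<in> golay_code" "T \<in> golay_code"
  shows "(S - T) \<union> (T - S) \<in> golay_code"
  using assms(2)
proof (induction rule: golay_code.induct)
  case zero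
  then show ?case using assms(1) by simp
next
  case (add T i)
  let ?U = "(S - T) \<union> (T - S)" and ?g = "golay_gen i"
  have "(?U - ?g) \<union> (?g - ?U) \<in> golay_code"
    using add.IH by (rule golay_code.add)
  moreover have "(?U - ?g) \<union> (?g - ?U) =
      (S - ((T - ?g) \<union> (?g - T))) \<union> (((T - ?g) \<union> (?g - T)) - S)"
    by auto
  ultimately show ?case by simp
qed

definition leech_coords :: "(pl23 \<Rightarrow> int) set" where
  "leech_coords = {x. \<exists>m :: int. (\<forall>i. x i mod 2 = m mod 2) \<and>
        (\<Sum>i\<in>UNIV. x i) mod 8 = 4 * m mod 8 \<and>
        (\<forall>k :: int. {i. x i mod 4 = k mod 4} \<in> golay_code)}"

definition coord_vec :: "(pl23 \<Rightarrow> int) \<Rightarrow> vec24" where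
  "coord_vec x = (1 / sqrt 8) *\<^sub>R (\<chi> i. real_of_int (x i))"

lemma leech_eq_image: "leech = coord_vec ` leech_coords"
  unfolding leech_def leech_coords_def coord_vec_def setcompr_eq_image ..

lemma coord_vec_diff: "coord_vec x - coord_vec y = coord_vec (\<lambda>i. x i - y i)"
  by (simp add: coord_vec_def vec_eq_iff diff_divide_distrib)

lemma coord_vec_scale: "real t *\<^sub>R coord_vec x = coord_vec (\<lambda>i. int t * x i)"
  by (simp add: coord_vec_def vec_eq_iff)

lemma mod4_iff:
  fixes a m :: int
  assumes "a mod 2 = m mod 2"
  shows "a mod 4 = (m + 2) mod 4 \<longleftrightarrow> a mod 4 \<noteq> m mod 4"
proof -
  obtain p where p: "a = m + 2 * p"
    using assms by (metis add.commute diff_add_cancel dvd_def mod_eq_dvd_iff)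
  have "a - (m + 2) = 2 * (p - 1)" "a - m = 2 * p" using p by simp_all
  moreover have "4 dvd 2 * c \<longleftrightarrow> even c" for c :: int by presburger
  ultimately show ?thesis unfolding mod_eq_dvd_iff by (simp_all only:) auto
qed

text \<open>Once the parities m and n are fixed, a coordinate modulo 4 carries one bit: whether it
  equals m or m + 2. The bits of a difference add modulo 2, so the level sets of a difference of
  coordinate vectors are the symmetric difference of two level sets and its complement.\<close>

lemma mod4_diff_iff:
  fixes a b m n :: int
  assumes "a mod 2 = m mod 2" "b mod 2 = n mod 2"
  shows "(a - b) mod 4 = (m - n) mod 4 \<longleftrightarrow> (a mod 4 = m mod 4 \<longleftrightarrow> b mod 4 = n mod 4)"
    and "(a - b) mod 4 = (m - n + 2) mod 4 \<longleftrightarrow> \<not> (a mod 4 = m mod 4 \<longleftrightarrow> b mod 4 = n mod 4)"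
proof -
  obtain p where p: "a = m + 2 * p"
    using assms(1) by (metis add.commute diff_add_cancel dvd_def mod_eq_dvd_iff)
  obtain q where q: "b = n + 2 * q"
    using assms(2) by (metis add.commute diff_add_cancel dvd_def mod_eq_dvd_iff)
  have "a - b - (m - n) = 2 * (p - q)" "a - m = 2 * p" "b - n = 2 * q"
    "a - b - (m - n + 2) = 2 * (p - q - 1)"
    using p q by simp_all
  moreover have "4 dvd 2 * c \<longleftrightarrow> even c" for c :: int by presburger
  ultimately show "(a - b) mod 4 = (m - n) mod 4 \<longleftrightarrow> (a mod 4 = m mod 4 \<longleftrightarrow> b mod 4 = n mod 4)"
    and "(a - b) mod 4 = (m - n + 2) mod 4 \<longleftrightarrow> \<not> (a mod 4 = m mod 4 \<longleftrightarrow> b mod 4 = n mod 4)"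
    unfolding mod_eq_dvd_iff by (simp_all only:) auto
qed

text \<open>All coordinates have one parity, so the level sets of m and m + 2 modulo 4 are
  complementary codewords and their sum is the full set. This yields the all-ones word, needed to
  complement codewords, without any work with quadratic residues.\<close>

lemma UNIV_golay_code:
  assumes "x \<in> leech_coords"
  shows "UNIV \<in> golay_code"
proof -
  obtain m where m: "\<And>i. x i mod 2 = m mod 2"
    and g: "\<And>k. {i. x i mod 4 = k mod 4} \<in> golay_code"
    using assms unfolding leech_coords_def by blast
  let ?A = "{i. x i mod 4 = m mod 4}" and ?B = "{i. x i mod 4 = (m + 2) mod 4}"
  have "i \<in> (?A - ?B) \<union> (?B - ?A)" for i
    using mod4_iff[OF m[of i]] by blast
  then have "(?A - ?B) \<union> (?B - ?A) = UNIV" by blast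
  moreover have "(?A - ?B) \<union> (?B - ?A) \<in> golay_code"
    by (rule golay_code_symdiff[OF g g])
  ultimately show ?thesis by simp
qed

lemma leech_coords_diff:
  assumes "x \<in> leech_coords" "y \<in> leech_coords"
  shows "(\<lambda>i. x i - y i) \<in> leech_coords"
proof -
  obtain m where m: "\<And>i. x i mod 2 = m mod 2" "(\<Sum>i\<in>UNIV. x i) mod 8 = 4 * m mod 8"
    and gx: "\<And>k. {i. x i mod 4 = k mod 4} \<in> golay_code"
    using assms(1) unfolding leech_coords_def by blast
  obtain n where n: "\<And>i. y i mod 2 = n mod 2" "(\<Sum>i\<in>UNIV. y i) mod 8 = 4 * n mod 8"
    and gy: "\<And>k. {i. y i mod 4 = k mod 4} \<in> golay_code"
    using assms(2) unfolding leech_coords_def by blast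
  let ?A = "{i. x i mod 4 = m mod 4}" and ?B = "{i. y i mod 4 = n mod 4}"
  let ?D = "(?A - ?B) \<union> (?B - ?A)"
  have D: "?D \<in> golay_code" by (rule golay_code_symdiff[OF gx gy])
  have compl: "- ?D \<in> golay_code"
    using golay_code_symdiff[OF UNIV_golay_code[OF assms(1)] D] by (simp add: Compl_eq_Diff_UNIV)
  have par: "(x i - y i) mod 2 = (m - n) mod 2" for i
    using mod_diff_cong[OF m(1) n(1)] .
  have "{i. (x i - y i) mod 4 = k mod 4} \<in> golay_code" for k
  proof -
    have "k mod 4 = (m - n) mod 4 \<or> k mod 4 = (m - n + 2) mod 4 \<or> k mod 2 \<noteq> (m - n) mod 2"
      using mod4_iff[of k "m - n"] by blast
    then consider "k mod 4 = (m - n) mod 4" | "k mod 4 = (m - n + 2) mod 4"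
      | "k mod 2 \<noteq> (m - n) mod 2" by blast
    then show ?thesis
    proof cases
      case 1
      have "(x i - y i) mod 4 = k mod 4 \<longleftrightarrow> (x i mod 4 = m mod 4 \<longleftrightarrow> y i mod 4 = n mod 4)" for i
        using mod4_diff_iff(1)[OF m(1)[of i] n(1)[of i]] 1 by simp
      then have "{i. (x i - y i) mod 4 = k mod 4} = - ?D" by auto
      with compl show ?thesis by simp
    next
      case 2
      have "(x i - y i) mod 4 = k mod 4 \<longleftrightarrow> \<not> (x i mod 4 = m mod 4 \<longleftrightarrow> y i mod 4 = n mod 4)" for i
        using mod4_diff_iff(2)[OF m(1)[of i] n(1)[of i]] 2 by simp
      then have "{i. (x i - y i) mod 4 = k mod 4} = ?D" by auto
      with D show ?thesis by simp
    next
      case 3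
      have "(x i - y i) mod 4 \<noteq> k mod 4" for i
        using par[of i] 3 by (metis mod_mod_cancel even_numeral)
      then have "{i. (x i - y i) mod 4 = k mod 4} = {}" by auto
      then show ?thesis by (simp add: golay_code.zero)
    qed
  qed
  moreover have "(\<Sum>i\<in>UNIV. x i - y i) mod 8 = 4 * (m - n) mod 8"
    unfolding sum_subtractf right_diff_distrib by (rule mod_diff_cong[OF m(2) n(2)])
  ultimately show ?thesis unfolding leech_coords_def using par by blast
qed

lemma leech_diff:
  assumes "u \<in> leech" "v \<in> leech"
  shows "u - v \<in> leech"
proof -
  obtain x where x: "u = coord_vec x" "x \<in> leech_coords"
    using assms(1) unfolding leech_eq_image by (rule imageE)
  obtain y where y: "v = coord_vec y" "y \<in> leech_coords"
    using assms(2) unfolding leech_eq_image by (rule imageE)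
  show ?thesis
    unfolding leech_eq_image x(1) y(1) coord_vec_diff
    by (rule imageI[OF leech_coords_diff[OF x(2) y(2)]])
qed

lemma zero_in_leech: "u \<in> leech \<Longrightarrow> 0 \<in> leech"
  by (metis diff_self leech_diff)

lemma leech_minus: "u \<in> leech \<Longrightarrow> - u \<in> leech"
  by (metis diff_0 leech_diff zero_in_leech)

lemma leech_add: "u \<in> leech \<Longrightarrow> v \<in> leech \<Longrightarrow> u + v \<in> leech"
  by (metis diff_minus_eq_add leech_diff leech_minus)

lemma leech_scale_nat:
  assumes "u \<in> leech" shows "real n *\<^sub>R u \<in> leech"
proof (induction n)
  case 0
  then show ?case using zero_in_leech[OF assms] by simp
next
  case (Suc n)
  then show ?case using leech_add[OF assms Suc] by (simp add: scaleR_add_left)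
qed

text \<open>The factor is 4 / sqrt 8 = sqrt 2. Coordinates divisible by 4 have only the empty and
  the full level set, and nonemptiness of the lattice supplies the full codeword. These vectors feed
  the moment computations.\<close>

lemma leech_four_multiples:
  assumes "leech \<noteq> {}" "even (\<Sum>i\<in>UNIV. z i)"
  shows "sqrt 2 *\<^sub>R (\<chi> i. real_of_int (z i)) \<in> leech"
proof -
  obtain x where x: "x \<in> leech_coords" using assms(1) unfolding leech_eq_image by blast
  have "{i. (4 * z i) mod 4 = k mod 4} \<in> golay_code" for k :: int
  proof (cases "k mod 4 = 0")
    case True
    then have "{i. (4 * z i) mod 4 = k mod 4} = UNIV" by auto
    then show ?thesis using UNIV_golay_code[OF x] by simp
  next
    case False
    then have "{i. (4 * z i) mod 4 = k mod 4} = {}" by auto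
    then show ?thesis by (simp add: golay_code.zero)
  qed
  moreover have "(\<Sum>i\<in>UNIV. 4 * z i) mod 8 = 4 * 0 mod 8"
    using assms(2) by (auto simp: sum_distrib_left[symmetric] elim!: evenE)
  moreover have "(4 * z i) mod 2 = 0 mod 2" for i by simp
  ultimately have "(\<lambda>i. 4 * z i) \<in> leech_coords" unfolding leech_coords_def by blast
  moreover have "coord_vec (\<lambda>i. 4 * z i) = sqrt 2 *\<^sub>R (\<chi> i. real_of_int (z i))"
  proof -
    have "sqrt 8 = 2 * sqrt 2"
      using real_sqrt_mult[of 4 2] by simp
    then have "1 / sqrt 8 * 4 = sqrt 2" by (simp add: field_simps)
    then show ?thesis
      by (simp add: coord_vec_def vec_eq_iff field_simps)
  qed
  ultimately show ?thesis unfolding leech_eq_image by force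
qed

section \<open>Automorphisms, shells and inner product counts\<close>

lemma Co0_linear: "\<sigma> \<in> Co0 \<Longrightarrow> linear \<sigma>"
  and Co0_inner: "\<sigma> \<in> Co0 \<Longrightarrow> \<sigma> v \<bullet> \<sigma> w = v \<bullet> w"
  and Co0_image: "\<sigma> \<in> Co0 \<Longrightarrow> \<sigma> ` leech = leech"
  by (auto simp: Co0_def orthogonal_transformation_def)

lemma Co0_leech: "\<sigma> \<in> Co0 \<Longrightarrow> v \<in> leech \<Longrightarrow> \<sigma> v \<in> leech"
  using Co0_image by blast

lemma Co0_inj: "\<sigma> \<in> Co0 \<Longrightarrow> inj \<sigma>"
  by (auto simp: Co0_def orthogonal_transformation_inj)

lemma Co0_id: "id \<in> Co0"
  by (auto simp: Co0_def orthogonal_transformation_def linear_id)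

lemma Co0_compose:
  assumes "\<sigma> \<in> Co0" "\<tau> \<in> Co0"
  shows "\<sigma> \<circ> \<tau> \<in> Co0"
proof -
  have "(\<sigma> \<circ> \<tau>) ` leech = leech"
    by (simp only: image_comp[symmetric] Co0_image[OF assms(1)] Co0_image[OF assms(2)])
  then show ?thesis
    using assms by (simp add: Co0_def orthogonal_transformation_compose)
qed

lemma Co0_inv:
  assumes "\<sigma> \<in> Co0"
  shows "inv \<sigma> \<in> Co0"
proof -
  have "inv \<sigma> ` leech = inv \<sigma> ` (\<sigma> ` leech)" by (simp only: Co0_image[OF assms])
  also have "\<dots> = leech" by (rule image_inv_f_f[OF Co0_inj[OF assms]])
  finally show ?thesis
    using assms by (simp add: Co0_def orthogonal_transformation_inv)
qed

lemma Co0_inv_apply: "\<sigma> \<in> Co0 \<Longrightarrow> inv \<sigma> (\<sigma> v) = v"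
  by (simp add: Co0_inj inv_f_f)

lemma co0_orbitI: "\<sigma> \<in> Co0 \<Longrightarrow> \<sigma> v \<in> co0_orbit v"
  unfolding co0_orbit_def by (rule CollectI) (intro exI conjI, rule refl)

lemma co0_orbit_refl: "v \<in> co0_orbit v"
  using co0_orbitI[OF Co0_id, of v] by simp

lemma co0_orbit_eq:
  assumes "u \<in> co0_orbit v"
  shows "co0_orbit u = co0_orbit v"
proof -
  obtain \<sigma> where s: "\<sigma> \<in> Co0" "u = \<sigma> v" using assms unfolding co0_orbit_def by blast
  have "\<tau> u \<in> co0_orbit v" if "\<tau> \<in> Co0" for \<tau>
    using co0_orbitI[OF Co0_compose[OF that s(1)], of v] s(2) by simp
  moreover have "\<tau> v \<in> co0_orbit u" if "\<tau> \<in> Co0" for \<tau>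
    using co0_orbitI[OF Co0_compose[OF that Co0_inv[OF s(1)]], of u]
    unfolding o_apply s(2) Co0_inv_apply[OF s(1)] .
  ultimately show ?thesis by (auto simp: co0_orbit_def)
qed

definition shell :: "nat \<Rightarrow> vec24 set" where
  "shell n = {v \<in> leech. v \<bullet> v = 2 * real n}"

definition ip_count :: "nat \<Rightarrow> int \<Rightarrow> vec24 \<Rightarrow> nat" where
  "ip_count t j v = card {w \<in> shell t. v \<bullet> w = of_int j}"

lemma Co0_shell:
  assumes "\<sigma> \<in> Co0"
  shows "\<sigma> ` shell n = shell n"
proof
  show "\<sigma> ` shell n \<subseteq> shell n"
    unfolding shell_def using Co0_leech[OF assms] Co0_inner[OF assms] by auto
  show "shell n \<subseteq> \<sigma> ` shell n"
  proof
    fix v assume v: "v \<in> shell n"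
    then have "v \<in> \<sigma> ` leech" unfolding shell_def using Co0_image[OF assms] by simp
    then obtain w where "w \<in> leech" "v = \<sigma> w" by blast
    with v show "v \<in> \<sigma> ` shell n"
      unfolding shell_def using Co0_inner[OF assms] by auto
  qed
qed

lemma sum_shell_Co0:
  assumes "\<sigma> \<in> Co0"
  shows "(\<Sum>y\<in>shell n. f (y \<bullet> \<sigma> r)) = (\<Sum>y\<in>shell n. f (y \<bullet> r))"
proof -
  have "(\<Sum>y\<in>shell n. f (y \<bullet> \<sigma> r)) = (\<Sum>y\<in>\<sigma> ` shell n. f (y \<bullet> \<sigma> r))"
    by (simp only: Co0_shell[OF assms])
  also have "\<dots> = (\<Sum>y\<in>shell n. f (\<sigma> y \<bullet> \<sigma> r))"
    by (subst sum.reindex) (auto intro: inj_on_subset[OF Co0_inj[OF assms]])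
  finally show ?thesis by (simp add: Co0_inner[OF assms])
qed

lemma ip_count_Co0:
  assumes "\<sigma> \<in> Co0"
  shows "ip_count t j (\<sigma> v) = ip_count t j v"
proof -
  have "\<sigma> ` {w \<in> shell t. v \<bullet> w = of_int j} = {w \<in> \<sigma> ` shell t. \<sigma> v \<bullet> w = of_int j}"
    by (auto simp: Co0_inner[OF assms])
  also have "\<dots> = {w \<in> shell t. \<sigma> v \<bullet> w = of_int j}"
    by (simp only: Co0_shell[OF assms])
  finally show ?thesis
    unfolding ip_count_def
    using card_image[OF inj_on_subset[OF Co0_inj[OF assms] subset_UNIV],
        of "{w \<in> shell t. v \<bullet> w = of_int j}"] by simp
qed

lemma ip_count_swap:
  assumes "finite (shell n)" "finite (shell t)"
  shows "(\<Sum>v\<in>shell n. ip_count t j v) = (\<Sum>w\<in>shell t. ip_count n j w)"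
proof -
  have card: "card {w \<in> A. P w} = (\<Sum>w\<in>A. if P w then 1 else 0)" if "finite A"
    for A :: "vec24 set" and P
    using that by (simp add: sum.If_cases Collect_conj_eq Int_commute)
  have "(\<Sum>v\<in>shell n. ip_count t j v) =
      (\<Sum>v\<in>shell n. \<Sum>w\<in>shell t. if v \<bullet> w = of_int j then 1 else 0)"
    unfolding ip_count_def card[OF assms(2)] ..
  also have "\<dots> = (\<Sum>w\<in>shell t. \<Sum>v\<in>shell n. if v \<bullet> w = of_int j then 1 else 0)"
    by (rule sum.swap)
  also have "\<dots> = (\<Sum>w\<in>shell t. ip_count n j w)"
    unfolding ip_count_def card[OF assms(1)] by (simp add: inner_commute)
  finally show ?thesis .
qed

lemma ip_count_minus: "ip_count t (- j) v = ip_count t j v"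
proof -
  have "bij_betw uminus {w \<in> shell t. v \<bullet> w = of_int j} {w \<in> shell t. v \<bullet> w = of_int (- j)}"
    by (rule bij_betwI[where g = uminus]) (auto simp: shell_def leech_minus)
  then show ?thesis unfolding ip_count_def by (simp add: bij_betw_same_card)
qed

text \<open>The affine map \<open>y \<mapsto> y - c w\<close> preserves the lattice, so it relates counts in different shells.\<close>

lemma ip_count_shift:
  assumes w: "w \<in> shell t" and c: "c \<in> {1, 2}"
    and m: "int m = int n - c * j + c\<^sup>2 * int t"
  shows "ip_count n j w = ip_count m (j - 2 * c * int t) w"
proof -
  have wl: "w \<in> leech" "w \<bullet> w = 2 * real t" using w by (auto simp: shell_def)
  have cl: "real_of_int c *\<^sub>R w \<in> leech"
    using c wl(1) leech_add[OF wl(1) wl(1)] by (auto simp: scaleR_2)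
  have mr: "2 * real m = 2 * real n - 2 * c * j + 2 * c\<^sup>2 * real t"
    using arg_cong[OF m, of real_of_int] by simp
  have norm: "(y - real_of_int c *\<^sub>R w) \<bullet> (y - real_of_int c *\<^sub>R w) =
      y \<bullet> y - 2 * c * (w \<bullet> y) + 2 * c\<^sup>2 * real t" for y
    using wl(2) by (simp add: inner_diff_left inner_diff_right inner_commute power2_eq_square)
  have ip: "w \<bullet> (y - real_of_int c *\<^sub>R w) = w \<bullet> y - 2 * c * real t" for y
    using wl(2) by (simp add: inner_diff_right)
  let ?f = "\<lambda>y. y - real_of_int c *\<^sub>R w"
  have "?f ` {y \<in> shell n. w \<bullet> y = of_int j} = {y \<in> shell m. w \<bullet> y = of_int (j - 2 * c * int t)}"
  proof (intro equalityI subsetI)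
    fix z assume "z \<in> ?f ` {y \<in> shell n. w \<bullet> y = of_int j}"
    then obtain y where y: "z = ?f y" "y \<in> leech" "y \<bullet> y = 2 * real n" "w \<bullet> y = of_int j"
      by (auto simp: shell_def)
    have "z \<bullet> z = 2 * real m" using mr unfolding y(1) norm y(3,4) by simp
    moreover have "w \<bullet> z = of_int (j - 2 * c * int t)" unfolding y(1) ip y(4) by simp
    moreover have "z \<in> leech" unfolding y(1) by (rule leech_diff[OF y(2) cl])
    ultimately show "z \<in> {y \<in> shell m. w \<bullet> y = of_int (j - 2 * c * int t)}"
      by (simp add: shell_def)
  next
    fix z assume "z \<in> {y \<in> shell m. w \<bullet> y = of_int (j - 2 * c * int t)}"
    then have z: "z \<in> leech" "z \<bullet> z = 2 * real m" "w \<bullet> z = of_int (j - 2 * c * int t)"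
      by (auto simp: shell_def)
    define y where "y = z + real_of_int c *\<^sub>R w"
    have zy: "z = ?f y" by (simp add: y_def)
    have wy: "w \<bullet> y = of_int j" using z(3) unfolding zy ip by simp
    have "y \<bullet> y = 2 * real n" using z(2) mr unfolding zy norm wy by simp
    moreover have "y \<in> leech" unfolding y_def by (rule leech_add[OF z(1) cl])
    ultimately have "y \<in> {y \<in> shell n. w \<bullet> y = of_int j}" using wy by (simp add: shell_def)
    then show "z \<in> ?f ` {y \<in> shell n. w \<bullet> y = of_int j}" unfolding zy by (rule imageI)
  qed
  moreover have "inj ?f" by (rule injI) simp
  ultimately show ?thesis unfolding ip_count_def
    using card_image[OF inj_on_subset[OF _ subset_UNIV], of ?f "{y \<in> shell n. w \<bullet> y = of_int j}"]
    by simp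
qed

lemma ip_count_eq_0:
  assumes "v \<bullet> v = 2 * real n" "4 * int n * int t < j\<^sup>2"
  shows "ip_count t j v = 0"
proof -
  have "v \<bullet> w \<noteq> of_int j" if "w \<in> shell t" for w
  proof
    assume "v \<bullet> w = of_int j"
    then have "(real_of_int j)\<^sup>2 \<le> (v \<bullet> v) * (w \<bullet> w)"
      using Cauchy_Schwarz_ineq[of v w] by simp
    also have "\<dots> = real_of_int (4 * int n * int t)" using assms(1) that by (simp add: shell_def)
    finally have "j\<^sup>2 \<le> 4 * int n * int t" by (simp only: of_int_le_iff flip: of_int_power)
    then show False using assms(2) by simp
  qed
  then have "{w \<in> shell t. v \<bullet> w = of_int j} = {}" by blast
  then show ?thesis unfolding ip_count_def by (simp only: card.empty)
qed

section \<open>Consequences of the orbit table\<close>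

lemma label_type_sets:
  "{x. label_type x = 0} = {O0}" "{x. label_type x = 1} = {}" "{x. label_type x = 2} = {O2}"
  "{x. label_type x = 3} = {O3}" "{x. label_type x = 4} = {O4}" "{x. label_type x = 5} = {O5}"
  "{x. label_type x = 6} = {O6a, O6b}" "{x. label_type x = 7} = {O7}"
  "{x. label_type x = 8} = {O8a, O8b, O8c}" "{x. label_type x = 9} = {O9a, O9b}"
  "{x. label_type x = 10} = {O10a, O10b, O10c}" "{x. label_type x = 11} = {O11a, O11b}"
  "{x. label_type x = 12} = {O12a, O12b, O12c, O12d, O12e, O12f}"
  "{x. label_type x = 13} = {O13a, O13b, O13c}"
  "{x. label_type x = 14} = {O14a, O14b, O14c, O14d, O14e}"
  "{x. label_type x = 15} = {O15a, O15b, O15c, O15d, O15e}"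
  "{x. label_type x = 16} = {O16a, O16b, O16c, O16d, O16e, O16f, O16g}"
  by (rule set_eqI; case_tac x; simp)+

lemma label_type_le: "label_type x \<le> 16"
  by (cases x) simp_all

lemma label_card_pos: "label_card x > 0"
  by (cases x) simp_all

lemma finite_label_set: "finite {x. label_type x = n}"
proof (cases "n \<le> 16")
  case True
  then have "n \<in> {0, 1, 2, 3, 4, 5, 6, 7, 8, 9, 10, 11, 12, 13, 14, 15, 16}" by simp presburger
  then show ?thesis by (elim insertE emptyE) (simp_all only: label_type_sets finite.intros)
next
  case False
  then have "{x. label_type x = n} = {}" using label_type_le by force
  then show ?thesis by (simp only: finite.emptyI)
qed

locale leech_table =
  fixes Orb :: "orbit_label \<Rightarrow> vec24 set"
  assumes table: "leech_orbit_table Orb"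
begin

lemma bij_Orb: "bij_betw Orb UNIV {co0_orbit v | v. v \<in> leech \<and> leech_type v \<le> 16}"
  using table unfolding leech_orbit_table_def by blast

lemma card_Orb: "card (Orb x) = label_card x"
  using table unfolding leech_orbit_table_def by blast

lemma finite_Orb: "finite (Orb x)"
  using card_Orb[of x] label_card_pos[of x] card_ge_0_finite by metis

lemma Orb_nonempty: "Orb x \<noteq> {}"
  using card_Orb[of x] label_card_pos[of x] by force

lemma Orb_norm: "v \<in> Orb x \<Longrightarrow> v \<bullet> v = 2 * real (label_type x)"
  using table unfolding leech_orbit_table_def leech_type_def by fastforce

lemma Orb_eq_orbit:
  assumes "v \<in> Orb x"
  shows "Orb x = co0_orbit v" "v \<in> leech"
proof -
  have "Orb x \<in> {co0_orbit v | v. v \<in> leech \<and> leech_type v \<le> 16}"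
    using bij_Orb rangeI[of Orb x] unfolding bij_betw_def by (elim conjE) (simp only:)
  then obtain w where w: "Orb x = co0_orbit w" "w \<in> leech" by blast
  then show "Orb x = co0_orbit v" using assms co0_orbit_eq by simp
  show "v \<in> leech" using assms w Co0_leech by (auto simp: co0_orbit_def)
qed

lemma Orb_inj: "v \<in> Orb x \<Longrightarrow> v \<in> Orb y \<Longrightarrow> x = y"
  by (rule inj_onD[OF bij_betw_imp_inj_on[OF bij_Orb]]) (use Orb_eq_orbit(1)[of v x] Orb_eq_orbit(1)[of v y] in simp_all)

lemma Orb_exists:
  assumes "v \<in> leech" "v \<bullet> v \<le> 32"
  shows "\<exists>x. v \<in> Orb x"
proof -
  have "co0_orbit v \<in> {co0_orbit v | v. v \<in> leech \<and> leech_type v \<le> 16}"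
    using assms unfolding leech_type_def by force
  then have "co0_orbit v \<in> range Orb" using bij_Orb by (simp only: bij_betw_def)
  then show ?thesis using co0_orbit_refl by blast
qed

lemma Orb_shell: "Orb x \<subseteq> shell (label_type x)"
  unfolding shell_def using Orb_norm Orb_eq_orbit(2) by blast

lemma shell_eq_Union:
  assumes "n \<le> 16"
  shows "shell n = \<Union> (Orb ` {x. label_type x = n})"
proof
  show "shell n \<subseteq> \<Union> (Orb ` {x. label_type x = n})"
  proof
    fix v assume v: "v \<in> shell n"
    then have "v \<in> leech" "v \<bullet> v \<le> 32" using assms by (auto simp: shell_def)
    then obtain x where x: "v \<in> Orb x" using Orb_exists by blast
    then have "label_type x = n" using Orb_norm[OF x] v by (simp add: shell_def)
    with x show "v \<in> \<Union> (Orb ` {x. label_type x = n})" by blast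
  qed
  show "\<Union> (Orb ` {x. label_type x = n}) \<subseteq> shell n" using Orb_shell by blast
qed

lemma finite_shell: "n \<le> 16 \<Longrightarrow> finite (shell n)"
  unfolding shell_eq_Union using finite_label_set finite_Orb by blast

lemma sum_shell_Orb:
  fixes f :: "vec24 \<Rightarrow> 'a::comm_monoid_add"
  assumes "n \<le> 16"
  shows "(\<Sum>v\<in>shell n. f v) = (\<Sum>x | label_type x = n. \<Sum>v\<in>Orb x. f v)"
  unfolding shell_eq_Union[OF assms]
proof (rule sum.UNION_disjoint)
  show "\<forall>x\<in>{x. label_type x = n}. \<forall>y\<in>{x. label_type x = n}. x \<noteq> y \<longrightarrow> Orb x \<inter> Orb y = {}"
    by (auto dest: Orb_inj)
qed (simp_all add: finite_label_set finite_Orb)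

lemma card_shell: "n \<le> 16 \<Longrightarrow> card (shell n) = (\<Sum>x | label_type x = n. label_card x)"
  using sum_shell_Orb[of n "\<lambda>_. 1::nat"] by (simp add: card_Orb)

text \<open>Integrality of the type is read off the table, hence available up to norm 32 and no
  further.\<close>

lemma exists_shell:
  assumes "v \<in> leech" "v \<bullet> v \<le> 32"
  obtains n where "n \<le> 16" "v \<in> shell n"
  using Orb_exists[OF assms] Orb_shell label_type_le by blast

lemma shell_1: "shell 1 = {}"
  using shell_eq_Union[of 1] by (simp add: label_type_sets[unfolded One_nat_def])

lemma shell_0: "shell 0 = {0}"
proof -
  obtain v where "v \<in> Orb O2" using Orb_nonempty by blast
  then have "0 \<in> leech" using Orb_eq_orbit(2) zero_in_leech by blast
  then show ?thesis by (auto simp: shell_def)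
qed

lemma leech_nonempty: "leech \<noteq> {}"
  using shell_0 by (auto simp: shell_def)

text \<open>Each of these three types has a single orbit in the table; they are also the types of
  the translation vectors \<open>s\<close>.\<close>

lemma shell_transitive:
  assumes "t \<in> {2, 3, 4}" "u \<in> shell t" "v \<in> shell t"
  shows "\<exists>\<sigma>\<in>Co0. u = \<sigma> v"
proof -
  have "shell 2 = Orb O2" "shell 3 = Orb O3" "shell 4 = Orb O4"
    by (simp_all add: shell_eq_Union label_type_sets)
  then have "\<exists>x. shell t = Orb x" using assms(1) by blast
  then obtain x where "shell t = Orb x" ..
  then have "u \<in> co0_orbit v" using Orb_eq_orbit(1)[of v x] assms by simp
  then show ?thesis by (auto simp: co0_orbit_def)
qed

lemma ip_count_shell:
  "t \<in> {2, 3, 4} \<Longrightarrow> u \<in> shell t \<Longrightarrow> v \<in> shell t \<Longrightarrow> ip_count n j u = ip_count n j v"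
  using shell_transitive ip_count_Co0 by metis

lemma ip_count_Orb:
  assumes "u \<in> Orb x" "v \<in> Orb x"
  shows "ip_count t j u = ip_count t j v"
  using Orb_eq_orbit(1)[OF assms(2)] assms(1) ip_count_Co0 by (auto simp: co0_orbit_def)

text \<open>A nonzero vector of smaller norm would be short enough to be listed, and the table has
  no orbit of type 1.\<close>

lemma norm_ge_4:
  assumes "v \<in> leech" "v \<noteq> 0"
  shows "4 \<le> v \<bullet> v"
proof (rule ccontr)
  assume small: "\<not> 4 \<le> v \<bullet> v"
  then obtain n where n: "v \<in> shell n" using exists_shell[OF assms(1)] by force
  with small have "real n < 2" by (simp add: shell_def)
  then have "n = 0 \<or> n = 1" by auto
  then show False using n(1) assms(2) shell_0 shell_1 by auto
qed

end

section \<open>Second and fourth moments of the shells\<close>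

text \<open>Summing over the signs of b, c and d kills every monomial with an odd exponent: the
  degree is even, so an odd exponent of a forces an odd one among the others.\<close>

lemma even_signs_pow4:
  fixes a b c d :: real
  shows "(a + b + c + d) ^ 4 + (a + b + c - d) ^ 4 + (a + b - c + d) ^ 4 + (a + b - c - d) ^ 4
    + (a - b + c + d) ^ 4 + (a - b + c - d) ^ 4 + (a - b - c + d) ^ 4 + (a - b - c - d) ^ 4
    = 8 * (a ^ 4 + b ^ 4 + c ^ 4 + d ^ 4) + 48 * (a\<^sup>2 * b\<^sup>2 + a\<^sup>2 * c\<^sup>2 + a\<^sup>2 * d\<^sup>2
        + b\<^sup>2 * c\<^sup>2 + b\<^sup>2 * d\<^sup>2 + c\<^sup>2 * d\<^sup>2)"
  by (simp add: algebra_simps power4_eq_xxxx power2_eq_square)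

lemma sqrt2_pow4: "(sqrt 2 * x) ^ 4 = 4 * x ^ 4"
  using power_mult[of "sqrt 2" 2 2] by (simp add: power_mult_distrib)

lemma inner_single_pow:
  fixes y :: vec24
  shows "(y \<bullet> (sqrt 2 *\<^sub>R (2 *\<^sub>R axis i 1)))\<^sup>2 = 8 * (y $ i)\<^sup>2"
    and "(y \<bullet> (sqrt 2 *\<^sub>R (2 *\<^sub>R axis i 1))) ^ 4 = 64 * (y $ i) ^ 4"
proof -
  have "y \<bullet> (sqrt 2 *\<^sub>R (2 *\<^sub>R axis i 1)) = sqrt 2 * (2 * y $ i)"
    by (simp add: inner_axis)
  then show "(y \<bullet> (sqrt 2 *\<^sub>R (2 *\<^sub>R axis i 1)))\<^sup>2 = 8 * (y $ i)\<^sup>2"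
    "(y \<bullet> (sqrt 2 *\<^sub>R (2 *\<^sub>R axis i 1))) ^ 4 = 64 * (y $ i) ^ 4"
    by (simp_all only: sqrt2_pow4) (simp_all add: power_mult_distrib)
qed

lemma inner_pair:
  "y \<bullet> (sqrt 2 *\<^sub>R (axis i 1 + s *\<^sub>R axis j 1)) = sqrt 2 * (y $ i + s * y $ j)" for y :: vec24
  by (simp add: inner_add_right inner_axis)

lemma inner_tetrad:
  "y \<bullet> (sqrt 2 *\<^sub>R (axis i 1 + s *\<^sub>R axis j 1 + t *\<^sub>R axis k 1 + u *\<^sub>R axis l 1)) =
    sqrt 2 * (y $ i + s * y $ j + t * y $ k + u * y $ l)" for y :: vec24
  by (simp add: inner_add_right inner_axis)

context leech_table
begin

lemma pair_in_shell:
  fixes s :: int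
  assumes "i \<noteq> j" "s = 1 \<or> s = -1"
  shows "sqrt 2 *\<^sub>R (axis i 1 + real_of_int s *\<^sub>R axis j 1) \<in> shell 2"
proof -
  let ?z = "\<lambda>k. (if k = i then 1 else 0) + (if k = j then s else 0)"
  have "sqrt 2 *\<^sub>R (\<chi> k. real_of_int (?z k)) \<in> leech"
    using assms(2) by (intro leech_four_multiples leech_nonempty) (auto simp: sum.distrib)
  moreover have "(\<chi> k. real_of_int (?z k)) = axis i 1 + real_of_int s *\<^sub>R axis j 1"
    by (simp add: vec_eq_iff axis_def)
  moreover have "(axis i 1 + real_of_int s *\<^sub>R axis j 1) \<bullet>
      (axis i 1 + real_of_int s *\<^sub>R axis j 1 :: vec24) = 2"
    using assms by (auto simp: inner_add_left inner_add_right inner_axis_axis)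
  ultimately show ?thesis by (simp add: shell_def)
qed

lemma single_in_shell: "sqrt 2 *\<^sub>R (2 *\<^sub>R axis i 1) \<in> shell 4"
proof -
  let ?z = "\<lambda>k. if k = i then 2 else 0 :: int"
  have "sqrt 2 *\<^sub>R (\<chi> k. real_of_int (?z k)) \<in> leech"
    by (intro leech_four_multiples leech_nonempty) simp
  moreover have "(\<chi> k. real_of_int (?z k)) = 2 *\<^sub>R axis i 1"
    by (simp add: vec_eq_iff axis_def)
  ultimately show ?thesis by (simp add: shell_def inner_axis_axis)
qed

lemma tetrad_in_shell:
  fixes s t u :: int
  assumes "distinct [i, j, k, l]" "s = 1 \<or> s = -1" "t = 1 \<or> t = -1" "u = 1 \<or> u = -1"
  shows "sqrt 2 *\<^sub>R (axis i 1 + real_of_int s *\<^sub>R axis j 1 + real_of_int t *\<^sub>R axis k 1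
    + real_of_int u *\<^sub>R axis l 1) \<in> shell 4"
proof -
  let ?z = "\<lambda>n. (if n = i then 1 else 0) + (if n = j then s else 0) + (if n = k then t else 0)
    + (if n = l then u else 0)"
  let ?w = "axis i 1 + real_of_int s *\<^sub>R axis j 1 + real_of_int t *\<^sub>R axis k 1
    + real_of_int u *\<^sub>R axis l 1 :: vec24"
  have "even (\<Sum>n\<in>UNIV. ?z n)"
    using assms(2,3,4) by (simp add: sum.distrib) auto
  then have "sqrt 2 *\<^sub>R (\<chi> n. real_of_int (?z n)) \<in> leech"
    by (intro leech_four_multiples leech_nonempty)
  moreover have "(\<chi> n. real_of_int (?z n)) = ?w"
    by (simp add: vec_eq_iff axis_def)
  moreover have "?w \<bullet> ?w = 4"
    using assms(1) assms(2,3,4)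
    by (elim disjE) (auto simp: inner_diff_left inner_diff_right inner_add_left inner_add_right inner_axis_axis)
  ultimately show ?thesis by (simp add: shell_def)
qed

lemma moment_transitive:
  assumes "t \<in> {2, 3, 4}" "r \<in> shell t" "s \<in> shell t"
  shows "(\<Sum>y\<in>shell m. f (y \<bullet> r)) = (\<Sum>y\<in>shell m. f (y \<bullet> s))"
proof -
  obtain \<sigma> where "\<sigma> \<in> Co0" "r = \<sigma> s" using shell_transitive[OF assms] by blast
  then show ?thesis using sum_shell_Co0[of \<sigma> f s m] by simp
qed

text \<open>The mean is (y . y) (r . r) / 24, as for a spherical 2-design. Type 4 vectors along the
  axes make all coordinate moments equal, the trace gives their common value, and the minimal
  vectors with coordinates of equal and of opposite sign together cancel the mixed term.\<close>

lemma second_moment: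
  assumes r: "r \<in> shell 2"
  shows "(\<Sum>y\<in>shell m. (y \<bullet> r)\<^sup>2) = real m * real (card (shell m)) / 3"
proof -
  define Q where "Q i = (\<Sum>y\<in>shell m. (y $ i)\<^sup>2)" for i
  let ?a = "None :: pl23" and ?b = "Some 0 :: pl23"
  have Q_const: "Q i = Q ?a" for i
    using moment_transitive[of 4, OF _ single_in_shell[of i] single_in_shell[of ?a],
        where f = "\<lambda>x. x\<^sup>2" and m = m]
    unfolding inner_single_pow sum_distrib_left[symmetric] Q_def by simp
  have *: "(\<Sum>y\<in>shell m. (y \<bullet> r)\<^sup>2) = 2 * (\<Sum>y\<in>shell m. (y $ ?a + s * y $ ?b)\<^sup>2)"
    if "s = 1 \<or> s = - 1" for s :: int
    using moment_transitive[of 2, OF _ r pair_in_shell[of ?a ?b, OF _ that],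
        where f = "\<lambda>x. x\<^sup>2" and m = m]
    unfolding inner_pair power_mult_distrib sum_distrib_left[symmetric] by simp
  have "(\<Sum>y\<in>shell m. (y \<bullet> r)\<^sup>2) = 2 * (\<Sum>y\<in>shell m. (y $ ?a + y $ ?b)\<^sup>2)"
    "(\<Sum>y\<in>shell m. (y \<bullet> r)\<^sup>2) = 2 * (\<Sum>y\<in>shell m. (y $ ?a - y $ ?b)\<^sup>2)"
    using *[of 1] *[of "- 1"] by simp_all
  then have "(\<Sum>y\<in>shell m. (y \<bullet> r)\<^sup>2)
      = (\<Sum>y\<in>shell m. (y $ ?a + y $ ?b)\<^sup>2) + (\<Sum>y\<in>shell m. (y $ ?a - y $ ?b)\<^sup>2)"
    by linarith
  also have "\<dots> = 2 * Q ?a + 2 * Q ?b"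
    unfolding Q_def sum_distrib_left
    by (simp only: sum.distrib[symmetric], rule sum.cong)
      (simp_all add: power2_eq_square algebra_simps)
  finally have F: "(\<Sum>y\<in>shell m. (y \<bullet> r)\<^sup>2) = 4 * Q ?a" using Q_const[of ?b] by simp
  have "(\<Sum>i\<in>(UNIV::pl23 set). Q ?a) = (\<Sum>i\<in>UNIV. Q i)"
    by (rule sum.cong[OF refl Q_const[symmetric]])
  also have "\<dots> = (\<Sum>y\<in>shell m. y \<bullet> y)"
    unfolding Q_def inner_vec_def by (subst sum.swap) (simp add: power2_eq_square)
  also have "\<dots> = (\<Sum>y\<in>shell m. 2 * real m)" by (rule sum.cong) (auto simp: shell_def)
  finally have "24 * Q ?a = 2 * real m * real (card (shell m))"
    by simp
  with F show ?thesis by simp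
qed

text \<open>The mean is 3 (y . y)^2 (r . r)^2 / (24 * 26), as for a spherical 4-design. Three
  relations determine it: minimal vectors express \<open>F\<close> by \<open>A\<close> and
  \<open>B\<close>, the two shapes of type 4 vectors give A = 3 B, and all \<open>B i j\<close> add
  up to the sum of the squared norms.\<close>

lemma fourth_moment:
  assumes r: "r \<in> shell 2"
  shows "(\<Sum>y\<in>shell m. (y \<bullet> r) ^ 4) = 4 * (real m)\<^sup>2 * real (card (shell m)) / 13"
proof -
  define A where "A i = (\<Sum>y\<in>shell m. (y $ i) ^ 4)" for i
  define B where "B i j = (\<Sum>y\<in>shell m. (y $ i)\<^sup>2 * (y $ j)\<^sup>2)" for i j
  define F where "F = (\<Sum>y\<in>shell m. (y \<bullet> r) ^ 4)"
  let ?a = "None :: pl23" and ?b = "Some 0 :: pl23" and ?c = "Some 1 :: pl23" and ?d = "Some 2 :: pl23"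
  have single: "(\<Sum>y\<in>shell m. (y \<bullet> (sqrt 2 *\<^sub>R (2 *\<^sub>R axis i 1))) ^ 4) = 64 * A i" for i
    unfolding inner_single_pow sum_distrib_left[symmetric] A_def ..
  have A_const: "A i = A ?a" for i
    using moment_transitive[of 4, OF _ single_in_shell[of i] single_in_shell[of ?a],
        where f = "\<lambda>x. x ^ 4" and m = m]
    unfolding single by simp
  have pair: "F = 4 * (\<Sum>y\<in>shell m. (y $ i + s * y $ j) ^ 4)"
    if "i \<noteq> j" "s = 1 \<or> s = - 1" for s :: int and i j
    using moment_transitive[of 2, OF _ r pair_in_shell[OF that],
        where f = "\<lambda>x. x ^ 4" and m = m]
    unfolding inner_pair sqrt2_pow4 sum_distrib_left[symmetric] F_def by simp
  have F: "F = 8 * A ?a + 24 * B i j" if "i \<noteq> j" for i j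
  proof -
    have "F = 4 * (\<Sum>y\<in>shell m. (y $ i + y $ j) ^ 4)" "F = 4 * (\<Sum>y\<in>shell m. (y $ i - y $ j) ^ 4)"
      using pair[OF that, of 1] pair[OF that, of "- 1"] by simp_all
    moreover have "(\<Sum>y\<in>shell m. (y $ i + y $ j) ^ 4) + (\<Sum>y\<in>shell m. (y $ i - y $ j) ^ 4)
        = 2 * A i + 12 * B i j + 2 * A j"
      unfolding A_def B_def sum_distrib_left by (simp only: sum.distrib[symmetric], rule sum.cong)
        (simp_all add: power2_eq_square power4_eq_xxxx algebra_simps)
    ultimately show ?thesis using A_const[of i] A_const[of j] by simp
  qed
  have B_const: "B i j = B ?a ?b" if "i \<noteq> j" for i j
    using F[OF that] F[of ?a ?b] by simp
  \<comment> \<open>A vector along an axis and a tetrad have the same type, hence the same fourth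
    moment. This relation between \<open>A\<close> and \<open>B\<close> does not follow from the
    pairs.\<close>
  have tetrad: "64 * A ?a = 4 * (\<Sum>y\<in>shell m. (y $ ?a + s * y $ ?b + t * y $ ?c + u * y $ ?d) ^ 4)"
    if "s = 1 \<or> s = - 1" "t = 1 \<or> t = - 1" "u = 1 \<or> u = - 1" for s t u :: int
  proof -
    have "distinct [?a, ?b, ?c, ?d]" by simp
    from moment_transitive[of 4, OF _ single_in_shell[of ?a] tetrad_in_shell[OF this that],
        where f = "\<lambda>x. x ^ 4" and m = m]
    show ?thesis
      unfolding single inner_tetrad sqrt2_pow4 sum_distrib_left[symmetric] by simp
  qed
  define T where "T s t u = (\<Sum>y\<in>shell m. (y $ ?a + s * y $ ?b + t * y $ ?c + u * y $ ?d) ^ 4)"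
    for s t u :: int
  have "T s t u = 16 * A ?a" if "s \<in> {1, -1}" "t \<in> {1, -1}" "u \<in> {1, -1}" for s t u
    using tetrad[of s t u] that unfolding T_def by auto
  \<comment> \<open>Eight sign patterns, each equal to 16 A.\<close>
  then have "128 * A ?a = T 1 1 1 + T 1 1 (-1) + T 1 (-1) 1 + T 1 (-1) (-1)
      + T (-1) 1 1 + T (-1) 1 (-1) + T (-1) (-1) 1 + T (-1) (-1) (-1)"
    by simp
  also have "\<dots> = (\<Sum>y\<in>shell m. 8 * ((y $ ?a) ^ 4 + (y $ ?b) ^ 4 + (y $ ?c) ^ 4 + (y $ ?d) ^ 4)
      + 48 * ((y $ ?a)\<^sup>2 * (y $ ?b)\<^sup>2 + (y $ ?a)\<^sup>2 * (y $ ?c)\<^sup>2 + (y $ ?a)\<^sup>2 * (y $ ?d)\<^sup>2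
        + (y $ ?b)\<^sup>2 * (y $ ?c)\<^sup>2 + (y $ ?b)\<^sup>2 * (y $ ?d)\<^sup>2 + (y $ ?c)\<^sup>2 * (y $ ?d)\<^sup>2))"
    unfolding T_def even_signs_pow4[symmetric] sum.distrib by simp
  also have "\<dots> = 8 * (A ?a + A ?b + A ?c + A ?d)
      + 48 * (B ?a ?b + B ?a ?c + B ?a ?d + B ?b ?c + B ?b ?d + B ?c ?d)"
    unfolding A_def B_def by (simp add: sum.distrib flip: sum_distrib_left)
  also have "\<dots> = 32 * A ?a + 288 * B ?a ?b"
    using A_const[of ?b] A_const[of ?c] A_const[of ?d] B_const[of ?a ?c] B_const[of ?a ?d]
      B_const[of ?b ?c] B_const[of ?b ?d] B_const[of ?c ?d] by simp
  finally have AB: "A ?a = 3 * B ?a ?b" by simp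
  have "(\<Sum>i\<in>UNIV. \<Sum>j\<in>UNIV. B i j) = (\<Sum>y\<in>shell m. (y \<bullet> y)\<^sup>2)"
  proof -
    have "(\<Sum>i\<in>UNIV. \<Sum>j\<in>UNIV. B i j) = (\<Sum>i\<in>UNIV. \<Sum>y\<in>shell m. \<Sum>j\<in>UNIV. (y $ i)\<^sup>2 * (y $ j)\<^sup>2)"
      unfolding B_def by (rule sum.cong[OF refl sum.swap])
    also have "\<dots> = (\<Sum>y\<in>shell m. \<Sum>i\<in>UNIV. \<Sum>j\<in>UNIV. (y $ i)\<^sup>2 * (y $ j)\<^sup>2)"
      by (rule sum.swap)
    also have "\<dots> = (\<Sum>y\<in>shell m. (y \<bullet> y)\<^sup>2)"
      by (simp add: inner_vec_def power2_eq_square sum_product)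
    finally show ?thesis .
  qed
  also have "\<dots> = (\<Sum>y\<in>shell m. (2 * real m)\<^sup>2)" by (rule sum.cong) (auto simp: shell_def)
  also have "\<dots> = 4 * (real m)\<^sup>2 * real (card (shell m))" by (simp add: power_mult_distrib)
  finally have total: "(\<Sum>i\<in>UNIV. \<Sum>j\<in>UNIV. B i j) = 4 * (real m)\<^sup>2 * real (card (shell m))" .
  have "(\<Sum>j\<in>UNIV. B i j) = A ?a + 23 * B ?a ?b" for i
  proof -
    have "(\<Sum>j\<in>UNIV. B i j) = B i i + (\<Sum>j\<in>UNIV - {i}. B i j)"
      by (rule sum.remove) simp_all
    also have "B i i = A i" unfolding A_def B_def by (simp flip: power_add)
    also have "(\<Sum>j\<in>UNIV - {i}. B i j) = (\<Sum>j\<in>UNIV - {i}. B ?a ?b)"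
      by (rule sum.cong) (auto intro: B_const)
    finally show ?thesis using A_const[of i] by simp
  qed
  with total have "24 * (A ?a + 23 * B ?a ?b) = 4 * (real m)\<^sup>2 * real (card (shell m))"
    by simp
  with AB F[of ?a ?b] show ?thesis unfolding F_def[symmetric] by simp
qed

end

section \<open>Inner product distributions with respect to a minimal vector\<close>

lemma sum_even_int:
  fixes h :: "int \<Rightarrow> real"
  assumes "\<And>j. h (- j) = h j"
  shows "(\<Sum>j\<in>{-7..7}. h j) = h 0 + 2 * (h 1 + h 2 + h 3 + h 4 + h 5 + h 6 + h 7)"
proof -
  have "{-7..7 :: int} = {-7, -6, -5, -4, -3, -2, -1, 0, 1, 2, 3, 4, 5, 6, 7}" by (auto; arith)
  then have "(\<Sum>j\<in>{-7..7}. h j) = h (-7) + h (-6) + h (-5) + h (-4) + h (-3) + h (-2) + h (-1) + h 0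
      + h 1 + h 2 + h 3 + h 4 + h 5 + h 6 + h 7"
    by simp
  then show ?thesis unfolding assms by simp
qed

context leech_table
begin

text \<open>The lower bound on the inner product says exactly that \<open>v - s\<close> has norm at
  most 32, so its type is an integer, and polarisation does the rest.\<close>

lemma inner_integral:
  assumes "v \<in> shell n" "s \<in> shell t" "real n + real t - 16 \<le> v \<bullet> s"
  shows "\<exists>j :: int. v \<bullet> s = real_of_int j"
proof -
  have vs: "v \<in> leech" "s \<in> leech" "v \<bullet> v = 2 * real n" "s \<bullet> s = 2 * real t"
    using assms(1,2) by (auto simp: shell_def)
  have norm: "(v - s) \<bullet> (v - s) = 2 * real n + 2 * real t - 2 * (v \<bullet> s)"
    using vs by (simp add: inner_diff_left inner_diff_right inner_commute)
  then have "(v - s) \<bullet> (v - s) \<le> 32" using assms(3) by simp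
  then obtain k where "v - s \<in> shell k" by (rule exists_shell[OF leech_diff[OF vs(1,2)]])
  then have "v \<bullet> s = real_of_int (int n + int t - int k)" using norm by (simp add: shell_def)
  then show ?thesis ..
qed

lemma inner_integral_small:
  assumes "v \<in> shell n" "s \<in> shell t" "n + t \<le> 16"
  shows "\<exists>j :: int. v \<bullet> s = real_of_int j"
proof (cases "v \<bullet> s \<ge> 0")
  case True
  then have "real n + real t - 16 \<le> v \<bullet> s" using assms(3) by linarith
  then show ?thesis by (rule inner_integral[OF assms(1,2)])
next
  case False
  have s: "- s \<in> shell t" using assms(2) by (simp add: shell_def leech_minus)
  have "real n + real t - 16 \<le> v \<bullet> - s"
    unfolding inner_minus_right using False assms(3) by linarith
  from inner_integral[OF assms(1) s this] obtain j where "v \<bullet> - s = real_of_int j" ..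
  then have "v \<bullet> s = real_of_int (- j)" by simp
  then show ?thesis ..
qed

lemma sum_shell_even:
  fixes f :: "real \<Rightarrow> real"
  assumes r: "r \<in> shell 2" and m: "m \<le> 7" and even: "\<And>x. f (- x) = f x"
  shows "(\<Sum>y\<in>shell m. f (y \<bullet> r)) = real (ip_count m 0 r) * f 0
    + 2 * (real (ip_count m 1 r) * f 1 + real (ip_count m 2 r) * f 2 + real (ip_count m 3 r) * f 3
      + real (ip_count m 4 r) * f 4 + real (ip_count m 5 r) * f 5 + real (ip_count m 6 r) * f 6
      + real (ip_count m 7 r) * f 7)"
proof -
  let ?S = "shell m" and ?T = "{-7..7} :: int set"
  have int: "\<exists>j. y \<bullet> r = real_of_int j" if "y \<in> ?S" for y
    by (rule inner_integral_small[OF that r]) (use m in simp)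
  \<comment> \<open>The norms are at most 14 and 4, and 14 * 4 = 56 < 64; hence the range from -7 to
    7.\<close>
  have bound: "\<bar>y \<bullet> r\<bar> < 8" if "y \<in> ?S" for y
  proof -
    have "(y \<bullet> r)\<^sup>2 \<le> (y \<bullet> y) * (r \<bullet> r)" by (rule Cauchy_Schwarz_ineq)
    also have "\<dots> < 8\<^sup>2" using that r m by (simp add: shell_def)
    finally have "\<bar>y \<bullet> r\<bar>\<^sup>2 < 8\<^sup>2" by simp
    then show ?thesis by (rule power_less_imp_less_base) simp
  qed
  \<comment> \<open>Integrality is known only on the shell, so the floor serves as an integer-valued
    key for grouping.\<close>
  have "(\<lambda>y. \<lfloor>y \<bullet> r\<rfloor>) ` ?S \<subseteq> ?T"
  proof
    fix j assume "j \<in> (\<lambda>y. \<lfloor>y \<bullet> r\<rfloor>) ` ?S"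
    then obtain y where y: "y \<in> ?S" "j = \<lfloor>y \<bullet> r\<rfloor>" by blast
    then have "y \<bullet> r = real_of_int j" using int[OF y(1)] by auto
    then have "- 8 < real_of_int j" "real_of_int j < 8" using bound[OF y(1)] by linarith+
    then show "j \<in> ?T" by simp
  qed
  then have "(\<Sum>y\<in>?S. f (y \<bullet> r)) = (\<Sum>j\<in>?T. \<Sum>y | y \<in> ?S \<and> \<lfloor>y \<bullet> r\<rfloor> = j. f (y \<bullet> r))"
    using m by (intro sum.group[symmetric] finite_shell) auto
  also have "\<dots> = (\<Sum>j\<in>?T. real (ip_count m j r) * f j)"
  proof (rule sum.cong[OF refl])
    fix j assume "j \<in> ?T"
    have eq: "{y. y \<in> ?S \<and> \<lfloor>y \<bullet> r\<rfloor> = j} = {y \<in> ?S. r \<bullet> y = real_of_int j}"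
      using int by (fastforce simp: inner_commute)
    have "(\<Sum>y | y \<in> ?S \<and> \<lfloor>y \<bullet> r\<rfloor> = j. f (y \<bullet> r)) = (\<Sum>y\<in>{y \<in> ?S. r \<bullet> y = real_of_int j}. f j)"
      unfolding eq by (rule sum.cong) (auto simp: inner_commute)
    then show "(\<Sum>y | y \<in> ?S \<and> \<lfloor>y \<bullet> r\<rfloor> = j. f (y \<bullet> r)) = real (ip_count m j r) * f j"
      by (simp add: ip_count_def)
  qed
  finally show ?thesis
    using sum_even_int[of "\<lambda>j. real (ip_count m j r) * f j"] by (simp add: ip_count_minus even)
qed

text \<open>The moments of order 0, 2 and 4, sorted by the value of the inner product. Counts for
  values from 3 on come from shorter shells, so three equations face three unknowns.\<close>

lemma ip_count_equations:
  assumes r: "r \<in> shell 2" and m: "m \<le> 7"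
  shows "real (ip_count m 0 r) + 2 * (real (ip_count m 1 r) + real (ip_count m 2 r)
      + real (ip_count m 3 r) + real (ip_count m 4 r) + real (ip_count m 5 r)
      + real (ip_count m 6 r) + real (ip_count m 7 r)) = real (card (shell m))" (is ?eq0)
    and "6 * (real (ip_count m 1 r) + 4 * real (ip_count m 2 r)
      + 9 * real (ip_count m 3 r) + 16 * real (ip_count m 4 r) + 25 * real (ip_count m 5 r)
      + 36 * real (ip_count m 6 r) + 49 * real (ip_count m 7 r)) = real m * real (card (shell m))" (is ?eq2)
    and "13 * (real (ip_count m 1 r) + 16 * real (ip_count m 2 r)
      + 81 * real (ip_count m 3 r) + 256 * real (ip_count m 4 r) + 625 * real (ip_count m 5 r)
      + 1296 * real (ip_count m 6 r) + 2401 * real (ip_count m 7 r))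
      = 2 * (real m)\<^sup>2 * real (card (shell m))" (is ?eq4)
proof -
  have "(\<Sum>y\<in>shell m. (1 :: real)) = real (ip_count m 0 r) + 2 * (real (ip_count m 1 r)
      + real (ip_count m 2 r) + real (ip_count m 3 r) + real (ip_count m 4 r) + real (ip_count m 5 r)
      + real (ip_count m 6 r) + real (ip_count m 7 r))"
    by (subst sum_shell_even[OF r m]) simp_all
  then show ?eq0 by simp
  have "(\<Sum>y\<in>shell m. (y \<bullet> r)\<^sup>2) = real (ip_count m 1 r) * 2 + real (ip_count m 2 r) * 8
      + real (ip_count m 3 r) * 18 + real (ip_count m 4 r) * 32 + real (ip_count m 5 r) * 50
      + real (ip_count m 6 r) * 72 + real (ip_count m 7 r) * 98"
    by (subst sum_shell_even[OF r m]) simp_all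
  then show ?eq2 unfolding second_moment[OF r] by (simp add: field_simps)
  have "(\<Sum>y\<in>shell m. (y \<bullet> r) ^ 4) = real (ip_count m 1 r) * 2 + real (ip_count m 2 r) * 32
      + real (ip_count m 3 r) * 162 + real (ip_count m 4 r) * 512 + real (ip_count m 5 r) * 1250
      + real (ip_count m 6 r) * 2592 + real (ip_count m 7 r) * 4802"
    by (subst sum_shell_even[OF r m]) simp_all
  then show ?eq4 unfolding fourth_moment[OF r] by (simp add: field_simps)
qed

text \<open>This is the map from \<open>y\<close> to \<open>w - y\<close>. For minimal
  \<open>w\<close> it turns the value j into 4 - j and the type n into n - j + 2, so each j >= 3
  leads to a smaller type, while j = 2 leads back to itself.\<close>

lemma ip_count_reflect:
  assumes "w \<in> shell t" "int m = int n - j + int t"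
  shows "ip_count n j w = ip_count m (2 * int t - j) w"
proof -
  have "ip_count n j w = ip_count m (j - 2 * 1 * int t) w"
    by (rule ip_count_shift[OF assms(1)]) (simp_all add: assms(2))
  also have "\<dots> = ip_count m (- (j - 2 * 1 * int t)) w" by (rule ip_count_minus[symmetric])
  finally show ?thesis by simp
qed

lemma ip_count_shell_0: "ip_count 0 j w = (if j = 0 then 1 else 0)"
  unfolding ip_count_def shell_0 by (auto simp: Collect_conv_if)

lemma ip_count_shell_1: "ip_count (Suc 0) j w = 0"
  unfolding ip_count_def shell_1[unfolded One_nat_def] by simp

lemma ip_count_minimal_0:
  assumes "r \<in> shell 2" "8 * int m < j\<^sup>2"
  shows "ip_count m j r = 0"
  by (rule ip_count_eq_0[of r 2]) (use assms in \<open>auto simp: shell_def\<close>)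

lemma card_shell_values:
  "card (shell 2) = 3 * 65520" "card (shell 3) = 256 * 65520" "card (shell 4) = 6075 * 65520"
  "card (shell 5) = 70656 * 65520" "card (shell 6) = 525300 * 65520"
  "card (shell 7) = 2861568 * 65520"
  by (simp_all add: card_shell label_type_sets)

section \<open>Distributions over the shells of types 2 to 7, by recursion on the type\<close>

context
  fixes r assumes r: "r \<in> shell 2"
begin

text \<open>The recursion starts here: value 3 would produce a vector of type 1, and value 4
  produces the zero vector, that is, \<open>y = r\<close>.\<close>

lemma ip_count_2: "ip_count 2 0 r = 93150" "ip_count 2 1 r = 47104" "ip_count 2 2 r = 4600" "ip_count 2 3 r = 0"
proof -
  have n3: "ip_count 2 3 r = 0"
    using ip_count_reflect[OF r, of 1 2 3] by (simp add: ip_count_shell_1)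
  have n4: "ip_count 2 4 r = 1"
    using ip_count_reflect[OF r, of 0 2 4] by (simp add: ip_count_shell_0)
  have n5: "ip_count 2 5 r = 0" by (rule ip_count_minimal_0[OF r]) simp
  have n6: "ip_count 2 6 r = 0" by (rule ip_count_minimal_0[OF r]) simp
  have n7: "ip_count 2 7 r = 0" by (rule ip_count_minimal_0[OF r]) simp
  note eqs = ip_count_equations[OF r, of 2, unfolded n3 n4 n5 n6 n7 card_shell_values, simplified]
  have "real (ip_count 2 0 r) = 93150" "real (ip_count 2 1 r) = 47104" "real (ip_count 2 2 r) = 4600"
    using eqs by linarith+
  then show "ip_count 2 0 r = 93150" "ip_count 2 1 r = 47104" "ip_count 2 2 r = 4600" by linarith+
  show "ip_count 2 3 r = 0" by (rule n3)
qed

lemma ip_count_3: "ip_count 3 0 r = 6476800" "ip_count 3 1 r = 4147200" "ip_count 3 2 r = 953856"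
proof -
  have n3: "ip_count 3 3 r = 47104"
    using ip_count_reflect[OF r, of 2 3 3] by (simp add: ip_count_2)
  have n4: "ip_count 3 4 r = 0"
    using ip_count_reflect[OF r, of 1 3 4] by (simp add: ip_count_shell_1)
  have n5: "ip_count 3 5 r = 0" by (rule ip_count_minimal_0[OF r]) simp
  have n6: "ip_count 3 6 r = 0" by (rule ip_count_minimal_0[OF r]) simp
  have n7: "ip_count 3 7 r = 0" by (rule ip_count_minimal_0[OF r]) simp
  note eqs = ip_count_equations[OF r, of 3, unfolded n3 n4 n5 n6 n7 card_shell_values, simplified]
  have "real (ip_count 3 0 r) = 6476800" "real (ip_count 3 1 r) = 4147200" "real (ip_count 3 2 r) = 953856"
    using eqs by linarith+
  then show "ip_count 3 0 r = 6476800" "ip_count 3 1 r = 4147200" "ip_count 3 2 r = 953856" by linarith+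
qed

lemma ip_count_4: "ip_count 4 0 r = 133204500" "ip_count 4 1 r = 95385600" "ip_count 4 2 r = 32788800"
proof -
  have n3: "ip_count 4 3 r = 4147200"
    using ip_count_reflect[OF r, of 3 4 3] by (simp add: ip_count_3)
  have n4: "ip_count 4 4 r = 93150"
    using ip_count_reflect[OF r, of 2 4 4] by (simp add: ip_count_2)
  have n5: "ip_count 4 5 r = 0"
    using ip_count_reflect[OF r, of 1 4 5] by (simp add: ip_count_shell_1)
  have n6: "ip_count 4 6 r = 0" by (rule ip_count_minimal_0[OF r]) simp
  have n7: "ip_count 4 7 r = 0" by (rule ip_count_minimal_0[OF r]) simp
  note eqs = ip_count_equations[OF r, of 4, unfolded n3 n4 n5 n6 n7 card_shell_values, simplified]
  have "real (ip_count 4 0 r) = 133204500" "real (ip_count 4 1 r) = 95385600" "real (ip_count 4 2 r) = 32788800"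
    using eqs by linarith+
  then show "ip_count 4 0 r = 133204500" "ip_count 4 1 r = 95385600" "ip_count 4 2 r = 32788800" by linarith+
qed

lemma ip_count_5: "ip_count 5 0 r = 1384998912" "ip_count 5 1 r = 1062195200"
proof -
  have n3: "ip_count 5 3 r = 95385600"
    using ip_count_reflect[OF r, of 4 5 3] by (simp add: ip_count_4)
  have n4: "ip_count 5 4 r = 6476800"
    using ip_count_reflect[OF r, of 3 5 4] by (simp add: ip_count_3)
  have n5: "ip_count 5 5 r = 47104"
    using ip_count_reflect[OF r, of 2 5 5] by (simp add: ip_count_2 ip_count_minus[of _ 1])
  have n6: "ip_count 5 6 r = 0"
    using ip_count_reflect[OF r, of 1 5 6] by (simp add: ip_count_shell_1)
  have n7: "ip_count 5 7 r = 0" by (rule ip_count_minimal_0[OF r]) simp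
  note eqs = ip_count_equations[OF r, of 5, unfolded n3 n4 n5 n6 n7 card_shell_values, simplified]
  have "real (ip_count 5 0 r) = 1384998912" "real (ip_count 5 1 r) = 1062195200" "real (ip_count 5 2 r) = 458086400"
    using eqs by linarith+
  then show "ip_count 5 0 r = 1384998912" "ip_count 5 1 r = 1062195200" by linarith+
qed

lemma ip_count_6: "ip_count 6 0 r = 9403968600" "ip_count 6 1 r = 7535462400"
proof -
  have n3: "ip_count 6 3 r = 1062195200"
    using ip_count_reflect[OF r, of 5 6 3] by (simp add: ip_count_5)
  have n4: "ip_count 6 4 r = 133204500"
    using ip_count_reflect[OF r, of 4 6 4] by (simp add: ip_count_4)
  have n5: "ip_count 6 5 r = 4147200"
    using ip_count_reflect[OF r, of 3 6 5] by (simp add: ip_count_3 ip_count_minus[of _ 1])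
  have n6: "ip_count 6 6 r = 4600"
    using ip_count_reflect[OF r, of 2 6 6] by (simp add: ip_count_2 ip_count_minus[of _ 2])
  have n7: "ip_count 6 7 r = 0" by (rule ip_count_minimal_0[OF r]) simp
  note eqs = ip_count_equations[OF r, of 6, unfolded n3 n4 n5 n6 n7 card_shell_values, simplified]
  have "real (ip_count 6 0 r) = 9403968600" "real (ip_count 6 1 r) = 7535462400" "real (ip_count 6 2 r) = 3771829800"
    using eqs by linarith+
  then show "ip_count 6 0 r = 9403968600" "ip_count 6 1 r = 7535462400" by linarith+
qed

text \<open>This value is the right side of the equation for type 15 and inner product 8.\<close>

lemma ip_count_7: "ip_count 7 0 r = 47406643200"
proof -
  have n3: "ip_count 7 3 r = 7535462400"
    by (rule trans[OF _ ip_count_6(2)]) (use ip_count_reflect[OF r, of 6 7 3] in simp)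
  have n4: "ip_count 7 4 r = 1384998912"
    using ip_count_reflect[OF r, of 5 7 4] by (simp add: ip_count_5)
  have n5: "ip_count 7 5 r = 95385600"
    using ip_count_reflect[OF r, of 4 7 5] by (simp add: ip_count_4 ip_count_minus[of _ 1])
  have n6: "ip_count 7 6 r = 953856"
    using ip_count_reflect[OF r, of 3 7 6] by (simp add: ip_count_3 ip_count_minus[of _ 2])
  have n7: "ip_count 7 7 r = 0"
    using ip_count_reflect[OF r, of 2 7 7] by (simp add: ip_count_2 ip_count_minus[of _ 3])
  note eqs = ip_count_equations[OF r, of 7, unfolded n3 n4 n5 n6 n7 card_shell_values, simplified]
  have "real (ip_count 7 0 r) = 47406643200" "real (ip_count 7 1 r) = 39253082112" "real (ip_count 7 2 r) = 21771763200"
    using eqs by linarith+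
  then show "ip_count 7 0 r = 47406643200" by linarith
qed

end

end

section \<open>Solving the orbit equations\<close>

text \<open>Each unknown is found from its residue modulo a common divisor \<open>g\<close> of the other coefficients.\<close>

lemma residue_cases:
  fixes c x g K T B M :: nat
  assumes "c * x + g * K = T" "x \<le> B" "K \<le> M"
  shows "x \<in> set (filter (\<lambda>x. c * x \<le> T \<and> (T - c * x) mod g = 0 \<and> (T - c * x) div g \<le> M) [0..<Suc B])"
proof -
  have "c * x \<le> T" "T - c * x = g * K" using assms(1) by auto
  then show ?thesis using assms(2,3) by (cases "g = 0") (auto simp del: upt_Suc)
qed

text \<open>In this series the two numbers in the name are the type of the orbits and the inner
  product j with \<open>s\<close>. Coefficients are orbit sizes divided by 65520; the right side is
  the size of the shell of \<open>s\<close> times an inner product count, divided likewise; the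
  bounds come from \<open>ip_count_bound\<close>. The unknowns are taken in an order in which a
  common divisor of the remaining coefficients leaves few candidates.\<close>

lemma orbit_equation_10_8:
  fixes a b c :: nat
  assumes eq: "143078400 * a + 279450 * b + 1430784 * c = 279450"
    and bounds: "a \<le> 1" "b \<le> 1" "c \<le> 1"
  shows "a = 0 \<and> b = 1 \<and> c = 0"
proof -
  have a0: "a = 0"
    using residue_cases[of 143078400 a 11178 "25 * b + 128 * c" 279450 1 153] eq bounds
    by (auto simp: upt_rec)
  have b1: "b = 1"
    using residue_cases[of 279450 b 1430784 "c" 279450 1 1] eq bounds a0
    by (auto simp: upt_rec)
  show ?thesis using eq a0 b1 by simp
qed

lemma orbit_equation_11_8:
  fixes a b :: nat
  assumes eq: "19430400 * a + 393465600 * b = 19430400"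
    and bounds: "a \<le> 2" "b \<le> 2"
  shows "a = 1 \<and> b = 0"
proof -
  have a0: "a = 1"
    using residue_cases[of 19430400 a 393465600 "b" 19430400 2 2] eq bounds
    by (auto simp: upt_rec)
  show ?thesis using eq a0 by simp
qed

lemma orbit_equation_12_8:
  fixes a b c d e f :: nat
  assumes eq: "256 * a + 141312 * b + 12441600 * c + 2049300 * d + 393465600 * e + 667699200 * f = 399613500"
    and bounds: "a \<le> 3" "b \<le> 3" "c \<le> 3" "d \<le> 3" "e \<le> 3" "f \<le> 3"
  shows "a = 0 \<and> b = 0 \<and> c = 0 \<and> d = 3 \<and> e = 1 \<and> f = 0"
proof -
  have d0: "d = 3"
    using residue_cases[of 2049300 d 256 "a + 552 * b + 48600 * c + 1536975 * e + 2608200 * f" 399613500 3 12582984] eq bounds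
    by (auto simp: upt_rec)
  have f1: "f = 0"
    using residue_cases[of 667699200 f 256 "a + 552 * b + 48600 * c + 1536975 * e" 393465600 3 4758384] eq bounds d0
    by (auto simp: upt_rec)
  have e2: "e = 1"
    using residue_cases[of 393465600 e 256 "a + 552 * b + 48600 * c" 393465600 3 147459] eq bounds d0 f1
    by (auto simp: upt_rec)
  show ?thesis using eq d0 f1 e2 by simp
qed

lemma orbit_equation_12_9:
  fixes a b c d e f :: nat
  assumes eq: "256 * a + 141312 * b + 12441600 * c + 2049300 * d + 393465600 * e + 667699200 * f = 141312"
    and bounds: "a \<le> 1" "b \<le> 1" "c \<le> 1" "d \<le> 1" "e \<le> 1" "f \<le> 1"
  shows "a = 0 \<and> b = 1 \<and> c = 0 \<and> d = 0 \<and> e = 0 \<and> f = 0"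
proof -
  have a0: "a = 0"
    using residue_cases[of 256 a 12 "11776 * b + 1036800 * c + 170775 * d + 32788800 * e + 55641600 * f" 141312 1 89649751] eq bounds
    by (auto simp: upt_rec)
  have b1: "b = 1"
    using residue_cases[of 141312 b 8100 "1536 * c + 253 * d + 48576 * e + 82432 * f" 141312 1 132797] eq bounds a0
    by (auto simp: upt_rec)
  show ?thesis using eq a0 b1 by simp
qed

lemma orbit_equation_13_8:
  fixes a b c :: nat
  assumes eq: "12441600 * a + 1007271936 * b + 1573862400 * c = 4154996736"
    and bounds: "a \<le> 4" "b \<le> 4" "c \<le> 4"
  shows "a = 0 \<and> b = 1 \<and> c = 2"
proof -
  have a0: "a = 0"
    using residue_cases[of 12441600 a 62954496 "16 * b + 25 * c" 4154996736 4 164] eq bounds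
    by (auto simp: upt_rec)
  have b1: "b = 1"
    using residue_cases[of 1007271936 b 1573862400 "c" 4154996736 4 4] eq bounds a0
    by (auto simp: upt_rec)
  have c2: "c = 2"
    using residue_cases[of 1573862400 c 1 "0" 3147724800 4 0] eq bounds a0 b1
    by (auto simp: upt_rec)
  show ?thesis using a0 b1 c2 by simp
qed

lemma orbit_equation_13_9:
  fixes a b c :: nat
  assumes eq: "12441600 * a + 1007271936 * b + 1573862400 * c = 12441600"
    and bounds: "a \<le> 1" "b \<le> 1" "c \<le> 1"
  shows "a = 1 \<and> b = 0 \<and> c = 0"
proof -
  have a0: "a = 1"
    using residue_cases[of 12441600 a 62954496 "16 * b + 25 * c" 12441600 1 41] eq bounds
    by (auto simp: upt_rec)
  show ?thesis using eq a0 by simp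
qed

lemma orbit_equation_14_8:
  fixes a b c d e :: nat
  assumes eq: "286156800 * a + 5508518400 * b + 13800 * c + 19430400 * d + 49183200 * e = 28211905800"
    and bounds: "a \<le> 7" "b \<le> 7" "c \<le> 7" "d \<le> 7" "e \<le> 7"
  shows "a = 1 \<and> b = 5 \<and> c = 1 \<and> d = 2 \<and> e = 7"
proof -
  have b0: "b = 5"
    using residue_cases[of 5508518400 b 13800 "20736 * a + c + 1408 * d + 3564 * e" 28211905800 7 179963] eq bounds
    by (auto simp: upt_rec)
  \<comment> \<open>Residues alone leave two candidates here and two for \<open>c\<close>, hence the
    case distinction.\<close>
  have a1: "a = 1 \<or> a = 2"
    using residue_cases[of 286156800 a 13800 "c + 1408 * d + 3564 * e" 669313800 7 34811] eq bounds b0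
    by (auto simp: upt_rec)
  have c2: "c = 1 \<or> c = 5"
    using residue_cases[of 13800 c 55200 "5184 * a + 352 * d + 891 * e" 669313800 7 19069] eq bounds b0 a1
    by (auto simp: upt_rec)
  have "a = 1 \<or> a = 2"
    by (rule a1)
  then show ?thesis
  proof (elim disjE)
    assume ax: "a = 1"
    have e3: "e = 6 \<or> e = 7"
      using residue_cases[of 49183200 e 13800 "c + 1408 * d" 383157000 7 9861] eq bounds b0 c2 ax
      by (auto simp: upt_rec)
    have c4: "c = 1"
      using residue_cases[of 13800 c 607200 "32 * d + 81 * e" 383157000 5 791] eq bounds b0 c2 ax e3
      by (auto simp: upt_rec)
    have d5: "d = 2"
      using residue_cases[of 19430400 d 49183200 "e" 383143200 7 7] eq bounds b0 c2 ax e3 c4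
      by (auto simp: upt_rec)
    have e6: "e = 7"
      using residue_cases[of 49183200 e 1 "0" 344282400 7 0] eq bounds b0 c2 ax e3 c4 d5
      by (auto simp: upt_rec)
    show ?thesis using b0 c2 ax e3 c4 d5 e6 by simp
  next
    assume ax: "a = 2"
    \<comment> \<open>Division by 13800 leaves c congruent to 33 modulo 44, which neither 1 nor 5
      satisfies.\<close>
    have c3: "False"
      using residue_cases[of 13800 c 607200 "32 * d + 81 * e" 97000200 5 791] eq bounds b0 c2 ax
      by (auto simp: upt_rec)
    then show ?thesis ..
  qed
qed

lemma orbit_equation_14_9:
  fixes a b c d e :: nat
  assumes eq: "286156800 * a + 5508518400 * b + 13800 * c + 19430400 * d + 49183200 * e = 286156800"
    and bounds: "a \<le> 2" "b \<le> 2" "c \<le> 2" "d \<le> 2" "e \<le> 2"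
  shows "a = 1 \<and> b = 0 \<and> c = 0 \<and> d = 0 \<and> e = 0"
proof -
  have b0: "b = 0"
    using residue_cases[of 5508518400 b 13800 "20736 * a + c + 1408 * d + 3564 * e" 286156800 2 51418] eq bounds
    by (auto simp: upt_rec)
  have a1: "a = 1"
    using residue_cases[of 286156800 a 13800 "c + 1408 * d + 3564 * e" 286156800 2 9946] eq bounds b0
    by (auto simp: upt_rec)
  show ?thesis using eq b0 a1 by simp
qed

lemma orbit_equation_14_10:
  fixes a b c d e :: nat
  assumes eq: "286156800 * a + 5508518400 * b + 13800 * c + 19430400 * d + 49183200 * e = 13800"
    and bounds: "a \<le> 1" "b \<le> 1" "c \<le> 1" "d \<le> 1" "e \<le> 1"
  shows "a = 0 \<and> b = 0 \<and> c = 1 \<and> d = 0 \<and> e = 0"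
proof -
  have a0: "a = 0"
    using residue_cases[of 286156800 a 13800 "399168 * b + c + 1408 * d + 3564 * e" 13800 1 404141] eq bounds
    by (auto simp: upt_rec)
  have b1: "b = 0"
    using residue_cases[of 5508518400 b 13800 "c + 1408 * d + 3564 * e" 13800 1 4973] eq bounds a0
    by (auto simp: upt_rec)
  have c2: "c = 1"
    using residue_cases[of 13800 c 607200 "32 * d + 81 * e" 13800 1 113] eq bounds a0 b1
    by (auto simp: upt_rec)
  show ?thesis using eq a0 b1 c2 by simp
qed

text \<open>Since 8012390400 = 6 * 1335398400, lowering \<open>d\<close> by 1 and raising
  \<open>b\<close> by 6 preserves the equation. Three solutions lie within the bounds; deciding
  among them takes the geometry of the classes.\<close>

lemma orbit_equation_15_8:
  fixes a b c d e :: nat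
  assumes eq: "2861568 * a + 1335398400 * b + 19430400 * c + 8012390400 * d + 3147724800 * e = 142219929600"
    and bounds: "a \<le> 15" "b \<le> 15" "c \<le> 15" "d \<le> 15" "e \<le> 15"
  shows "a = 0 \<and> c = 0 \<and> e = 7 \<and> (b = 12 \<and> d = 13 \<or> b = 6 \<and> d = 14 \<or> b = 0 \<and> d = 15)"
proof -
  have a0: "a = 0"
    using residue_cases[of 2861568 a 1766400 "756 * b + 11 * c + 4536 * d + 1782 * e" 142219929600 15 106275] eq bounds
    by (auto simp: upt_rec)
  have c1: "c = 0"
    using residue_cases[of 19430400 c 95385600 "14 * b + 84 * d + 33 * e" 142219929600 15 1965] eq bounds a0
    by (auto simp: upt_rec)
  have e2: "e = 7"
    using residue_cases[of 3147724800 e 1335398400 "b + 6 * d" 142219929600 15 105] eq bounds a0 c1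
    by (auto simp: upt_rec)
  have b3: "b = 0 \<or> b = 6 \<or> b = 12"
    using residue_cases[of 1335398400 b 8012390400 "d" 120185856000 15 15] eq bounds a0 c1 e2
    by (auto simp: upt_rec)
  have d4: "d = 13 \<or> d = 14 \<or> d = 15"
    using residue_cases[of 8012390400 d 1335398400 "b" 120185856000 15 12] eq bounds a0 c1 e2 b3
    by (auto simp: upt_rec)
  have "b = 0 \<or> b = 6 \<or> b = 12"
    by (rule b3)
  then show ?thesis
  proof (elim disjE)
    assume bx: "b = 0"
    have d5: "d = 15"
      using residue_cases[of 8012390400 d 1 "0" 120185856000 15 0] eq bounds a0 c1 e2 d4 bx
      by (auto simp: upt_rec)
    show ?thesis using a0 c1 e2 d4 bx d5 by simp
  next
    assume bx: "b = 6"
    have d5: "d = 14"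
      using residue_cases[of 8012390400 d 1 "0" 112173465600 15 0] eq bounds a0 c1 e2 d4 bx
      by (auto simp: upt_rec)
    show ?thesis using a0 c1 e2 d4 bx d5 by simp
  next
    assume bx: "b = 12"
    have d5: "d = 13"
      using residue_cases[of 8012390400 d 1 "0" 104161075200 15 0] eq bounds a0 c1 e2 d4 bx
      by (auto simp: upt_rec)
    show ?thesis using a0 c1 e2 d4 bx d5 by simp
  qed
qed

lemma orbit_equation_15_9:
  fixes a b c d e :: nat
  assumes eq: "2861568 * a + 1335398400 * b + 19430400 * c + 8012390400 * d + 3147724800 * e = 3186585600"
    and bounds: "a \<le> 2" "b \<le> 2" "c \<le> 2" "d \<le> 2" "e \<le> 2"
  shows "a = 0 \<and> b = 0 \<and> c = 2 \<and> d = 0 \<and> e = 1"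
proof -
  have a0: "a = 0"
    using residue_cases[of 2861568 a 1766400 "756 * b + 11 * c + 4536 * d + 1782 * e" 3186585600 2 14170] eq bounds
    by (auto simp: upt_rec)
  have c1: "c = 2"
    using residue_cases[of 19430400 c 95385600 "14 * b + 84 * d + 33 * e" 3186585600 2 262] eq bounds a0
    by (auto simp: upt_rec)
  have b2: "b = 0"
    using residue_cases[of 1335398400 b 286156800 "28 * d + 11 * e" 3147724800 2 78] eq bounds a0 c1
    by (auto simp: upt_rec)
  have d3: "d = 0"
    using residue_cases[of 8012390400 d 3147724800 "e" 3147724800 2 2] eq bounds a0 c1 b2
    by (auto simp: upt_rec)
  have e4: "e = 1"
    using residue_cases[of 3147724800 e 1 "0" 3147724800 2 0] eq bounds a0 c1 b2 d3
    by (auto simp: upt_rec)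
  show ?thesis using a0 c1 b2 d3 e4 by simp
qed

lemma orbit_equation_15_10:
  fixes a b c d e :: nat
  assumes eq: "2861568 * a + 1335398400 * b + 19430400 * c + 8012390400 * d + 3147724800 * e = 2861568"
    and bounds: "a \<le> 1" "b \<le> 1" "c \<le> 1" "d \<le> 1" "e \<le> 1"
  shows "a = 1 \<and> b = 0 \<and> c = 0 \<and> d = 0 \<and> e = 0"
proof -
  have a0: "a = 1"
    using residue_cases[of 2861568 a 1766400 "756 * b + 11 * c + 4536 * d + 1782 * e" 2861568 1 7085] eq bounds
    by (auto simp: upt_rec)
  show ?thesis using eq a0 by simp
qed

lemma orbit_equation_16_9:
  fixes a b c d e f g :: nat
  assumes eq: "6075 * a + 12441600 * b + 286156800 * c + 98366400 * d + 5901984000 * e + 16024780800 * f + 3147724800 * g = 22606387200"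
    and bounds: "a \<le> 3" "b \<le> 3" "c \<le> 3" "d \<le> 3" "e \<le> 3" "f \<le> 3" "g \<le> 3"
  shows "a = 0 \<and> b = 0 \<and> c = 1 \<and> d = 0 \<and> e = 0 \<and> f = 1 \<and> g = 2"
proof -
  have a0: "a = 0"
    using residue_cases[of 6075 a 388800 "32 * b + 736 * c + 253 * d + 15180 * e + 41216 * f + 8096 * g" 22606387200 3 196539] eq bounds
    by (auto simp: upt_rec)
  have b1: "b = 0"
    using residue_cases[of 12441600 b 8942400 "32 * c + 11 * d + 660 * e + 1792 * f + 352 * g" 22606387200 3 8541] eq bounds a0
    by (auto simp: upt_rec)
  have d2: "d = 0"
    using residue_cases[of 98366400 d 35769600 "8 * c + 165 * e + 448 * f + 88 * g" 22606387200 3 2127] eq bounds a0 b1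
    by (auto simp: upt_rec)
  have e3: "e = 0"
    using residue_cases[of 5901984000 e 286156800 "c + 56 * f + 11 * g" 22606387200 3 204] eq bounds a0 b1 d2
    by (auto simp: upt_rec)
  have f4: "f = 1"
    using residue_cases[of 16024780800 f 286156800 "c + 11 * g" 22606387200 3 36] eq bounds a0 b1 d2 e3
    by (auto simp: upt_rec)
  have c5: "c = 1"
    using residue_cases[of 286156800 c 3147724800 "g" 6581606400 3 3] eq bounds a0 b1 d2 e3 f4
    by (auto simp: upt_rec)
  have g6: "g = 2"
    using residue_cases[of 3147724800 g 1 "0" 6295449600 3 0] eq bounds a0 b1 d2 e3 f4 c5
    by (auto simp: upt_rec)
  show ?thesis using a0 b1 d2 e3 f4 c5 g6 by simp
qed

lemma orbit_equation_16_10: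
  fixes a b c d e f g :: nat
  assumes eq: "6075 * a + 12441600 * b + 286156800 * c + 98366400 * d + 5901984000 * e + 16024780800 * f + 3147724800 * g = 98366400"
    and bounds: "a \<le> 1" "b \<le> 1" "c \<le> 1" "d \<le> 1" "e \<le> 1" "f \<le> 1" "g \<le> 1"
  shows "a = 0 \<and> b = 0 \<and> c = 0 \<and> d = 1 \<and> e = 0 \<and> f = 0 \<and> g = 0"
proof -
  have a0: "a = 0"
    using residue_cases[of 6075 a 388800 "32 * b + 736 * c + 253 * d + 15180 * e + 41216 * f + 8096 * g" 98366400 1 65513] eq bounds
    by (auto simp: upt_rec)
  have b1: "b = 0"
    using residue_cases[of 12441600 b 8942400 "32 * c + 11 * d + 660 * e + 1792 * f + 352 * g" 98366400 1 2847] eq bounds a0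
    by (auto simp: upt_rec)
  have c2: "c = 0"
    using residue_cases[of 286156800 c 8942400 "11 * d + 660 * e + 1792 * f + 352 * g" 98366400 1 2815] eq bounds a0 b1
    by (auto simp: upt_rec)
  have d3: "d = 1"
    using residue_cases[of 98366400 d 35769600 "165 * e + 448 * f + 88 * g" 98366400 1 701] eq bounds a0 b1 c2
    by (auto simp: upt_rec)
  show ?thesis using eq a0 b1 c2 d3 by simp
qed

lemma orbit_equation_8_8:
  fixes a b c :: nat
  assumes eq: "3 * a + 12295800 * b + 141312 * c = 3"
    and bounds: "a \<le> 1" "b \<le> 1" "c \<le> 1"
  shows "a = 1 \<and> b = 0 \<and> c = 0"
proof -
  have a0: "a = 1"
    using residue_cases[of 3 a 552 "22275 * b + 256 * c" 3 1 22531] eq bounds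
    by (auto simp: upt_rec)
  show ?thesis using eq a0 by simp
qed

lemma orbit_equation_12_12:
  fixes a b c d e f :: nat
  assumes eq: "256 * a + 141312 * b + 12441600 * c + 2049300 * d + 393465600 * e + 667699200 * f = 256"
    and bounds: "a \<le> 1" "b \<le> 1" "c \<le> 1" "d \<le> 1" "e \<le> 1" "f \<le> 1"
  shows "a = 1 \<and> b = 0 \<and> c = 0 \<and> d = 0 \<and> e = 0 \<and> f = 0"
proof -
  have a0: "a = 1"
    using residue_cases[of 256 a 12 "11776 * b + 1036800 * c + 170775 * d + 32788800 * e + 55641600 * f" 256 1 89649751] eq bounds
    by (auto simp: upt_rec)
  show ?thesis using eq a0 by simp
qed

lemma orbit_equation_14_12:
  fixes a b c d e :: nat
  assumes eq: "286156800 * a + 5508518400 * b + 13800 * c + 19430400 * d + 49183200 * e = 19430400"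
    and bounds: "a \<le> 1" "b \<le> 1" "c \<le> 1" "d \<le> 1" "e \<le> 1"
  shows "a = 0 \<and> b = 0 \<and> c = 0 \<and> d = 1 \<and> e = 0"
proof -
  have a0: "a = 0"
    using residue_cases[of 286156800 a 13800 "399168 * b + c + 1408 * d + 3564 * e" 19430400 1 404141] eq bounds
    by (auto simp: upt_rec)
  have b1: "b = 0"
    using residue_cases[of 5508518400 b 13800 "c + 1408 * d + 3564 * e" 19430400 1 4973] eq bounds a0
    by (auto simp: upt_rec)
  have c2: "c = 0"
    using residue_cases[of 13800 c 607200 "32 * d + 81 * e" 19430400 1 113] eq bounds a0 b1
    by (auto simp: upt_rec)
  have d3: "d = 1"
    using residue_cases[of 19430400 d 49183200 "e" 19430400 1 1] eq bounds a0 b1 c2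
    by (auto simp: upt_rec)
  show ?thesis using eq a0 b1 c2 d3 by simp
qed

lemma orbit_equation_16_13:
  fixes a b c d e f g :: nat
  assumes eq: "6075 * a + 12441600 * b + 286156800 * c + 98366400 * d + 5901984000 * e + 16024780800 * f + 3147724800 * g = 12441600"
    and bounds: "a \<le> 1" "b \<le> 1" "c \<le> 1" "d \<le> 1" "e \<le> 1" "f \<le> 1" "g \<le> 1"
  shows "a = 0 \<and> b = 1 \<and> c = 0 \<and> d = 0 \<and> e = 0 \<and> f = 0 \<and> g = 0"
proof -
  have a0: "a = 0"
    using residue_cases[of 6075 a 388800 "32 * b + 736 * c + 253 * d + 15180 * e + 41216 * f + 8096 * g" 12441600 1 65513] eq bounds
    by (auto simp: upt_rec)
  have b1: "b = 1"
    using residue_cases[of 12441600 b 8942400 "32 * c + 11 * d + 660 * e + 1792 * f + 352 * g" 12441600 1 2847] eq bounds a0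
    by (auto simp: upt_rec)
  show ?thesis using eq a0 b1 by simp
qed

lemma orbit_equation_16_16:
  fixes a b c d e f g :: nat
  assumes eq: "6075 * a + 12441600 * b + 286156800 * c + 98366400 * d + 5901984000 * e + 16024780800 * f + 3147724800 * g = 6075"
    and bounds: "a \<le> 1" "b \<le> 1" "c \<le> 1" "d \<le> 1" "e \<le> 1" "f \<le> 1" "g \<le> 1"
  shows "a = 1 \<and> b = 0 \<and> c = 0 \<and> d = 0 \<and> e = 0 \<and> f = 0 \<and> g = 0"
proof -
  have a0: "a = 1"
    using residue_cases[of 6075 a 388800 "32 * b + 736 * c + 253 * d + 15180 * e + 41216 * f + 8096 * g" 6075 1 65513] eq bounds
    by (auto simp: upt_rec)
  show ?thesis using eq a0 by simp
qed

section \<open>Inner product counts for the orbits\<close>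

context leech_table
begin

definition orbit_count :: "nat \<Rightarrow> int \<Rightarrow> orbit_label \<Rightarrow> nat" where
  "orbit_count t j x = ip_count t j (SOME v. v \<in> Orb x)"

lemma ip_count_eq_orbit_count:
  assumes "v \<in> Orb x"
  shows "ip_count t j v = orbit_count t j x"
  unfolding orbit_count_def by (rule ip_count_Orb[OF assms someI[of "\<lambda>v. v \<in> Orb x", OF assms]])

lemma shell_nonempty: "\<exists>w. w \<in> shell (label_type x)"
  using Orb_nonempty[of x] Orb_shell[of x] by blast

text \<open>The vector \<open>v - 2 s\<close> is the midpoint of the congruent vectors
  \<open>v\<close> and \<open>v - 4 s\<close>. It has type m and inner product j - 4 t with
  \<open>s\<close>, so it is orthogonal to \<open>s\<close> exactly when the two lengths agree. In
  the applications m is at most 7, within reach of the distributions above.\<close>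

lemma orbit_equation:
  assumes n: "n \<le> 16" and t: "t \<in> {2, 3, 4}" and w: "w \<in> shell t"
    and m: "int m = int n - 2 * j + 4 * int t"
  shows "(\<Sum>x | label_type x = n. label_card x * orbit_count t j x)
    = card (shell t) * ip_count m (j - 4 * int t) w"
proof -
  have t16: "t \<le> 16" using t by auto
  have "(\<Sum>x | label_type x = n. label_card x * orbit_count t j x)
      = (\<Sum>x | label_type x = n. \<Sum>v\<in>Orb x. ip_count t j v)"
    by (rule sum.cong[OF refl]) (simp add: ip_count_eq_orbit_count card_Orb)
  also have "\<dots> = (\<Sum>v\<in>shell n. ip_count t j v)" by (rule sum_shell_Orb[OF n, symmetric])
  also have "\<dots> = (\<Sum>u\<in>shell t. ip_count n j u)"
    by (rule ip_count_swap[OF finite_shell[OF n] finite_shell[OF t16]])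
  also have "\<dots> = (\<Sum>u\<in>shell t. ip_count n j w)"
    by (rule sum.cong[OF refl]) (rule ip_count_shell[OF t _ w])
  also have "ip_count n j w = ip_count m (j - 4 * int t) w"
    using ip_count_shift[OF w, of 2 m n j] m by simp
  finally show ?thesis by simp
qed

lemma shell_inner_le:
  assumes "s \<in> shell t" "s' \<in> shell t" "s \<noteq> s'"
  shows "s \<bullet> s' \<le> 2 * real t - 2"
proof -
  have s: "s \<in> leech" "s' \<in> leech" "s \<bullet> s = 2 * real t" "s' \<bullet> s' = 2 * real t"
    using assms(1,2) by (auto simp: shell_def)
  have "4 \<le> (s - s') \<bullet> (s - s')" by (rule norm_ge_4) (use s leech_diff assms(3) in auto)
  also have "\<dots> = 4 * real t - 2 * (s \<bullet> s')"
    using s by (simp add: inner_diff_left inner_diff_right inner_commute)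
  finally show ?thesis by simp
qed

text \<open>Cauchy--Schwarz for \<open>v\<close> and the sum of all \<open>s\<close> with \<open>v \<bullet> s = j\<close>.\<close>

lemma ip_count_bound:
  assumes v: "v \<bullet> v = 2 * real n" and t: "1 \<le> t" "t \<le> 16"
  shows "int (ip_count t j v) * (j\<^sup>2 - 4 * int n * (int t - 1)) \<le> 4 * int n"
proof -
  define A where "A = {w \<in> shell t. v \<bullet> w = of_int j}"
  define k where "k = card A"
  have fin: "finite A" unfolding A_def using finite_shell[OF t(2)] by simp
  have k: "ip_count t j v = k" unfolding k_def A_def ip_count_def ..
  show ?thesis
  proof (cases "k = 0")
    case True
    then show ?thesis unfolding k by simp
  next
    case False
    define S where "S = (\<Sum>s\<in>A. s)"
    have "v \<bullet> S = (\<Sum>s\<in>A. v \<bullet> s)" unfolding S_def by (rule inner_sum_right)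
    also have "\<dots> = (\<Sum>s\<in>A. real_of_int j)" by (rule sum.cong) (auto simp: A_def)
    finally have vS: "v \<bullet> S = real k * real_of_int j" by (simp add: k_def)
    have row: "(\<Sum>s'\<in>A. s \<bullet> s') \<le> 2 + real k * (2 * real t - 2)" if s: "s \<in> A" for s
    proof -
      have "(\<Sum>s'\<in>A. s \<bullet> s') = s \<bullet> s + (\<Sum>s'\<in>A - {s}. s \<bullet> s')"
        by (rule sum.remove[OF fin s])
      also have "(\<Sum>s'\<in>A - {s}. s \<bullet> s') \<le> (\<Sum>s'\<in>A - {s}. 2 * real t - 2)"
        by (rule sum_mono) (rule shell_inner_le, use s in \<open>auto simp: A_def\<close>)
      also have "\<dots> = (real k - 1) * (2 * real t - 2)"
        using s False by (cases "card A") (simp_all add: k_def)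
      also have "s \<bullet> s = 2 * real t" using s by (simp add: A_def shell_def)
      finally show ?thesis by (simp add: algebra_simps)
    qed
    have "S \<bullet> S = (\<Sum>s\<in>A. \<Sum>s'\<in>A. s \<bullet> s')"
      unfolding S_def inner_sum_left inner_sum_right by (rule sum.swap)
    also have "\<dots> \<le> (\<Sum>s\<in>A. 2 + real k * (2 * real t - 2))"
      by (rule sum_mono[OF row])
    finally have SS: "S \<bullet> S \<le> real k * (2 + real k * (2 * real t - 2))" by (simp add: k_def)
    have "(real k * real_of_int j)\<^sup>2 \<le> (v \<bullet> v) * (S \<bullet> S)"
      using Cauchy_Schwarz_ineq[of v S] unfolding vS .
    also have "\<dots> \<le> 2 * real n * (real k * (2 + real k * (2 * real t - 2)))"
      unfolding v by (rule mult_left_mono[OF SS]) simp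
    finally have "real k * (real k * (real_of_int j)\<^sup>2)
        \<le> real k * (4 * real n * (1 + real k * (real t - 1)))"
      by (simp add: power2_eq_square algebra_simps)
    then have "real k * (real_of_int j)\<^sup>2 \<le> 4 * real n * (1 + real k * (real t - 1))"
      using False by simp
    then have "real_of_int (int k * (j\<^sup>2 - 4 * int n * (int t - 1))) \<le> real_of_int (4 * int n)"
      by (simp add: algebra_simps)
    then show ?thesis unfolding k by (simp only: of_int_le_iff)
  qed
qed

lemma orbit_count_bound:
  assumes "1 \<le> t" "t \<le> 16"
  shows "int (orbit_count t j x) * (j\<^sup>2 - 4 * int (label_type x) * (int t - 1)) \<le> 4 * int (label_type x)"
proof -
  obtain v where "v \<in> Orb x" using Orb_nonempty by blast
  then show ?thesis
    using ip_count_bound[OF Orb_norm assms, of v x j] ip_count_eq_orbit_count by simp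
qed

lemma orbit_count_eq_0:
  assumes "4 * int (label_type x) * int t < j\<^sup>2"
  shows "orbit_count t j x = 0"
proof -
  obtain v where "v \<in> Orb x" using Orb_nonempty by blast
  then show ?thesis
    using ip_count_eq_0[OF Orb_norm assms, of v] ip_count_eq_orbit_count by simp
qed

text \<open>The summands are natural numbers with positive coefficients, so a vanishing right side
  settles every orbit of the type at once.\<close>

lemma orbit_count_eq_0':
  assumes "t \<in> {2, 3, 4}" "w \<in> shell t" "int m = int (label_type x) - 2 * j + 4 * int t"
    "ip_count m (j - 4 * int t) w = 0"
  shows "orbit_count t j x = 0"
proof -
  have "(\<Sum>y | label_type y = label_type x. label_card y * orbit_count t j y) = 0"
    using orbit_equation[OF label_type_le assms(1-3)] assms(4) by simp
  then have "label_card x * orbit_count t j x = 0"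
    using finite_label_set by (simp add: sum_eq_0_iff)
  then show ?thesis using label_card_pos[of x] by simp
qed


text \<open>Counting pairs between the two shells transfers a distribution seen from a minimal
  vector, where the moments are known, to one seen from a vector of type 3.\<close>

lemma ip_count_23:
  assumes r: "r \<in> shell 2" and w: "w \<in> shell 3"
  shows "card (shell 3) * ip_count 2 j w = card (shell 2) * ip_count 3 j r"
proof -
  have "(\<Sum>v\<in>shell 2. ip_count 3 j r) = (\<Sum>v\<in>shell 2. ip_count 3 j v)"
    by (rule sum.cong[OF refl]) (rule ip_count_shell[OF _ r], simp_all)
  also have "\<dots> = (\<Sum>u\<in>shell 3. ip_count 2 j u)" by (intro ip_count_swap finite_shell) simp_all
  also have "\<dots> = (\<Sum>u\<in>shell 3. ip_count 2 j w)"
    by (rule sum.cong[OF refl]) (rule ip_count_shell[OF _ _ w], simp_all)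
  finally show ?thesis by simp
qed

text \<open>The pattern of all evaluations below: \<open>orbit_equation\<close> supplies the linear
  equation, \<open>orbit_count_bound\<close> the ranges, the arithmetic lemma the solution. In this
  first case the midpoint is the zero vector, so the count detects \<open>v = 2 s\<close>.\<close>

lemma orbit_count_8_8:
  shows "orbit_count 2 8 O8a = 1" "orbit_count 2 8 O8b = 0" "orbit_count 2 8 O8c = 0"
proof -
  obtain r where r: "r \<in> shell 2" using shell_nonempty[of O2] by auto
  have "3 * orbit_count 2 8 O8a + 12295800 * orbit_count 2 8 O8b + 141312 * orbit_count 2 8 O8c = 3"
    using orbit_equation[of 8 2 r 0 8] r
    by (simp add: label_type_sets card_shell_values ip_count_shell_0)
  note eq = orbit_equation_8_8[OF this]
  have "orbit_count 2 8 O8a \<le> 1" "orbit_count 2 8 O8b \<le> 1" "orbit_count 2 8 O8c \<le> 1"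
    using orbit_count_bound[of 2 8 O8a] orbit_count_bound[of 2 8 O8b] orbit_count_bound[of 2 8 O8c]
    by simp_all
  from eq[OF this] show "orbit_count 2 8 O8a = 1" "orbit_count 2 8 O8b = 0" "orbit_count 2 8 O8c = 0" by simp_all
qed

lemma orbit_count_10_8:
  shows "orbit_count 2 8 O10a = 0" "orbit_count 2 8 O10b = 1" "orbit_count 2 8 O10c = 0"
proof -
  obtain r where r: "r \<in> shell 2" using shell_nonempty[of O2] by auto
  have "143078400 * orbit_count 2 8 O10a + 279450 * orbit_count 2 8 O10b + 1430784 * orbit_count 2 8 O10c = 279450"
    using orbit_equation[of 10 2 r 2 8] r
    by (simp add: label_type_sets card_shell_values ip_count_2[OF r])
  note eq = orbit_equation_10_8[OF this]
  have "orbit_count 2 8 O10a \<le> 1" "orbit_count 2 8 O10b \<le> 1" "orbit_count 2 8 O10c \<le> 1"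
    using orbit_count_bound[of 2 8 O10a] orbit_count_bound[of 2 8 O10b] orbit_count_bound[of 2 8 O10c]
    by simp_all
  from eq[OF this] show "orbit_count 2 8 O10a = 0" "orbit_count 2 8 O10b = 1" "orbit_count 2 8 O10c = 0" by simp_all
qed

lemma orbit_count_11_8:
  shows "orbit_count 2 8 O11a = 1" "orbit_count 2 8 O11b = 0"
proof -
  obtain r where r: "r \<in> shell 2" using shell_nonempty[of O2] by auto
  have "19430400 * orbit_count 2 8 O11a + 393465600 * orbit_count 2 8 O11b = 19430400"
    using orbit_equation[of 11 2 r 3 8] r
    by (simp add: label_type_sets card_shell_values ip_count_3[OF r])
  note eq = orbit_equation_11_8[OF this]
  have "orbit_count 2 8 O11a \<le> 2" "orbit_count 2 8 O11b \<le> 2"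
    using orbit_count_bound[of 2 8 O11a] orbit_count_bound[of 2 8 O11b]
    by simp_all
  from eq[OF this] show "orbit_count 2 8 O11a = 1" "orbit_count 2 8 O11b = 0" by simp_all
qed

lemma orbit_count_12_8:
  shows "orbit_count 2 8 O12a = 0" "orbit_count 2 8 O12b = 0" "orbit_count 2 8 O12c = 0" "orbit_count 2 8 O12d = 3" "orbit_count 2 8 O12e = 1" "orbit_count 2 8 O12f = 0"
proof -
  obtain r where r: "r \<in> shell 2" using shell_nonempty[of O2] by auto
  have "256 * orbit_count 2 8 O12a + 141312 * orbit_count 2 8 O12b + 12441600 * orbit_count 2 8 O12c + 2049300 * orbit_count 2 8 O12d + 393465600 * orbit_count 2 8 O12e + 667699200 * orbit_count 2 8 O12f = 399613500"
    using orbit_equation[of 12 2 r 4 8] r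
    by (simp add: label_type_sets card_shell_values ip_count_4[OF r])
  note eq = orbit_equation_12_8[OF this]
  have "orbit_count 2 8 O12a \<le> 3" "orbit_count 2 8 O12b \<le> 3" "orbit_count 2 8 O12c \<le> 3" "orbit_count 2 8 O12d \<le> 3" "orbit_count 2 8 O12e \<le> 3" "orbit_count 2 8 O12f \<le> 3"
    using orbit_count_bound[of 2 8 O12a] orbit_count_bound[of 2 8 O12b] orbit_count_bound[of 2 8 O12c] orbit_count_bound[of 2 8 O12d] orbit_count_bound[of 2 8 O12e] orbit_count_bound[of 2 8 O12f]
    by simp_all
  from eq[OF this] show "orbit_count 2 8 O12a = 0" "orbit_count 2 8 O12b = 0" "orbit_count 2 8 O12c = 0" "orbit_count 2 8 O12d = 3" "orbit_count 2 8 O12e = 1" "orbit_count 2 8 O12f = 0" by simp_all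
qed

lemma orbit_count_12_9:
  shows "orbit_count 2 9 O12a = 0" "orbit_count 2 9 O12b = 1" "orbit_count 2 9 O12c = 0" "orbit_count 2 9 O12d = 0" "orbit_count 2 9 O12e = 0" "orbit_count 2 9 O12f = 0"
proof -
  obtain r where r: "r \<in> shell 2" using shell_nonempty[of O2] by auto
  have "256 * orbit_count 2 9 O12a + 141312 * orbit_count 2 9 O12b + 12441600 * orbit_count 2 9 O12c + 2049300 * orbit_count 2 9 O12d + 393465600 * orbit_count 2 9 O12e + 667699200 * orbit_count 2 9 O12f = 141312"
    using orbit_equation[of 12 2 r 2 9] r
    by (simp add: label_type_sets card_shell_values ip_count_2[OF r])
  note eq = orbit_equation_12_9[OF this]
  have "orbit_count 2 9 O12a \<le> 1" "orbit_count 2 9 O12b \<le> 1" "orbit_count 2 9 O12c \<le> 1" "orbit_count 2 9 O12d \<le> 1" "orbit_count 2 9 O12e \<le> 1" "orbit_count 2 9 O12f \<le> 1"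
    using orbit_count_bound[of 2 9 O12a] orbit_count_bound[of 2 9 O12b] orbit_count_bound[of 2 9 O12c] orbit_count_bound[of 2 9 O12d] orbit_count_bound[of 2 9 O12e] orbit_count_bound[of 2 9 O12f]
    by simp_all
  from eq[OF this] show "orbit_count 2 9 O12a = 0" "orbit_count 2 9 O12b = 1" "orbit_count 2 9 O12c = 0" "orbit_count 2 9 O12d = 0" "orbit_count 2 9 O12e = 0" "orbit_count 2 9 O12f = 0" by simp_all
qed

lemma orbit_count_12_12:
  shows "orbit_count 3 12 O12a = 1" "orbit_count 3 12 O12b = 0" "orbit_count 3 12 O12c = 0" "orbit_count 3 12 O12d = 0" "orbit_count 3 12 O12e = 0" "orbit_count 3 12 O12f = 0"
proof -
  obtain w where w: "w \<in> shell 3" using shell_nonempty[of O3] by auto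
  have "256 * orbit_count 3 12 O12a + 141312 * orbit_count 3 12 O12b + 12441600 * orbit_count 3 12 O12c + 2049300 * orbit_count 3 12 O12d + 393465600 * orbit_count 3 12 O12e + 667699200 * orbit_count 3 12 O12f = 256"
    using orbit_equation[of 12 3 w 0 12] w
    by (simp add: label_type_sets card_shell_values ip_count_shell_0)
  note eq = orbit_equation_12_12[OF this]
  have "orbit_count 3 12 O12a \<le> 1" "orbit_count 3 12 O12b \<le> 1" "orbit_count 3 12 O12c \<le> 1" "orbit_count 3 12 O12d \<le> 1" "orbit_count 3 12 O12e \<le> 1" "orbit_count 3 12 O12f \<le> 1"
    using orbit_count_bound[of 3 12 O12a] orbit_count_bound[of 3 12 O12b] orbit_count_bound[of 3 12 O12c] orbit_count_bound[of 3 12 O12d] orbit_count_bound[of 3 12 O12e] orbit_count_bound[of 3 12 O12f]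
    by simp_all
  from eq[OF this] show "orbit_count 3 12 O12a = 1" "orbit_count 3 12 O12b = 0" "orbit_count 3 12 O12c = 0" "orbit_count 3 12 O12d = 0" "orbit_count 3 12 O12e = 0" "orbit_count 3 12 O12f = 0" by simp_all
qed

lemma orbit_count_13_8:
  shows "orbit_count 2 8 O13a = 0" "orbit_count 2 8 O13b = 1" "orbit_count 2 8 O13c = 2"
proof -
  obtain r where r: "r \<in> shell 2" using shell_nonempty[of O2] by auto
  have "12441600 * orbit_count 2 8 O13a + 1007271936 * orbit_count 2 8 O13b + 1573862400 * orbit_count 2 8 O13c = 4154996736"
    using orbit_equation[of 13 2 r 5 8] r
    by (simp add: label_type_sets card_shell_values ip_count_5[OF r])
  note eq = orbit_equation_13_8[OF this]
  have "orbit_count 2 8 O13a \<le> 4" "orbit_count 2 8 O13b \<le> 4" "orbit_count 2 8 O13c \<le> 4"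
    using orbit_count_bound[of 2 8 O13a] orbit_count_bound[of 2 8 O13b] orbit_count_bound[of 2 8 O13c]
    by simp_all
  from eq[OF this] show "orbit_count 2 8 O13a = 0" "orbit_count 2 8 O13b = 1" "orbit_count 2 8 O13c = 2" by simp_all
qed

lemma orbit_count_13_9:
  shows "orbit_count 2 9 O13a = 1" "orbit_count 2 9 O13b = 0" "orbit_count 2 9 O13c = 0"
proof -
  obtain r where r: "r \<in> shell 2" using shell_nonempty[of O2] by auto
  have "12441600 * orbit_count 2 9 O13a + 1007271936 * orbit_count 2 9 O13b + 1573862400 * orbit_count 2 9 O13c = 12441600"
    using orbit_equation[of 13 2 r 3 9] r
    by (simp add: label_type_sets card_shell_values ip_count_3[OF r])
  note eq = orbit_equation_13_9[OF this]
  have "orbit_count 2 9 O13a \<le> 1" "orbit_count 2 9 O13b \<le> 1" "orbit_count 2 9 O13c \<le> 1"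
    using orbit_count_bound[of 2 9 O13a] orbit_count_bound[of 2 9 O13b] orbit_count_bound[of 2 9 O13c]
    by simp_all
  from eq[OF this] show "orbit_count 2 9 O13a = 1" "orbit_count 2 9 O13b = 0" "orbit_count 2 9 O13c = 0" by simp_all
qed

lemma orbit_count_14_8:
  shows "orbit_count 2 8 O14a = 1" "orbit_count 2 8 O14b = 5" "orbit_count 2 8 O14c = 1" "orbit_count 2 8 O14d = 2" "orbit_count 2 8 O14e = 7"
proof -
  obtain r where r: "r \<in> shell 2" using shell_nonempty[of O2] by auto
  have "286156800 * orbit_count 2 8 O14a + 5508518400 * orbit_count 2 8 O14b + 13800 * orbit_count 2 8 O14c + 19430400 * orbit_count 2 8 O14d + 49183200 * orbit_count 2 8 O14e = 28211905800"
    using orbit_equation[of 14 2 r 6 8] r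
    by (simp add: label_type_sets card_shell_values ip_count_6[OF r])
  note eq = orbit_equation_14_8[OF this]
  have "orbit_count 2 8 O14a \<le> 7" "orbit_count 2 8 O14b \<le> 7" "orbit_count 2 8 O14c \<le> 7" "orbit_count 2 8 O14d \<le> 7" "orbit_count 2 8 O14e \<le> 7"
    using orbit_count_bound[of 2 8 O14a] orbit_count_bound[of 2 8 O14b] orbit_count_bound[of 2 8 O14c] orbit_count_bound[of 2 8 O14d] orbit_count_bound[of 2 8 O14e]
    by simp_all
  from eq[OF this] show "orbit_count 2 8 O14a = 1" "orbit_count 2 8 O14b = 5" "orbit_count 2 8 O14c = 1" "orbit_count 2 8 O14d = 2" "orbit_count 2 8 O14e = 7" by simp_all
qed

lemma orbit_count_14_9:
  shows "orbit_count 2 9 O14a = 1" "orbit_count 2 9 O14b = 0" "orbit_count 2 9 O14c = 0" "orbit_count 2 9 O14d = 0" "orbit_count 2 9 O14e = 0"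
proof -
  obtain r where r: "r \<in> shell 2" using shell_nonempty[of O2] by auto
  have "286156800 * orbit_count 2 9 O14a + 5508518400 * orbit_count 2 9 O14b + 13800 * orbit_count 2 9 O14c + 19430400 * orbit_count 2 9 O14d + 49183200 * orbit_count 2 9 O14e = 286156800"
    using orbit_equation[of 14 2 r 4 9] r
    by (simp add: label_type_sets card_shell_values ip_count_4[OF r])
  note eq = orbit_equation_14_9[OF this]
  have "orbit_count 2 9 O14a \<le> 2" "orbit_count 2 9 O14b \<le> 2" "orbit_count 2 9 O14c \<le> 2" "orbit_count 2 9 O14d \<le> 2" "orbit_count 2 9 O14e \<le> 2"
    using orbit_count_bound[of 2 9 O14a] orbit_count_bound[of 2 9 O14b] orbit_count_bound[of 2 9 O14c] orbit_count_bound[of 2 9 O14d] orbit_count_bound[of 2 9 O14e]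
    by simp_all
  from eq[OF this] show "orbit_count 2 9 O14a = 1" "orbit_count 2 9 O14b = 0" "orbit_count 2 9 O14c = 0" "orbit_count 2 9 O14d = 0" "orbit_count 2 9 O14e = 0" by simp_all
qed

lemma orbit_count_14_10:
  shows "orbit_count 2 10 O14a = 0" "orbit_count 2 10 O14b = 0" "orbit_count 2 10 O14c = 1" "orbit_count 2 10 O14d = 0" "orbit_count 2 10 O14e = 0"
proof -
  obtain r where r: "r \<in> shell 2" using shell_nonempty[of O2] by auto
  have "286156800 * orbit_count 2 10 O14a + 5508518400 * orbit_count 2 10 O14b + 13800 * orbit_count 2 10 O14c + 19430400 * orbit_count 2 10 O14d + 49183200 * orbit_count 2 10 O14e = 13800"
    using orbit_equation[of 14 2 r 2 10] r
    by (simp add: label_type_sets card_shell_values ip_count_2[OF r])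
  note eq = orbit_equation_14_10[OF this]
  have "orbit_count 2 10 O14a \<le> 1" "orbit_count 2 10 O14b \<le> 1" "orbit_count 2 10 O14c \<le> 1" "orbit_count 2 10 O14d \<le> 1" "orbit_count 2 10 O14e \<le> 1"
    using orbit_count_bound[of 2 10 O14a] orbit_count_bound[of 2 10 O14b] orbit_count_bound[of 2 10 O14c] orbit_count_bound[of 2 10 O14d] orbit_count_bound[of 2 10 O14e]
    by simp_all
  from eq[OF this] show "orbit_count 2 10 O14a = 0" "orbit_count 2 10 O14b = 0" "orbit_count 2 10 O14c = 1" "orbit_count 2 10 O14d = 0" "orbit_count 2 10 O14e = 0" by simp_all
qed

lemma orbit_count_14_12:
  shows "orbit_count 3 12 O14a = 0" "orbit_count 3 12 O14b = 0" "orbit_count 3 12 O14c = 0" "orbit_count 3 12 O14d = 1" "orbit_count 3 12 O14e = 0"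
proof -
  obtain w where w: "w \<in> shell 3" using shell_nonempty[of O3] by auto
  obtain r where r: "r \<in> shell 2" using shell_nonempty[of O2] by auto
  have "286156800 * orbit_count 3 12 O14a + 5508518400 * orbit_count 3 12 O14b + 13800 * orbit_count 3 12 O14c + 19430400 * orbit_count 3 12 O14d + 49183200 * orbit_count 3 12 O14e = 19430400"
    using orbit_equation[of 14 3 w 2 12] w ip_count_23[OF r w, of 0]
    by (simp add: label_type_sets card_shell_values ip_count_3[OF r])
  note eq = orbit_equation_14_12[OF this]
  have "orbit_count 3 12 O14a \<le> 1" "orbit_count 3 12 O14b \<le> 1" "orbit_count 3 12 O14c \<le> 1" "orbit_count 3 12 O14d \<le> 1" "orbit_count 3 12 O14e \<le> 1"
    using orbit_count_bound[of 3 12 O14a] orbit_count_bound[of 3 12 O14b] orbit_count_bound[of 3 12 O14c] orbit_count_bound[of 3 12 O14d] orbit_count_bound[of 3 12 O14e]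
    by simp_all
  from eq[OF this] show "orbit_count 3 12 O14a = 0" "orbit_count 3 12 O14b = 0" "orbit_count 3 12 O14c = 0" "orbit_count 3 12 O14d = 1" "orbit_count 3 12 O14e = 0" by simp_all
qed

lemma orbit_count_15_8:
  shows "orbit_count 2 8 O15b = 12 \<and> orbit_count 2 8 O15d = 13
      \<or> orbit_count 2 8 O15b = 6 \<and> orbit_count 2 8 O15d = 14
      \<or> orbit_count 2 8 O15b = 0 \<and> orbit_count 2 8 O15d = 15"
proof -
  obtain r where r: "r \<in> shell 2" using shell_nonempty[of O2] by auto
  have "2861568 * orbit_count 2 8 O15a + 1335398400 * orbit_count 2 8 O15b + 19430400 * orbit_count 2 8 O15c + 8012390400 * orbit_count 2 8 O15d + 3147724800 * orbit_count 2 8 O15e = 142219929600"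
    using orbit_equation[of 15 2 r 7 8] r
    by (simp add: label_type_sets card_shell_values ip_count_7[OF r])
  note eq = orbit_equation_15_8[OF this]
  have "orbit_count 2 8 O15a \<le> 15" "orbit_count 2 8 O15b \<le> 15" "orbit_count 2 8 O15c \<le> 15" "orbit_count 2 8 O15d \<le> 15" "orbit_count 2 8 O15e \<le> 15"
    using orbit_count_bound[of 2 8 O15a] orbit_count_bound[of 2 8 O15b] orbit_count_bound[of 2 8 O15c] orbit_count_bound[of 2 8 O15d] orbit_count_bound[of 2 8 O15e]
    by simp_all
  from eq[OF this] show "orbit_count 2 8 O15b = 12 \<and> orbit_count 2 8 O15d = 13
      \<or> orbit_count 2 8 O15b = 6 \<and> orbit_count 2 8 O15d = 14
      \<or> orbit_count 2 8 O15b = 0 \<and> orbit_count 2 8 O15d = 15" by blast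
qed

lemma orbit_count_15_9:
  shows "orbit_count 2 9 O15a = 0" "orbit_count 2 9 O15b = 0" "orbit_count 2 9 O15c = 2" "orbit_count 2 9 O15d = 0" "orbit_count 2 9 O15e = 1"
proof -
  obtain r where r: "r \<in> shell 2" using shell_nonempty[of O2] by auto
  have "2861568 * orbit_count 2 9 O15a + 1335398400 * orbit_count 2 9 O15b + 19430400 * orbit_count 2 9 O15c + 8012390400 * orbit_count 2 9 O15d + 3147724800 * orbit_count 2 9 O15e = 3186585600"
    using orbit_equation[of 15 2 r 5 9] r
    by (simp add: label_type_sets card_shell_values ip_count_5[OF r])
  note eq = orbit_equation_15_9[OF this]
  have "orbit_count 2 9 O15a \<le> 2" "orbit_count 2 9 O15b \<le> 2" "orbit_count 2 9 O15c \<le> 2" "orbit_count 2 9 O15d \<le> 2" "orbit_count 2 9 O15e \<le> 2"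
    using orbit_count_bound[of 2 9 O15a] orbit_count_bound[of 2 9 O15b] orbit_count_bound[of 2 9 O15c] orbit_count_bound[of 2 9 O15d] orbit_count_bound[of 2 9 O15e]
    by simp_all
  from eq[OF this] show "orbit_count 2 9 O15a = 0" "orbit_count 2 9 O15b = 0" "orbit_count 2 9 O15c = 2" "orbit_count 2 9 O15d = 0" "orbit_count 2 9 O15e = 1" by simp_all
qed

lemma orbit_count_15_10:
  shows "orbit_count 2 10 O15a = 1" "orbit_count 2 10 O15b = 0" "orbit_count 2 10 O15c = 0" "orbit_count 2 10 O15d = 0" "orbit_count 2 10 O15e = 0"
proof -
  obtain r where r: "r \<in> shell 2" using shell_nonempty[of O2] by auto
  have "2861568 * orbit_count 2 10 O15a + 1335398400 * orbit_count 2 10 O15b + 19430400 * orbit_count 2 10 O15c + 8012390400 * orbit_count 2 10 O15d + 3147724800 * orbit_count 2 10 O15e = 2861568"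
    using orbit_equation[of 15 2 r 3 10] r
    by (simp add: label_type_sets card_shell_values ip_count_3[OF r])
  note eq = orbit_equation_15_10[OF this]
  have "orbit_count 2 10 O15a \<le> 1" "orbit_count 2 10 O15b \<le> 1" "orbit_count 2 10 O15c \<le> 1" "orbit_count 2 10 O15d \<le> 1" "orbit_count 2 10 O15e \<le> 1"
    using orbit_count_bound[of 2 10 O15a] orbit_count_bound[of 2 10 O15b] orbit_count_bound[of 2 10 O15c] orbit_count_bound[of 2 10 O15d] orbit_count_bound[of 2 10 O15e]
    by simp_all
  from eq[OF this] show "orbit_count 2 10 O15a = 1" "orbit_count 2 10 O15b = 0" "orbit_count 2 10 O15c = 0" "orbit_count 2 10 O15d = 0" "orbit_count 2 10 O15e = 0" by simp_all
qed

lemma orbit_count_16_9: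
  shows "orbit_count 2 9 O16a = 0" "orbit_count 2 9 O16b = 0" "orbit_count 2 9 O16c = 1" "orbit_count 2 9 O16d = 0" "orbit_count 2 9 O16e = 0" "orbit_count 2 9 O16f = 1" "orbit_count 2 9 O16g = 2"
proof -
  obtain r where r: "r \<in> shell 2" using shell_nonempty[of O2] by auto
  have "6075 * orbit_count 2 9 O16a + 12441600 * orbit_count 2 9 O16b + 286156800 * orbit_count 2 9 O16c + 98366400 * orbit_count 2 9 O16d + 5901984000 * orbit_count 2 9 O16e + 16024780800 * orbit_count 2 9 O16f + 3147724800 * orbit_count 2 9 O16g = 22606387200"
    using orbit_equation[of 16 2 r 6 9] r
    by (simp add: label_type_sets card_shell_values ip_count_6[OF r])
  note eq = orbit_equation_16_9[OF this]
  have "orbit_count 2 9 O16a \<le> 3" "orbit_count 2 9 O16b \<le> 3" "orbit_count 2 9 O16c \<le> 3" "orbit_count 2 9 O16d \<le> 3" "orbit_count 2 9 O16e \<le> 3" "orbit_count 2 9 O16f \<le> 3" "orbit_count 2 9 O16g \<le> 3"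
    using orbit_count_bound[of 2 9 O16a] orbit_count_bound[of 2 9 O16b] orbit_count_bound[of 2 9 O16c] orbit_count_bound[of 2 9 O16d] orbit_count_bound[of 2 9 O16e] orbit_count_bound[of 2 9 O16f] orbit_count_bound[of 2 9 O16g]
    by simp_all
  from eq[OF this] show "orbit_count 2 9 O16a = 0" "orbit_count 2 9 O16b = 0" "orbit_count 2 9 O16c = 1" "orbit_count 2 9 O16d = 0" "orbit_count 2 9 O16e = 0" "orbit_count 2 9 O16f = 1" "orbit_count 2 9 O16g = 2" by simp_all
qed

lemma orbit_count_16_10:
  shows "orbit_count 2 10 O16a = 0" "orbit_count 2 10 O16b = 0" "orbit_count 2 10 O16c = 0" "orbit_count 2 10 O16d = 1" "orbit_count 2 10 O16e = 0" "orbit_count 2 10 O16f = 0" "orbit_count 2 10 O16g = 0"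
proof -
  obtain r where r: "r \<in> shell 2" using shell_nonempty[of O2] by auto
  have "6075 * orbit_count 2 10 O16a + 12441600 * orbit_count 2 10 O16b + 286156800 * orbit_count 2 10 O16c + 98366400 * orbit_count 2 10 O16d + 5901984000 * orbit_count 2 10 O16e + 16024780800 * orbit_count 2 10 O16f + 3147724800 * orbit_count 2 10 O16g = 98366400"
    using orbit_equation[of 16 2 r 4 10] r
    by (simp add: label_type_sets card_shell_values ip_count_4[OF r])
  note eq = orbit_equation_16_10[OF this]
  have "orbit_count 2 10 O16a \<le> 1" "orbit_count 2 10 O16b \<le> 1" "orbit_count 2 10 O16c \<le> 1" "orbit_count 2 10 O16d \<le> 1" "orbit_count 2 10 O16e \<le> 1" "orbit_count 2 10 O16f \<le> 1" "orbit_count 2 10 O16g \<le> 1"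
    using orbit_count_bound[of 2 10 O16a] orbit_count_bound[of 2 10 O16b] orbit_count_bound[of 2 10 O16c] orbit_count_bound[of 2 10 O16d] orbit_count_bound[of 2 10 O16e] orbit_count_bound[of 2 10 O16f] orbit_count_bound[of 2 10 O16g]
    by simp_all
  from eq[OF this] show "orbit_count 2 10 O16a = 0" "orbit_count 2 10 O16b = 0" "orbit_count 2 10 O16c = 0" "orbit_count 2 10 O16d = 1" "orbit_count 2 10 O16e = 0" "orbit_count 2 10 O16f = 0" "orbit_count 2 10 O16g = 0" by simp_all
qed

lemma orbit_count_16_13:
  shows "orbit_count 3 13 O16a = 0" "orbit_count 3 13 O16b = 1" "orbit_count 3 13 O16c = 0" "orbit_count 3 13 O16d = 0" "orbit_count 3 13 O16e = 0" "orbit_count 3 13 O16f = 0" "orbit_count 3 13 O16g = 0"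
proof -
  obtain w where w: "w \<in> shell 3" using shell_nonempty[of O3] by auto
  obtain r where r: "r \<in> shell 2" using shell_nonempty[of O2] by auto
  have "6075 * orbit_count 3 13 O16a + 12441600 * orbit_count 3 13 O16b + 286156800 * orbit_count 3 13 O16c + 98366400 * orbit_count 3 13 O16d + 5901984000 * orbit_count 3 13 O16e + 16024780800 * orbit_count 3 13 O16f + 3147724800 * orbit_count 3 13 O16g = 12441600"
    using orbit_equation[of 16 3 w 2 13] w ip_count_23[OF r w, of 1]
    by (simp add: label_type_sets card_shell_values ip_count_3[OF r])
  note eq = orbit_equation_16_13[OF this]
  have "orbit_count 3 13 O16a \<le> 1" "orbit_count 3 13 O16b \<le> 1" "orbit_count 3 13 O16c \<le> 1" "orbit_count 3 13 O16d \<le> 1" "orbit_count 3 13 O16e \<le> 1" "orbit_count 3 13 O16f \<le> 1" "orbit_count 3 13 O16g \<le> 1"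
    using orbit_count_bound[of 3 13 O16a] orbit_count_bound[of 3 13 O16b] orbit_count_bound[of 3 13 O16c] orbit_count_bound[of 3 13 O16d] orbit_count_bound[of 3 13 O16e] orbit_count_bound[of 3 13 O16f] orbit_count_bound[of 3 13 O16g]
    by simp_all
  from eq[OF this] show "orbit_count 3 13 O16a = 0" "orbit_count 3 13 O16b = 1" "orbit_count 3 13 O16c = 0" "orbit_count 3 13 O16d = 0" "orbit_count 3 13 O16e = 0" "orbit_count 3 13 O16f = 0" "orbit_count 3 13 O16g = 0" by simp_all
qed

lemma orbit_count_16_16:
  shows "orbit_count 4 16 O16a = 1" "orbit_count 4 16 O16b = 0" "orbit_count 4 16 O16c = 0" "orbit_count 4 16 O16d = 0" "orbit_count 4 16 O16e = 0" "orbit_count 4 16 O16f = 0" "orbit_count 4 16 O16g = 0"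
proof -
  obtain q where q: "q \<in> shell 4" using shell_nonempty[of O4] by auto
  have "6075 * orbit_count 4 16 O16a + 12441600 * orbit_count 4 16 O16b + 286156800 * orbit_count 4 16 O16c + 98366400 * orbit_count 4 16 O16d + 5901984000 * orbit_count 4 16 O16e + 16024780800 * orbit_count 4 16 O16f + 3147724800 * orbit_count 4 16 O16g = 6075"
    using orbit_equation[of 16 4 q 0 16] q
    by (simp add: label_type_sets card_shell_values ip_count_shell_0)
  note eq = orbit_equation_16_16[OF this]
  have "orbit_count 4 16 O16a \<le> 1" "orbit_count 4 16 O16b \<le> 1" "orbit_count 4 16 O16c \<le> 1" "orbit_count 4 16 O16d \<le> 1" "orbit_count 4 16 O16e \<le> 1" "orbit_count 4 16 O16f \<le> 1" "orbit_count 4 16 O16g \<le> 1"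
    using orbit_count_bound[of 4 16 O16a] orbit_count_bound[of 4 16 O16b] orbit_count_bound[of 4 16 O16c] orbit_count_bound[of 4 16 O16d] orbit_count_bound[of 4 16 O16e] orbit_count_bound[of 4 16 O16f] orbit_count_bound[of 4 16 O16g]
    by simp_all
  from eq[OF this] show "orbit_count 4 16 O16a = 1" "orbit_count 4 16 O16b = 0" "orbit_count 4 16 O16c = 0" "orbit_count 4 16 O16d = 0" "orbit_count 4 16 O16e = 0" "orbit_count 4 16 O16f = 0" "orbit_count 4 16 O16g = 0" by simp_all
qed

end

section \<open>Short vectors in a class modulo four\<close>

lemma mult_leech_iff: "x \<in> mult_leech t \<longleftrightarrow> (\<exists>w\<in>leech. x = real t *\<^sub>R w)"
  unfolding mult_leech_def by blast

lemma mult_leech_minus: "x \<in> mult_leech t \<Longrightarrow> - x \<in> mult_leech t"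
  unfolding mult_leech_iff by (metis leech_minus scaleR_minus_right)

lemma mult_leech_add: "x \<in> mult_leech t \<Longrightarrow> y \<in> mult_leech t \<Longrightarrow> x + y \<in> mult_leech t"
  unfolding mult_leech_iff by (metis leech_add scaleR_add_right)

lemma mult_leech_swap: "u - v \<in> mult_leech t \<Longrightarrow> v - u \<in> mult_leech t"
  using mult_leech_minus[of "u - v" t] by simp

lemma mult_leech_trans: "u - v \<in> mult_leech t \<Longrightarrow> v - w \<in> mult_leech t \<Longrightarrow> u - w \<in> mult_leech t"
  using mult_leech_add[of "u - v" t "v - w"] by simp

lemma zero_in_mult_leech: "leech \<noteq> {} \<Longrightarrow> 0 \<in> mult_leech t"
  unfolding mult_leech_iff using zero_in_leech by force

lemma Co0_mult_leech:
  assumes "\<sigma> \<in> Co0" "u - v \<in> mult_leech t"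
  shows "\<sigma> u - \<sigma> v \<in> mult_leech t"
proof -
  obtain w where w: "w \<in> leech" "u - v = real t *\<^sub>R w" using assms(2) mult_leech_iff by blast
  have "\<sigma> u - \<sigma> v = real t *\<^sub>R \<sigma> w"
    using w(2) Co0_linear[OF assms(1)] by (metis linear_diff linear_scale)
  then show ?thesis using Co0_leech[OF assms(1) w(1)] mult_leech_iff by blast
qed

definition class_sphere :: "vec24 \<Rightarrow> vec24 set" where
  "class_sphere v = {u \<in> leech. u - v \<in> mult_leech 4 \<and> u \<bullet> u = v \<bullet> v}"

lemma vector_weight_eq: "vector_weight 4 v = card (class_sphere v)"
  unfolding vector_weight_def class_sphere_def ..

lemma inner_diff_4:
  fixes v s :: vec24
  shows "(v - 4 *\<^sub>R s) \<bullet> (v - 4 *\<^sub>R s) = v \<bullet> v - 8 * (v \<bullet> s) + 16 * (s \<bullet> s)"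
  by (simp add: inner_diff_left inner_diff_right inner_commute)

context leech_table
begin

lemma ip_count_pos:
  assumes "s \<in> shell t" "v \<bullet> s = of_int j" "t \<le> 16"
  shows "ip_count t j v > 0"
proof -
  have "finite {w \<in> shell t. v \<bullet> w = of_int j}" using finite_shell[OF assms(3)] by simp
  then show ?thesis unfolding ip_count_def card_gt_0_iff using assms(1,2) by blast
qed

lemma class_step:
  assumes v: "v \<in> shell n" "n \<le> 16" and u: "u \<in> leech" "u - v \<in> mult_leech 4"
    and le: "u \<bullet> u \<le> v \<bullet> v" and ne: "u \<noteq> v"
  obtains t s j where "t \<in> {2, 3, 4}" "s \<in> shell t" "u = v - 4 *\<^sub>R s" "v \<bullet> s = real_of_int j"
    "4 * int t \<le> j" "u \<bullet> u = v \<bullet> v - 8 * (of_int j - 4 * real t)"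
proof -
  obtain w where w: "w \<in> leech" "u - v = 4 *\<^sub>R w" using u(2) mult_leech_iff[of _ 4] by auto
  \<comment> \<open>With this sign, a shorter \<open>u\<close> corresponds to a large positive inner
    product of \<open>v\<close> and \<open>s\<close>.\<close>
  define s where "s = - w"
  have s: "s \<in> leech" "u = v - 4 *\<^sub>R s" using w leech_minus by (auto simp: s_def algebra_simps)
  have s0: "s \<noteq> 0" using ne s(2) by auto
  define q where "q = s \<bullet> s"
  have q: "q > 0" using s0 by (simp add: q_def)
  have vv: "v \<bullet> v = 2 * real n" using v by (simp add: shell_def)
  have uu: "u \<bullet> u = v \<bullet> v - 8 * (v \<bullet> s) + 16 * q" unfolding s(2) inner_diff_4 q_def ..
  have vs: "2 * q \<le> v \<bullet> s" using le uu by simp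
  have "(2 * q)\<^sup>2 \<le> (v \<bullet> s)\<^sup>2" using vs q by (intro power_mono) auto
  also have "\<dots> \<le> (v \<bullet> v) * q" unfolding q_def by (rule Cauchy_Schwarz_ineq)
  also have "\<dots> \<le> 32 * q" using v(2) q unfolding vv by (intro mult_right_mono) auto
  finally have "q * q \<le> 8 * q" by (simp add: power2_eq_square)
  then have q8: "q \<le> 8" using q by simp
  then obtain t where t: "s \<in> shell t" using exists_shell[OF s(1)] unfolding q_def by force
  then have qt: "q = 2 * real t" by (simp add: shell_def q_def)
  have "t \<noteq> 0" "t \<noteq> 1" using t shell_0 shell_1 s0 by auto
  moreover have "t \<le> 4" using q8 qt by simp
  ultimately have t234: "t \<in> {2, 3, 4}" by auto
  \<comment> \<open>From v . s >= 4 t and n <= 16, so that \<open>v - s\<close> is short enough for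
    \<open>inner_integral\<close>.\<close>
  have "real n + real t - 16 \<le> v \<bullet> s" using vs qt v(2) by simp
  then obtain j where j: "v \<bullet> s = real_of_int j" using inner_integral[OF v(1) t] by blast
  have "real_of_int (4 * int t) \<le> real_of_int j" using vs unfolding qt j by simp
  then have j4: "4 * int t \<le> j" by (simp only: of_int_le_iff)
  have "u \<bullet> u = v \<bullet> v - 8 * (of_int j - 4 * real t)" unfolding uu j qt by simp
  from that[OF t234 t s(2) j j4 this] show ?thesis .
qed

text \<open>A shorter congruent vector needs j > 4 t, while Cauchy--Schwarz gives j^2 <= 4 * 16 * t.
  This leaves 9, 10 and 11 for t = 2, only 13 for t = 3, and nothing for t = 4.\<close>

lemma minimal_if_counts:
  assumes v: "v \<in> Orb x"
    and zero: "orbit_count 2 9 x = 0" "orbit_count 2 10 x = 0" "orbit_count 2 11 x = 0"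
      "orbit_count 3 13 x = 0"
  shows "minimal_in_class 4 v"
proof -
  define n where "n = label_type x"
  have n: "n \<le> 16" "v \<in> shell n" "v \<in> leech"
    using v Orb_shell[of x] label_type_le[of x] Orb_eq_orbit(2) by (auto simp: n_def)
  have vv: "v \<bullet> v = 2 * real n" using n by (simp add: shell_def)
  have "v \<bullet> v \<le> u \<bullet> u" if u: "u \<in> leech" "u - v \<in> mult_leech 4" for u
  proof (rule ccontr)
    assume less: "\<not> v \<bullet> v \<le> u \<bullet> u"
    then have "u \<bullet> u \<le> v \<bullet> v" "u \<noteq> v" by auto
    from class_step[OF n(2,1) u this] obtain t s j where s: "t \<in> {2, 3, 4}" "s \<in> shell t"
      "v \<bullet> s = real_of_int j" "4 * int t \<le> j" "u \<bullet> u = v \<bullet> v - 8 * (of_int j - 4 * real t)" .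
    have "j \<noteq> 4 * int t" using s(5) less by auto
    then have j: "4 * int t < j" using s(4) by simp
    have "ip_count t j v \<noteq> 0" using ip_count_pos[OF s(2,3)] s(1) by auto
    then have oc: "orbit_count t j x \<noteq> 0" using ip_count_eq_orbit_count[OF v] by simp
    have j2: "j\<^sup>2 \<le> 64 * int t"
    proof (rule ccontr)
      assume "\<not> j\<^sup>2 \<le> 64 * int t"
      moreover have "4 * int n * int t \<le> 64 * int t" using n(1) by (intro mult_right_mono) auto
      ultimately have "4 * int n * int t < j\<^sup>2" by linarith
      from ip_count_eq_0[OF vv this] \<open>ip_count t j v \<noteq> 0\<close> show False by simp
    qed
    from s(1) consider "t = 2" | "t = 3" | "t = 4" by blast
    then show False
    proof cases
      case 1
      have "j < 12"
      proof (rule ccontr)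
        assume "\<not> j < 12"
        then have "12\<^sup>2 \<le> j\<^sup>2" by (intro power_mono) auto
        then show False using j2 1 by simp
      qed
      then have "j = 9 \<or> j = 10 \<or> j = 11" using j 1 by auto
      then show False using oc zero 1 by auto
    next
      case 2
      have "j < 14"
      proof (rule ccontr)
        assume "\<not> j < 14"
        then have "14\<^sup>2 \<le> j\<^sup>2" by (intro power_mono) auto
        then show False using j2 2 by simp
      qed
      then have "j = 13" using j 2 by auto
      then show False using oc zero 2 by auto
    next
      case 3
      then have "17\<^sup>2 \<le> j\<^sup>2" using j by (intro power_mono) auto
      then show False using j2 3 by simp
    qed
  qed
  then show ?thesis unfolding minimal_in_class_def using n(3) by blast
qed

lemma not_minimal_if_count:
  assumes v: "v \<in> Orb x" and pos: "orbit_count t j x > 0" and j: "4 * int t < j"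
  shows "\<not> minimal_in_class 4 v"
proof -
  have "ip_count t j v > 0" using pos ip_count_eq_orbit_count[OF v] by simp
  then have "{s \<in> shell t. v \<bullet> s = of_int j} \<noteq> {}" unfolding ip_count_def card_gt_0_iff by blast
  then obtain s where s: "s \<in> leech" "s \<bullet> s = 2 * real t" "v \<bullet> s = of_int j"
    by (auto simp: shell_def)
  have "v \<in> leech" using v Orb_eq_orbit(2) by blast
  have m: "- (4 *\<^sub>R s) \<in> mult_leech 4"
    using mult_leech_minus[of "4 *\<^sub>R s" 4] mult_leech_iff[of "4 *\<^sub>R s" 4] s(1) by auto
  have "4 *\<^sub>R s \<in> leech" using leech_scale_nat[OF s(1), of 4] by simp
  then have u: "v - 4 *\<^sub>R s \<in> leech" by (rule leech_diff[OF \<open>v \<in> leech\<close>])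
  have "real_of_int (4 * int t) < real_of_int j" using j by (simp only: of_int_less_iff)
  then have "(v - 4 *\<^sub>R s) \<bullet> (v - 4 *\<^sub>R s) < v \<bullet> v"
    unfolding inner_diff_4 s(2,3) by simp
  moreover have "(v - 4 *\<^sub>R s) - v \<in> mult_leech 4" using m by simp
  ultimately show ?thesis unfolding minimal_in_class_def using u by force
qed

lemma class_sphere_eq:
  assumes v: "v \<in> shell n" "n \<le> 16"
  shows "class_sphere v = insert v ((\<lambda>s. v - 4 *\<^sub>R s) `
    (\<Union>t\<in>{2, 3, 4}. {s \<in> shell t. v \<bullet> s = of_int (4 * int t)}))"
    (is "_ = insert v (?f ` ?A)")
proof (intro equalityI subsetI)
  fix u assume "u \<in> class_sphere v"
  then have u: "u \<in> leech" "u - v \<in> mult_leech 4" "u \<bullet> u = v \<bullet> v"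
    unfolding class_sphere_def by auto
  show "u \<in> insert v (?f ` ?A)"
  proof (cases "u = v")
    case False
    have "u \<bullet> u \<le> v \<bullet> v" using u(3) by simp
    from class_step[OF v u(1,2) this False] obtain t s j where s: "t \<in> {2, 3, 4}" "s \<in> shell t"
      "u = v - 4 *\<^sub>R s" "v \<bullet> s = real_of_int j" "u \<bullet> u = v \<bullet> v - 8 * (of_int j - 4 * real t)" .
    have "v \<bullet> s = of_int (4 * int t)" using s(4,5) u(3) by simp
    then have "s \<in> ?A" using s(1,2) by blast
    then show ?thesis using s(3) by blast
  qed simp
next
  fix u assume "u \<in> insert v (?f ` ?A)"
  then consider "u = v" | t s where "t \<in> {2, 3, 4}" "s \<in> shell t" "v \<bullet> s = of_int (4 * int t)"
      "u = v - 4 *\<^sub>R s" by blast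
  then show "u \<in> class_sphere v"
  proof cases
    case 1
    then show ?thesis
      using v zero_in_mult_leech[OF leech_nonempty] by (auto simp: class_sphere_def shell_def)
  next
    case 2
    have s: "s \<in> leech" "s \<bullet> s = 2 * real t" using 2(2) by (auto simp: shell_def)
    have "4 *\<^sub>R s \<in> leech" using leech_scale_nat[OF s(1), of 4] by simp
    then have "u \<in> leech" unfolding 2(4) using v leech_diff by (auto simp: shell_def)
    moreover have "u - v \<in> mult_leech 4"
      using mult_leech_minus[of "4 *\<^sub>R s" 4] mult_leech_iff[of "4 *\<^sub>R s" 4] s(1) 2(4) by auto
    moreover have "u \<bullet> u = v \<bullet> v" unfolding 2(4) inner_diff_4 2(3) s(2) by simp
    ultimately show ?thesis unfolding class_sphere_def by blast
  qed
qed

text \<open>In all cases but one the midpoint \<open>v - 2 s\<close> would have type 1. For type 16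
  and j = 11 it would be a minimal vector with inner product 3 with \<open>s\<close>, and then their
  difference would have type 1.\<close>

lemma orbit_count_vanishing:
  "label_type x = 9 \<Longrightarrow> orbit_count 2 8 x = 0" "label_type x = 11 \<Longrightarrow> orbit_count 2 9 x = 0"
  "label_type x = 13 \<Longrightarrow> orbit_count 2 10 x = 0" "label_type x = 16 \<Longrightarrow> orbit_count 2 11 x = 0"
  "label_type x = 13 \<Longrightarrow> orbit_count 3 12 x = 0" "label_type x = 15 \<Longrightarrow> orbit_count 3 13 x = 0"
proof -
  obtain r where r: "r \<in> shell 2" using shell_nonempty[of O2] by auto
  obtain w where w: "w \<in> shell 3" using shell_nonempty[of O3] by auto
  show "label_type x = 9 \<Longrightarrow> orbit_count 2 8 x = 0" "label_type x = 11 \<Longrightarrow> orbit_count 2 9 x = 0"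
    "label_type x = 13 \<Longrightarrow> orbit_count 2 10 x = 0"
    by (rule orbit_count_eq_0'[of 2 r 1, OF _ r], simp_all add: ip_count_shell_1)+
  show "label_type x = 16 \<Longrightarrow> orbit_count 2 11 x = 0"
    by (rule orbit_count_eq_0'[of 2 r 2, OF _ r]) (simp_all add: ip_count_2[OF r])
  show "label_type x = 13 \<Longrightarrow> orbit_count 3 12 x = 0" "label_type x = 15 \<Longrightarrow> orbit_count 3 13 x = 0"
    by (rule orbit_count_eq_0'[of 3 w 1, OF _ w], simp_all add: ip_count_shell_1)+
qed

lemmas orbit_counts = orbit_count_eq_0 orbit_count_vanishing
  orbit_count_8_8 orbit_count_10_8 orbit_count_11_8 orbit_count_12_8 orbit_count_12_9 orbit_count_12_12 orbit_count_13_8 orbit_count_13_9 orbit_count_14_8 orbit_count_14_9 orbit_count_14_10 orbit_count_14_12 orbit_count_15_9 orbit_count_15_10 orbit_count_16_9 orbit_count_16_10 orbit_count_16_13 orbit_count_16_16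

lemma listed_counts:
  assumes "eq_weight x \<noteq> None"
  shows "orbit_count 2 9 x = 0 \<and> orbit_count 2 10 x = 0 \<and> orbit_count 2 11 x = 0 \<and> orbit_count 3 13 x = 0"
  using assms by (cases x) (simp_all add: orbit_counts)

lemma unlisted_counts:
  assumes "eq_weight x = None"
  shows "orbit_count 2 9 x > 0 \<or> orbit_count 2 10 x > 0 \<or> orbit_count 3 13 x > 0"
  using assms by (cases x) (simp_all add: orbit_counts)

text \<open>The summand 1 is the vector itself; each \<open>s\<close> of type t with inner product 4
  t contributes the equally long vector \<open>v - 4 s\<close>.\<close>

definition class_size :: "orbit_label \<Rightarrow> nat" where
  "class_size x = 1 + orbit_count 2 8 x + orbit_count 3 12 x + orbit_count 4 16 x"

lemma class_size_eq:
  assumes "eq_weight x = Some k" "x \<notin> {O15b, O15d, O16a, O16e}"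
  shows "class_size x = k"
  using assms unfolding class_size_def by (cases x) (simp_all add: orbit_counts)

text \<open>What the equations leave open: they are ambiguous for type 15, and for type 16 the bound
  at inner product 8 is void.\<close>

lemma class_size_special:
  "class_size O15b = 1 + orbit_count 2 8 O15b + orbit_count 3 12 O15b"
  "class_size O15d = 1 + orbit_count 2 8 O15d + orbit_count 3 12 O15d"
  "class_size O16e = 1 + orbit_count 2 8 O16e + orbit_count 3 12 O16e"
  unfolding class_size_def by (simp_all add: orbit_counts)

lemma minimal_iff_listed:
  assumes "v \<in> Orb x"
  shows "minimal_in_class 4 v \<longleftrightarrow> eq_weight x \<noteq> None"
proof
  assume min: "minimal_in_class 4 v"
  show "eq_weight x \<noteq> None"
  proof
    assume "eq_weight x = None"
    from unlisted_counts[OF this] show False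
      using not_minimal_if_count[OF assms, of 2 9] not_minimal_if_count[OF assms, of 2 10]
        not_minimal_if_count[OF assms, of 3 13] min by auto
  qed
next
  assume "eq_weight x \<noteq> None"
  from listed_counts[OF this] show "minimal_in_class 4 v"
    using minimal_if_counts[OF assms] by blast
qed

end

section \<open>Counting classes modulo four\<close>

lemma subgroup_scale:
  fixes L :: "('i \<Rightarrow> int) set"
  assumes diff: "\<And>x y. x \<in> L \<Longrightarrow> y \<in> L \<Longrightarrow> (\<lambda>i. x i - y i) \<in> L"
    and zero: "(\<lambda>_. 0) \<in> L" and x: "x \<in> L"
  shows "(\<lambda>i. n * x i) \<in> L"
proof -
  have neg: "(\<lambda>i. - y i) \<in> L" if "y \<in> L" for y using diff[OF zero that] by simp
  have nat: "(\<lambda>i. int k * x i) \<in> L" for k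
  proof (induction k)
    case (Suc k)
    from diff[OF Suc neg[OF x]] show ?case by (simp add: algebra_simps)
  qed (simp add: zero)
  show ?thesis
  proof (cases "n \<ge> 0")
    case True
    then show ?thesis using nat[of "nat n"] by simp
  next
    case False
    then show ?thesis using neg[OF nat[of "nat (- n)"]] by simp
  qed
qed

text \<open>Only an element with the smallest positive entry at \<open>j\<close> is needed to reduce the support
  from \<open>insert j J\<close> to \<open>J\<close>; its multiples contribute \<open>t\<close> classes.\<close>

lemma subgroup_residues:
  fixes L :: "('i \<Rightarrow> int) set"
  assumes diff: "\<And>x y. x \<in> L \<Longrightarrow> y \<in> L \<Longrightarrow> (\<lambda>i. x i - y i) \<in> L"
    and zero: "(\<lambda>_. 0) \<in> L" and t: "t > 0" and "finite J"
  shows "\<exists>R. finite R \<and> R \<subseteq> L \<and> card R \<le> t ^ card J \<and>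
    (\<forall>x\<in>L. (\<forall>i. i \<notin> J \<longrightarrow> x i = 0) \<longrightarrow> (\<exists>\<rho>\<in>R. \<exists>z\<in>L. \<forall>i. x i - \<rho> i = int t * z i))"
  using \<open>finite J\<close>
proof (induction J rule: finite_induct)
  case empty
  have "\<forall>x\<in>L. (\<forall>i. i \<notin> {} \<longrightarrow> x i = 0) \<longrightarrow>
      (\<exists>\<rho>\<in>{\<lambda>_. 0}. \<exists>z\<in>L. \<forall>i. x i - \<rho> i = int t * z i)"
    using zero by (auto intro!: bexI[of _ "\<lambda>_. 0"])
  then show ?case using zero by (intro exI[of _ "{\<lambda>_. 0}"]) simp
next
  case (insert j J)
  from insert.IH obtain R where R: "finite R" "R \<subseteq> L" "card R \<le> t ^ card J"
    and red: "\<forall>x\<in>L. (\<forall>i. i \<notin> J \<longrightarrow> x i = 0) \<longrightarrow> (\<exists>\<rho>\<in>R. \<exists>z\<in>L. \<forall>i. x i - \<rho> i = int t * z i)"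
    by (elim exE conjE) (rule that)
  define M where "M = {x \<in> L. \<forall>i. i \<notin> insert j J \<longrightarrow> x i = 0}"
  have Mdiff: "(\<lambda>i. x i - y i) \<in> M" if "x \<in> M" "y \<in> M" for x y
    using that diff unfolding M_def by auto
  have Mzero: "(\<lambda>_. 0) \<in> M" using zero unfolding M_def by simp
  have sup: "x i = 0" if "x \<in> M" "x j = 0" "i \<notin> J" for x i
    using that unfolding M_def by (cases "i = j") auto
  have add: "(\<lambda>i. x i + y i) \<in> L" if "x \<in> L" "y \<in> L" for x y
    using diff[OF that(1) diff[OF zero that(2)]] by simp
  have conclude: ?case if "finite S" "S \<subseteq> L" "card S \<le> t ^ card (insert j J)"
    "\<And>x. x \<in> M \<Longrightarrow> \<exists>\<rho>\<in>S. \<exists>z\<in>L. \<forall>i. x i - \<rho> i = int t * z i" for S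
    by (intro exI[of _ S] conjI ballI impI that) (simp_all add: M_def)
  show ?case
  proof (cases "\<forall>x\<in>M. x j = 0")
    case True
    have 1: "\<exists>\<rho>\<in>R. \<exists>z\<in>L. \<forall>i. x i - \<rho> i = int t * z i" if "x \<in> M" for x
    proof (rule red[rule_format])
      show "x \<in> L" using that unfolding M_def by simp
      show "x i = 0" if "i \<notin> J" for i using sup[OF \<open>x \<in> M\<close>] True \<open>x \<in> M\<close> that by blast
    qed
    have 2: "card R \<le> t ^ card (insert j J)"
    proof -
      have "t ^ card J \<le> t ^ card (insert j J)"
        using t insert.hyps by (intro power_increasing) auto
      with R(3) show ?thesis by linarith
    qed
    show ?thesis by (rule conclude[OF R(1,2) 2 1])
  next
    case False
    then obtain x0 where x0: "x0 \<in> M" "x0 j \<noteq> 0" unfolding Ball_def not_all not_imp by (elim exE conjE)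
    have "\<exists>x\<in>M. x j > 0"
    proof (cases "x0 j > 0")
      case True
      then show ?thesis using x0(1) by (rule bexI)
    next
      case False
      then have "0 - x0 j > 0" using x0(2) by simp
      then show ?thesis using Mdiff[OF Mzero x0(1)] by (intro bexI[of _ "\<lambda>i. 0 - x0 i"])
    qed
    then obtain x1 where x1: "x1 \<in> M" "x1 j > 0" by (elim bexE)
    have ex: "\<exists>m. \<exists>x\<in>M. x j = int m \<and> m > 0"
      by (intro exI[of _ "nat (x1 j)"] bexI[of _ x1]) (use x1 in simp_all)
    define m where "m = (LEAST m. \<exists>x\<in>M. x j = int m \<and> m > 0)"
    obtain g where g: "g \<in> M" "g j = int m" "m > 0" using LeastI_ex[OF ex] unfolding m_def[symmetric] by (elim bexE conjE)
    have gM: "(\<lambda>i. n * g i) \<in> M" for n by (rule subgroup_scale[OF Mdiff Mzero g(1)])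
    have gL: "(\<lambda>i. n * g i) \<in> L" for n using gM unfolding M_def by blast
    have least: "\<not> (\<exists>x\<in>M. x j = int k \<and> k > 0)" if "k < m" for k
      using that unfolding m_def by (rule not_less_Least)
    have quot: "x j = (x j div int m) * int m" if "x \<in> M" for x
    proof (rule ccontr)
      assume ne: "x j \<noteq> (x j div int m) * int m"
      let ?y = "\<lambda>i. x i - (x j div int m) * g i"
      have y: "?y \<in> M" by (rule Mdiff[OF that gM])
      have yj: "?y j = x j mod int m" unfolding g(2) by (simp add: minus_div_mult_eq_mod)
      have "x j mod int m \<noteq> 0" using ne minus_div_mult_eq_mod[of "x j" "int m"] by linarith
      moreover have "0 \<le> x j mod int m" "x j mod int m < int m" using g(3) by simp_all
      ultimately have "0 < ?y j" "?y j < int m" unfolding yj by linarith+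
      then have "\<exists>x\<in>M. x j = int (nat (?y j)) \<and> nat (?y j) > 0" "nat (?y j) < m"
        by (intro bexI[of _ ?y] y, simp_all)
      from least[OF this(2)] this(1) show False by (rule notE)
    qed
    define R' where "R' = (\<lambda>(a, \<rho>) i. int a * g i + \<rho> i) ` ({..<t} \<times> R)"
    have 1: "finite R'" unfolding R'_def using R(1) by simp
    have 2: "R' \<subseteq> L"
    proof
      fix \<rho>' assume "\<rho>' \<in> R'"
      then obtain a \<rho> where "\<rho> \<in> R" "\<rho>' = (\<lambda>i. int a * g i + \<rho> i)" unfolding R'_def by auto
      then show "\<rho>' \<in> L" using add[OF gL[of "int a"]] R(2) by auto
    qed
    have 3: "card R' \<le> t ^ card (insert j J)"
    proof -
      have "card R' \<le> card ({..<t} \<times> R)" unfolding R'_def using R(1) by (intro card_image_le) simp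
      also have "\<dots> = t * card R" by (simp add: card_cartesian_product)
      also have "\<dots> \<le> t * t ^ card J" using R(3) by simp
      finally show ?thesis using insert.hyps by simp
    qed
    have 4: "\<exists>\<rho>\<in>R'. \<exists>z\<in>L. \<forall>i. x i - \<rho> i = int t * z i" if x: "x \<in> M" for x
    proof -
      define q where "q = x j div int m"
      have y: "(\<lambda>i. x i - q * g i) \<in> M" by (rule Mdiff[OF x gM])
      have "x j - q * g j = 0" using quot[OF x] unfolding q_def g(2) by simp
      then have "x i - q * g i = 0" if "i \<notin> J" for i using sup[OF y _ that] by simp
      moreover have "(\<lambda>i. x i - q * g i) \<in> L" using y unfolding M_def by simp
      ultimately have "\<exists>\<rho>\<in>R. \<exists>z\<in>L. \<forall>i. x i - q * g i - \<rho> i = int t * z i"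
        by (intro red[rule_format])
      then obtain \<rho> z where \<rho>: "\<rho> \<in> R" "z \<in> L" "\<forall>i. x i - q * g i - \<rho> i = int t * z i"
        by (elim bexE)
      \<comment> \<open>Only \<open>q\<close> modulo t needs a representative; the multiple of t
        contained in \<open>q\<close> is absorbed into \<open>z\<close>.\<close>
      define a where "a = nat (q mod int t)"
      have a: "a < t" "int a = q mod int t" using t by (auto simp: a_def nat_less_iff)
      then have q: "q = int t * (q div int t) + int a" by simp
      have 1: "(\<lambda>i. int a * g i + \<rho> i) \<in> R'"
        unfolding R'_def using a(1) \<rho>(1) by (intro image_eqI[of _ _ "(a, \<rho>)"]) simp_all
      have 2: "(\<lambda>i. z i + (q div int t) * g i) \<in> L" by (rule add[OF \<rho>(2) gL])
      have "x i - (int a * g i + \<rho> i) = int t * (z i + (q div int t) * g i)" for i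
      proof -
        have "q * g i = int t * ((q div int t) * g i) + int a * g i"
          by (subst q) (simp add: algebra_simps)
        then show ?thesis using \<rho>(3)[rule_format, of i] by (simp add: algebra_simps)
      qed
      then show ?thesis by (intro bexI[OF _ 1] bexI[OF _ 2] allI)
    qed
    show ?thesis by (rule conclude[OF 1 2 3 4])
  qed
qed

section \<open>Congruence classes modulo four and an upper bound for their number\<close>

definition leech_class :: "vec24 \<Rightarrow> vec24 set" where
  "leech_class v = {u \<in> leech. u - v \<in> mult_leech 4}"

lemma leech_class_eq_iff:
  assumes "u \<in> leech" "v \<in> leech"
  shows "leech_class u = leech_class v \<longleftrightarrow> u - v \<in> mult_leech 4"
proof
  assume eq: "leech_class u = leech_class v"
  have "u \<in> leech_class u"
    unfolding leech_class_def using assms(1) zero_in_mult_leech[of 4] by auto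
  then have "u \<in> leech_class v" by (simp only: eq)
  then show "u - v \<in> mult_leech 4" unfolding leech_class_def by blast
next
  assume uv: "u - v \<in> mult_leech 4"
  have "w - u \<in> mult_leech 4 \<longleftrightarrow> w - v \<in> mult_leech 4" for w
    using mult_leech_trans[of w u 4 v] mult_leech_trans[of w v 4 u] mult_leech_swap[OF uv] uv
    by blast
  then show "leech_class u = leech_class v" unfolding leech_class_def by simp
qed

text \<open>The residue count with all 24 coordinates as support, transported along
  \<open>coord_vec\<close>. The bound reflects the rank; that it is attained will follow from the
  orbit sizes.\<close>

lemma card_leech_classes:
  "finite (leech_class ` leech)" "card (leech_class ` leech) \<le> 4 ^ 24"
proof -
  have "finite (leech_class ` leech) \<and> card (leech_class ` leech) \<le> 4 ^ 24"
  proof (cases "leech = {}")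
    case False
    then obtain x0 where "x0 \<in> leech_coords" unfolding leech_eq_image by blast
    from leech_coords_diff[OF this this] have zero: "(\<lambda>_. 0) \<in> leech_coords" by simp
    have "\<exists>R. finite R \<and> R \<subseteq> leech_coords \<and> card R \<le> 4 ^ card (UNIV :: pl23 set) \<and>
      (\<forall>x\<in>leech_coords. (\<forall>i. i \<notin> UNIV \<longrightarrow> x i = 0) \<longrightarrow>
        (\<exists>\<rho>\<in>R. \<exists>z\<in>leech_coords. \<forall>i. x i - \<rho> i = int 4 * z i))"
      by (rule subgroup_residues) (simp_all add: leech_coords_diff zero)
    then obtain R where R: "finite R" "R \<subseteq> leech_coords" "card R \<le> 4 ^ card (UNIV :: pl23 set)"
      and red: "\<forall>x\<in>leech_coords. (\<forall>i. i \<notin> UNIV \<longrightarrow> x i = 0) \<longrightarrow>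
        (\<exists>\<rho>\<in>R. \<exists>z\<in>leech_coords. \<forall>i. x i - \<rho> i = int 4 * z i)"
      by (elim exE conjE) (rule that)
    have "leech_class ` leech \<subseteq> (\<lambda>\<rho>. leech_class (coord_vec \<rho>)) ` R"
    proof
      fix C assume "C \<in> leech_class ` leech"
      then obtain x where x: "x \<in> leech_coords" "C = leech_class (coord_vec x)"
        unfolding leech_eq_image by blast
      have "\<exists>\<rho>\<in>R. \<exists>z\<in>leech_coords. \<forall>i. x i - \<rho> i = int 4 * z i"
        by (rule red[rule_format, OF x(1)]) simp
      then obtain \<rho> z where z: "\<rho> \<in> R" "z \<in> leech_coords" "\<forall>i. x i - \<rho> i = int 4 * z i"
        by (elim bexE)
      have "coord_vec x - coord_vec \<rho> = real 4 *\<^sub>R coord_vec z"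
        unfolding coord_vec_diff coord_vec_scale using z(3) by simp
      then have "coord_vec x - coord_vec \<rho> \<in> mult_leech 4"
        unfolding mult_leech_iff leech_eq_image using z(2) by blast
      then have "C = leech_class (coord_vec \<rho>)"
        unfolding x(2) using x(1) z(1) R(2) by (subst leech_class_eq_iff) (auto simp: leech_eq_image)
      then show "C \<in> (\<lambda>\<rho>. leech_class (coord_vec \<rho>)) ` R" using z(1) by (rule image_eqI)
    qed
    then have "finite (leech_class ` leech)" "card (leech_class ` leech) \<le> card R"
      using finite_surj[OF R(1)] surj_card_le[OF R(1)] by simp_all
    moreover have "card R \<le> 4 ^ 24" using R(3) by simp
    ultimately show ?thesis by linarith
  qed simp
  then show "finite (leech_class ` leech)" "card (leech_class ` leech) \<le> 4 ^ 24" by blast+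
qed

text \<open>Each fibre contributes a total of 1. With 4-weights as fibre sizes, this turns a number
  of classes into a weighted sum of orbit sizes.\<close>

lemma card_image_eq_sum:
  assumes "finite S"
  shows "real (card (f ` S)) = (\<Sum>v\<in>S. 1 / real (card {u \<in> S. f u = f v}))"
proof -
  have "(\<Sum>v\<in>S. 1 / real (card {u \<in> S. f u = f v}))
      = (\<Sum>y\<in>f ` S. \<Sum>v\<in>{v \<in> S. f v = y}. 1 / real (card {u \<in> S. f u = f v}))"
    by (rule sum.image_gen[OF assms])
  also have "\<dots> = (\<Sum>y\<in>f ` S. 1)"
  proof (rule sum.cong[OF refl])
    fix y assume y: "y \<in> f ` S"
    have "(\<Sum>v\<in>{v \<in> S. f v = y}. 1 / real (card {u \<in> S. f u = f v}))
        = (\<Sum>v\<in>{v \<in> S. f v = y}. 1 / real (card {u \<in> S. f u = y}))"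
      by (rule sum.cong) auto
    also have "\<dots> = 1" using assms y by (auto simp: card_eq_0_iff)
    finally show "(\<Sum>v\<in>{v \<in> S. f v = y}. 1 / real (card {u \<in> S. f u = f v})) = 1" .
  qed
  finally show ?thesis by simp
qed

section \<open>Trace bounds for configurations of vectors\<close>

text \<open>Cauchy--Schwarz for the trace of \<open>P = \<Sum>u. p u \<otimes> q u\<close>, a symmetric matrix of size 24.\<close>

lemma trace_bound:
  fixes p q :: "'a \<Rightarrow> vec24"
  assumes sym: "\<And>i j. (\<Sum>u\<in>K. p u $ i * q u $ j) = (\<Sum>u\<in>K. p u $ j * q u $ i)"
  shows "(\<Sum>u\<in>K. p u \<bullet> q u)\<^sup>2 \<le> 24 * (\<Sum>u\<in>K. \<Sum>u'\<in>K. (p u \<bullet> q u') * (p u' \<bullet> q u))"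
proof -
  define P where "P i j = (\<Sum>u\<in>K. p u $ i * q u $ j)" for i j
  have "(\<Sum>u\<in>K. p u \<bullet> q u) = (\<Sum>i\<in>UNIV. P i i)"
    unfolding inner_vec_def P_def by (simp add: sum.swap[of _ K])
  then have "(\<Sum>u\<in>K. p u \<bullet> q u)\<^sup>2 = (\<Sum>i\<in>UNIV. P i i)\<^sup>2" by simp
  also have "\<dots> \<le> (\<Sum>i\<in>UNIV. (P i i)\<^sup>2) * card (UNIV :: pl23 set)"
    by (rule sum_squared_le_sum_of_squares)
  also have "\<dots> = 24 * (\<Sum>i\<in>UNIV. (P i i)\<^sup>2)" by simp
  \<comment> \<open>Adding the off-diagonal squares gives, by symmetry, the trace of the square of
    P, which is an expression in inner products.\<close>
  also have "\<dots> \<le> 24 * (\<Sum>i\<in>UNIV. \<Sum>j\<in>UNIV. (P i j)\<^sup>2)"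
    by (intro mult_left_mono sum_mono member_le_sum) auto
  also have "(\<Sum>i\<in>UNIV. \<Sum>j\<in>UNIV. (P i j)\<^sup>2) = (\<Sum>i\<in>UNIV. \<Sum>j\<in>UNIV. P i j * P j i)"
    using sym unfolding P_def power2_eq_square by (intro sum.cong refl) metis
  also have "\<dots> = (\<Sum>i\<in>UNIV. \<Sum>j\<in>UNIV. \<Sum>u\<in>K. \<Sum>u'\<in>K. (p u $ i * q u' $ i) * (p u' $ j * q u $ j))"
    unfolding P_def sum_product by (intro sum.cong refl) (simp add: mult_ac)
  also have "\<dots> = (\<Sum>u\<in>K. \<Sum>u'\<in>K. \<Sum>i\<in>UNIV. \<Sum>j\<in>UNIV. (p u $ i * q u' $ i) * (p u' $ j * q u $ j))"
    by (simp only: sum.swap[of _ "UNIV :: pl23 set" K])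
  also have "\<dots> = (\<Sum>u\<in>K. \<Sum>u'\<in>K. (p u \<bullet> q u') * (p u' \<bullet> q u))"
    unfolding inner_vec_def sum_product by simp
  finally show ?thesis .
qed

text \<open>The case where p and q are both the identity: P is the frame operator of K, and the sum
  of all squared inner products is the trace of its square.\<close>

lemma welch_bound:
  fixes K :: "vec24 set"
  assumes K: "card K > 0" "\<And>u. u \<in> K \<Longrightarrow> u \<bullet> u = 32"
    and row: "\<And>u. u \<in> K \<Longrightarrow> (\<Sum>a\<in>K. (u \<bullet> a)\<^sup>2) \<le> c"
  shows "1024 * real (card K) \<le> 24 * c"
proof -
  have "(\<Sum>u\<in>K. u \<bullet> u)\<^sup>2 \<le> 24 * (\<Sum>u\<in>K. \<Sum>a\<in>K. (u \<bullet> a) * (a \<bullet> u))"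
    by (rule trace_bound) (simp add: mult.commute)
  also have "\<dots> = 24 * (\<Sum>u\<in>K. \<Sum>a\<in>K. (u \<bullet> a)\<^sup>2)"
    by (simp add: power2_eq_square inner_commute)
  also have "\<dots> \<le> 24 * (\<Sum>u\<in>K. c)" by (intro mult_left_mono sum_mono row) auto
  finally have "(32 * real (card K))\<^sup>2 \<le> 24 * (real (card K) * c)" using K(2) by simp
  then have "real (card K) * (1024 * real (card K)) \<le> real (card K) * (24 * c)"
    by (simp add: power2_eq_square algebra_simps)
  then show ?thesis using K(1) by simp
qed

section \<open>Classes of minimal vectors\<close>

lemma class_sphere_eqI:
  assumes "u \<in> class_sphere v"
  shows "class_sphere u = class_sphere v"
proof -
  have uv: "u - v \<in> mult_leech 4" "u \<bullet> u = v \<bullet> v" using assms unfolding class_sphere_def by auto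
  have "w - u \<in> mult_leech 4 \<longleftrightarrow> w - v \<in> mult_leech 4" for w
    using mult_leech_trans[of w u 4 v] mult_leech_trans[of w v 4 u] mult_leech_swap[OF uv(1)] uv(1)
    by blast
  then show ?thesis unfolding class_sphere_def uv(2) by simp
qed

context leech_table
begin

lemma class_sphere_refl: "v \<in> leech \<Longrightarrow> v \<in> class_sphere v"
  unfolding class_sphere_def using zero_in_mult_leech[OF leech_nonempty, of 4] by simp

lemma class_sphere_shell: "v \<in> shell n \<Longrightarrow> class_sphere v \<subseteq> shell n"
  unfolding class_sphere_def shell_def by auto

lemma finite_class_sphere: "v \<in> Orb x \<Longrightarrow> finite (class_sphere v)"
  using class_sphere_shell[of v "label_type x"] Orb_shell[of x] finite_shell[OF label_type_le[of x]]
  by (meson finite_subset subsetD)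

text \<open>A vector \<open>v - 4 s\<close> of the class has inner product 2 n - 16 t with
  \<open>v\<close> when \<open>s\<close> has type t. Thus three counts determine a whole row of the
  Gram matrix of the class. The function g will be 1 for the size, the identity for row sums, the
  square for trace bounds, and an indicator to read off the possible entries.\<close>

lemma sum_class_sphere:
  fixes g :: "real \<Rightarrow> real"
  assumes v: "v \<in> Orb x" and n: "label_type x = n"
  shows "(\<Sum>a\<in>class_sphere v. g (v \<bullet> a)) = g (2 * real n)
    + real (orbit_count 2 8 x) * g (2 * real n - 32) + real (orbit_count 3 12 x) * g (2 * real n - 48)
    + real (orbit_count 4 16 x) * g (2 * real n - 64)"
proof -
  have n16: "n \<le> 16" "v \<in> shell n"
    using v Orb_shell[of x] label_type_le[of x] n by auto
  have vv: "v \<bullet> v = 2 * real n" using n16 by (simp add: shell_def)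
  define A where "A t = {s \<in> shell t. v \<bullet> s = of_int (4 * int t)}" for t
  have cA: "card (A t) = orbit_count t (4 * int t) x" for t
    unfolding A_def ip_count_def[symmetric] by (rule ip_count_eq_orbit_count[OF v])
  have fin: "finite (A t)" if "t \<in> {2, 3, 4}" for t
    unfolding A_def using finite_shell[of t] that by auto
  have dis: "A t \<inter> A t' = {}" if "t \<noteq> t'" for t t'
    using that unfolding A_def shell_def by auto
  have nz: "0 \<notin> A t" if "t \<in> {2, 3, 4}" for t
    using that unfolding A_def shell_def by auto
  let ?f = "\<lambda>s. v - 4 *\<^sub>R s" and ?U = "\<Union>t\<in>{2, 3, 4}. A t"
  have inj: "inj_on ?f ?U" by (rule inj_onI) simp
  have "(\<Sum>a\<in>?f ` ?U. g (v \<bullet> a)) = (\<Sum>s\<in>?U. g (v \<bullet> (v - 4 *\<^sub>R s)))"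
    by (rule sum.reindex[OF inj, unfolded o_def])
  also have "\<dots> = (\<Sum>t\<in>{2, 3, 4}. \<Sum>s\<in>A t. g (v \<bullet> (v - 4 *\<^sub>R s)))"
    by (rule sum.UNION_disjoint) (use fin dis in auto)
  also have "\<dots> = (\<Sum>t\<in>{2, 3, 4}. real (card (A t)) * g (2 * real n - 16 * real t))"
  proof (rule sum.cong[OF refl])
    fix t :: nat
    have "(\<Sum>s\<in>A t. g (v \<bullet> (v - 4 *\<^sub>R s))) = (\<Sum>s\<in>A t. g (2 * real n - 16 * real t))"
      by (rule sum.cong[OF refl]) (simp add: A_def inner_diff_right vv)
    then show "(\<Sum>s\<in>A t. g (v \<bullet> (v - 4 *\<^sub>R s))) = real (card (A t)) * g (2 * real n - 16 * real t)"
      by simp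
  qed
  finally have img: "(\<Sum>a\<in>?f ` ?U. g (v \<bullet> a)) = real (orbit_count 2 8 x) * g (2 * real n - 32)
      + real (orbit_count 3 12 x) * g (2 * real n - 48) + real (orbit_count 4 16 x) * g (2 * real n - 64)"
    by (simp add: cA)
  have "v \<notin> ?f ` ?U" using nz by auto
  moreover have "finite (?f ` ?U)" using fin by (intro finite_imageI finite_UN_I) auto
  ultimately show ?thesis
    unfolding class_sphere_eq[OF n16(2,1)] A_def[symmetric] using img vv by simp
qed

lemma vector_weight_class_size:
  assumes "v \<in> Orb x"
  shows "vector_weight 4 v = class_size x"
proof -
  have "real (vector_weight 4 v) = real (class_size x)"
    using sum_class_sphere[OF assms refl, of "\<lambda>_. 1"]
    unfolding vector_weight_eq class_size_def by simp
  then show ?thesis by simp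
qed

lemma minimal_class:
  assumes "minimal_in_class 4 v" "u \<in> class_sphere v"
  shows "minimal_in_class 4 u"
  using assms mult_leech_trans unfolding minimal_in_class_def class_sphere_def by auto

text \<open>Such an \<open>s\<close> would give \<open>w - s\<close> the norm 8 - 12 + 6 = 2. In a
  class of doubled vectors of type 16 this removes the Gram entry -16.\<close>

lemma doubled_ip_count_eq_0:
  assumes w: "w \<in> leech" "w \<bullet> w = 8"
  shows "ip_count 3 12 (2 *\<^sub>R w) = 0"
proof -
  have "(2 *\<^sub>R w) \<bullet> s \<noteq> 12" if "s \<in> shell 3" for s
  proof
    assume "(2 *\<^sub>R w) \<bullet> s = 12"
    moreover have s: "s \<in> leech" "s \<bullet> s = 6" using that by (auto simp: shell_def)
    ultimately have "(w - s) \<bullet> (w - s) = 2"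
      using w by (simp add: inner_diff_left inner_diff_right inner_commute)
    then show False using norm_ge_4[OF leech_diff[OF w(1) s(1)]] by force
  qed
  then have "{s \<in> shell 3. (2 *\<^sub>R w) \<bullet> s = of_int 12} = {}" by auto
  then show ?thesis unfolding ip_count_def by (simp only: card.empty)
qed

lemma doubled_class:
  assumes "v = 2 *\<^sub>R w" "w \<in> leech" "u - v \<in> mult_leech 4"
  shows "\<exists>w'\<in>leech. u = 2 *\<^sub>R w'"
proof -
  obtain z where z: "z \<in> leech" "u - v = real 4 *\<^sub>R z" using assms(3) mult_leech_iff by blast
  have "u = 2 *\<^sub>R (w + 2 *\<^sub>R z)" using z(2) assms(1) by (simp add: algebra_simps)
  moreover have "w + 2 *\<^sub>R z \<in> leech"
    using leech_add[OF assms(2) leech_scale_nat[OF z(1), of 2]] by simp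
  ultimately show ?thesis by blast
qed

text \<open>The count for t = 4 provides \<open>s\<close> of norm 8 with inner product 16, which is
  equality in Cauchy--Schwarz; hence \<open>v = 2 s\<close>.\<close>

lemma O16a_doubled:
  assumes "v \<in> Orb O16a"
  shows "\<exists>w\<in>leech. v = 2 *\<^sub>R w"
proof -
  have "ip_count 4 16 v > 0" using ip_count_eq_orbit_count[OF assms] by (simp add: orbit_counts)
  then have "{s \<in> shell 4. v \<bullet> s = of_int 16} \<noteq> {}" unfolding ip_count_def card_gt_0_iff by blast
  then obtain s where s: "s \<in> leech" "s \<bullet> s = 8" "v \<bullet> s = 16" by (auto simp: shell_def)
  have "v \<bullet> v = 32" using Orb_norm[OF assms] by simp
  then have "(v - 2 *\<^sub>R s) \<bullet> (v - 2 *\<^sub>R s) = 0"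
    using s by (simp add: inner_diff_left inner_diff_right inner_commute)
  then show ?thesis using s(1) by auto
qed

text \<open>Apart from itself, a vector of this class can be non-orthogonal only to its negative, so
  the squares in a Gram row add up to at most 2 * 32^2. The trace bound gives 24 * 2048 / 1024 = 48,
  the size of an orthogonal frame with signs.\<close>

lemma class_size_O16a: "class_size O16a \<le> 48"
proof -
  obtain v where v: "v \<in> Orb O16a" using Orb_nonempty by blast
  define K where "K = class_sphere v"
  have vs: "v \<in> shell 16" using v Orb_shell[of O16a] by auto
  obtain w where w: "w \<in> leech" "v = 2 *\<^sub>R w" using O16a_doubled[OF v] by blast
  have row: "(\<Sum>a\<in>K. (u \<bullet> a)\<^sup>2) \<le> 2048" if u: "u \<in> K" for u
  proof -
    have us: "u \<in> shell 16" using u class_sphere_shell[OF vs] unfolding K_def by blast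
    then obtain y where y: "u \<in> Orb y" "label_type y = 16"
      using shell_eq_Union[of 16] by auto
    have "u - v \<in> mult_leech 4" using u unfolding K_def class_sphere_def by simp
    then obtain w' where w': "w' \<in> leech" "u = 2 *\<^sub>R w'" using doubled_class[OF w(2,1)] by blast
    have "w' \<bullet> w' = 8" using us w'(2) by (simp add: shell_def)
    then have "orbit_count 3 12 y = 0"
      using doubled_ip_count_eq_0[OF w'(1)] ip_count_eq_orbit_count[OF y(1)] w'(2) by simp
    moreover have "orbit_count 4 16 y \<le> 1"
      using orbit_count_bound[of 4 16 y] y(2) by simp
    moreover have "class_sphere u = K" using u class_sphere_eqI unfolding K_def by blast
    ultimately show ?thesis using sum_class_sphere[OF y, of "\<lambda>x. x\<^sup>2"] by simp
  qed
  have "class_size O16a = card K"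
    unfolding K_def vector_weight_eq[symmetric] by (rule vector_weight_class_size[OF v, symmetric])
  moreover have "1024 * real (card K) \<le> 24 * 2048"
  proof (rule welch_bound[OF _ _ row])
    show "card K > 0"
      unfolding card_gt_0_iff K_def using finite_class_sphere[OF v] class_sphere_refl w
        Orb_eq_orbit(2)[OF v] by blast
    show "u \<bullet> u = 32" if "u \<in> K" for u
      using that class_sphere_shell[OF vs] unfolding K_def by (auto simp: shell_def)
  qed
  ultimately show ?thesis by simp
qed

end

text \<open>
  Vectors of norm 32 with inner products 0 and -16 form a union of cycles, and a cycle of length
  \<open>l\<close> has rank \<open>l - 1\<close>, so a bound of 32 holds unless there are triangles. Instead of decomposing
  into cycles, the trace bound is applied to \<open>4 u + a + b\<close>, where \<open>a\<close> and \<open>b\<close> are the neighbours of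
  \<open>u\<close>: for cycles of length four the resulting matrix is a multiple of a projection.
\<close>

lemma triangle_free_bound:
  fixes K :: "vec24 set"
  assumes K: "finite K" "K \<noteq> {}" "\<And>u. u \<in> K \<Longrightarrow> u \<bullet> u = 32"
    and ip: "\<And>u a. u \<in> K \<Longrightarrow> a \<in> K \<Longrightarrow> u \<noteq> a \<Longrightarrow> u \<bullet> a = 0 \<or> u \<bullet> a = - 16"
    and deg: "\<And>u. u \<in> K \<Longrightarrow> card {a \<in> K. u \<bullet> a = - 16} = 2"
    and tri: "\<And>u a b. u \<in> K \<Longrightarrow> a \<in> K \<Longrightarrow> b \<in> K \<Longrightarrow>
      u \<bullet> a = - 16 \<Longrightarrow> u \<bullet> b = - 16 \<Longrightarrow> a \<bullet> b \<noteq> - 16"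
  shows "card K \<le> 32"
proof -
  define N where "N u = {a \<in> K. u \<bullet> a = - 16}" for u
  have fN: "finite (N u)" for u unfolding N_def using K(1) by simp
  have cN: "card (N u) = 2" if "u \<in> K" for u unfolding N_def by (rule deg[OF that])
  have sumN: "(\<Sum>a\<in>N u. f a) = (\<Sum>a\<in>K. if u \<bullet> a = - 16 then f a else 0)" for u and f :: "vec24 \<Rightarrow> real"
    unfolding N_def by (rule sum.inter_filter[OF K(1)])
  define q where "q u = 4 *\<^sub>R u + (\<Sum>a\<in>N u. a)" for u
  define c where "c u u' = real (card (N u \<inter> N u'))" for u u'
  have val: "u' \<bullet> q u = 4 * (u \<bullet> u') + (if u \<bullet> u' = - 16 then 32 else 0) - 16 * c u u'"
    if "u \<in> K" "u' \<in> K" for u u'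
  proof -
    have "u' \<bullet> a = (if a = u' then 32 else 0) - (if u' \<bullet> a = - 16 then 16 else 0)" if "a \<in> N u" for a
    proof -
      have "a \<in> K" using that unfolding N_def by blast
      then show ?thesis using ip[OF \<open>u' \<in> K\<close> \<open>a \<in> K\<close>] K(3)[OF \<open>u' \<in> K\<close>] by auto
    qed
    then have "(\<Sum>a\<in>N u. u' \<bullet> a)
        = (\<Sum>a\<in>N u. (if a = u' then 32 else 0) - (if u' \<bullet> a = - 16 then 16 else 0))"
      by (rule sum.cong[OF refl])
    also have "\<dots> = (\<Sum>a\<in>N u. if a = u' then 32 else 0) - (\<Sum>a\<in>N u. if u' \<bullet> a = - 16 then 16 else 0)"
      by (rule sum_subtractf)
    also have "(\<Sum>a\<in>N u. if a = u' then 32 else 0) = (if u \<bullet> u' = - 16 then 32 else (0 :: real))"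
      using fN that(2) by (simp add: N_def)
    also have "(\<Sum>a\<in>N u. if u' \<bullet> a = - 16 then 16 else 0) = (\<Sum>a\<in>{a \<in> N u. u' \<bullet> a = - 16}. 16 :: real)"
      by (rule sum.inter_filter[OF fN, symmetric])
    also have "{a \<in> N u. u' \<bullet> a = - 16} = N u \<inter> N u'" unfolding N_def by auto
    finally show ?thesis
      unfolding q_def c_def by (simp add: inner_add_right inner_sum_right inner_commute)
  qed
  have c_commute: "c u u' = c u' u" for u u' unfolding c_def by (simp add: Int_commute)
  have c_le: "c u u' \<le> 2" if "u \<in> K" for u u'
    unfolding c_def using card_mono[OF fN, of "N u \<inter> N u'" u] cN[OF that] by simp
  \<comment> \<open>Walks of length two from \<open>u\<close>: two neighbours, each with two
    neighbours.\<close>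
  have c_sum: "(\<Sum>u'\<in>K. c u u') = 4" if u: "u \<in> K" for u
  proof -
    have "c u u' = (\<Sum>a\<in>N u. if u' \<bullet> a = - 16 then 1 else 0)" if "u' \<in> K" for u'
    proof -
      have "N u \<inter> N u' = {a \<in> N u. u' \<bullet> a = - 16}" unfolding N_def by auto
      then show ?thesis unfolding c_def using sum.inter_filter[OF fN, of "\<lambda>_. 1 :: real" u] by simp
    qed
    then have "(\<Sum>u'\<in>K. c u u') = (\<Sum>u'\<in>K. \<Sum>a\<in>N u. if u' \<bullet> a = - 16 then 1 else 0)"
      by (rule sum.cong[OF refl])
    also have "\<dots> = (\<Sum>a\<in>N u. \<Sum>u'\<in>K. if u' \<bullet> a = - 16 then 1 else 0)" by (rule sum.swap)
    also have "\<dots> = (\<Sum>a\<in>N u. 2)"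
    proof (rule sum.cong[OF refl])
      fix a assume "a \<in> N u"
      then have "a \<in> K" unfolding N_def by blast
      have "(\<Sum>u'\<in>K. if u' \<bullet> a = - 16 then 1 else 0) = (\<Sum>u'\<in>N a. 1 :: real)"
        unfolding sumN by (simp add: inner_commute)
      then show "(\<Sum>u'\<in>K. if u' \<bullet> a = - 16 then 1 else 0) = (2 :: real)"
        using cN[OF \<open>a \<in> K\<close>] by simp
    qed
    finally show ?thesis using cN[OF u] by simp
  qed
  have row: "(\<Sum>u'\<in>K. (u \<bullet> q u') * (u' \<bullet> q u)) \<le> 12288" if u: "u \<in> K" for u
  proof -
    \<comment> \<open>The product is 96^2 = 8192 + 512 * 2 for equal vectors, 32^2 for neighbours,
      and 256 c^2 otherwise. The last is linearised by c^2 <= 2 c, with equality for c = 0 and c =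
      2, as in cycles of length four.\<close>
    have "(u \<bullet> q u') * (u' \<bullet> q u)
        \<le> (if u' = u then 8192 else 0) + (if u \<bullet> u' = - 16 then 1024 else 0) + 512 * c u u'"
      if u': "u' \<in> K" for u'
    proof -
      have eq: "u \<bullet> q u' = u' \<bullet> q u"
        unfolding val[OF u u'] val[OF u' u] by (simp add: inner_commute c_commute)
      consider "u' = u" | "u \<bullet> u' = - 16" | "u' \<noteq> u" "u \<bullet> u' = 0" using ip[OF u u'] by auto
      then show ?thesis
      proof cases
        case 1
        have "c u u = 2" unfolding c_def using cN[OF u] by simp
        then show ?thesis unfolding eq unfolding val[OF u u'] using 1 K(3)[OF u] by simp
      next
        case 2
        \<comment> \<open>A common neighbour of two neighbours would close a triangle.\<close>
        have "N u \<inter> N u' = {}" using tri[OF u u' _ 2] unfolding N_def by auto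
        then have "c u u' = 0" unfolding c_def by simp
        moreover have "u' \<noteq> u" using 2 K(3)[OF u] by auto
        ultimately show ?thesis unfolding eq unfolding val[OF u u'] using 2 by simp
      next
        case 3
        have "c u u' * c u u' \<le> 2 * c u u'"
          using c_le[OF u] by (intro mult_right_mono) (simp_all add: c_def)
        then show ?thesis unfolding eq unfolding val[OF u u'] using 3 by simp
      qed
    qed
    then have "(\<Sum>u'\<in>K. (u \<bullet> q u') * (u' \<bullet> q u))
        \<le> (\<Sum>u'\<in>K. (if u' = u then 8192 else 0) + (if u \<bullet> u' = - 16 then 1024 else 0) + 512 * c u u')"
      by (rule sum_mono)
    also have "\<dots> = 8192 + (\<Sum>u'\<in>N u. 1024) + 512 * (\<Sum>u'\<in>K. c u u')"
      unfolding sum.distrib sumN sum_distrib_left using K(1) u by simp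
    also have "\<dots> = 12288" using c_sum[OF u] cN[OF u] by simp
    finally show ?thesis .
  qed
  have "(\<Sum>u\<in>K. u \<bullet> q u)\<^sup>2 \<le> 24 * (\<Sum>u\<in>K. \<Sum>u'\<in>K. (u \<bullet> q u') * (u' \<bullet> q u))"
  proof (rule trace_bound)
    fix i j
    have "(\<Sum>u\<in>K. u $ i * q u $ j) = 4 * (\<Sum>u\<in>K. u $ i * u $ j)
        + (\<Sum>u\<in>K. \<Sum>a\<in>K. if u \<bullet> a = - 16 then u $ i * a $ j else 0)" for i j
      unfolding q_def sum_distrib_left sum.distrib[symmetric]
      by (rule sum.cong[OF refl]) (simp add: sumN algebra_simps sum_distrib_left if_distrib cong: if_cong)
    moreover have "(\<Sum>u\<in>K. \<Sum>a\<in>K. if u \<bullet> a = - 16 then u $ i * a $ j else 0)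
        = (\<Sum>u\<in>K. \<Sum>a\<in>K. if u \<bullet> a = - 16 then u $ j * a $ i else 0)"
      by (subst sum.swap) (simp add: inner_commute mult.commute cong: if_cong)
    ultimately show "(\<Sum>u\<in>K. u $ i * q u $ j) = (\<Sum>u\<in>K. u $ j * q u $ i)"
      by (simp add: mult.commute)
  qed
  also have "\<dots> \<le> 24 * (\<Sum>u\<in>K. 12288)" by (intro mult_left_mono sum_mono row) simp_all
  also have "(\<Sum>u\<in>K. u \<bullet> q u) = (\<Sum>u\<in>K. 96)"
  proof (rule sum.cong[OF refl])
    fix u assume u: "u \<in> K"
    have "c u u = 2" unfolding c_def using cN[OF u] by simp
    then show "u \<bullet> q u = 96" unfolding val[OF u u] using K(3)[OF u] by simp
  qed
  \<comment> \<open>With k = card K this is 96^2 k^2 <= 24 * 12288 k, that is, k <= 32.\<close>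
  finally have "real (card K) * (9216 * real (card K)) \<le> real (card K) * 294912"
    by (simp add: power2_eq_square algebra_simps)
  moreover have "card K > 0" using K(1,2) by (simp add: card_gt_0_iff)
  ultimately show ?thesis by simp
qed

context leech_table
begin

text \<open>The class stays inside \<open>O16e\<close>, so all Gram rows have the same distribution,
  with entries 32, 0 and -16, where -16 occurs d times. Nonnegativity of the total sum gives d <= 2.
  For d <= 1 the trace bound gives 24 * 1280 / 1024 = 30; for d = 2 a triangle would produce a
  vector of norm 2, and \<open>triangle_free_bound\<close> applies.\<close>

lemma class_size_O16e: "class_size O16e \<le> 32"
proof -
  obtain v where v: "v \<in> Orb O16e" using Orb_nonempty by blast
  define K where "K = class_sphere v"
  define d where "d = orbit_count 3 12 O16e"
  have vl: "v \<in> leech" by (rule Orb_eq_orbit(2)[OF v])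
  have vs: "v \<in> shell 16" using v Orb_shell[of O16e] by auto
  have size: "class_size O16e = card K"
    unfolding K_def vector_weight_eq[symmetric] by (rule vector_weight_class_size[OF v, symmetric])
  have finK: "finite K" unfolding K_def by (rule finite_class_sphere[OF v])
  have vK: "v \<in> K" unfolding K_def by (rule class_sphere_refl[OF vl])
  have normK: "u \<bullet> u = 32" if "u \<in> K" for u
    using that class_sphere_shell[OF vs] unfolding K_def by (auto simp: shell_def)
  \<comment> \<open>If \<open>v = 2 w\<close>, then \<open>w\<close> is counted for t = 4 and inner
    product 16, but that count is 0 on \<open>O16e\<close>. This separates the class from those of
    \<open>O16a\<close>.\<close>
  have not_doubled: "v \<noteq> 2 *\<^sub>R w" if w: "w \<in> leech" for w
  proof
    assume eq: "v = 2 *\<^sub>R w"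
    then have "w \<bullet> w = 8" using vs by (simp add: shell_def)
    then have "w \<in> shell 4" "v \<bullet> w = of_int 16" using w eq by (auto simp: shell_def)
    then have "ip_count 4 16 v > 0" by (rule ip_count_pos) simp
    then show False using ip_count_eq_orbit_count[OF v] by (simp add: orbit_counts)
  qed
  have orbK: "u \<in> Orb O16e" if u: "u \<in> K" for u
  proof -
    have min: "minimal_in_class 4 u"
      using minimal_class minimal_iff_listed[OF v] u unfolding K_def by simp
    have "u \<in> shell 16" using u class_sphere_shell[OF vs] unfolding K_def by blast
    then obtain y where y: "u \<in> Orb y" "label_type y = 16" using shell_eq_Union[of 16] by auto
    have "eq_weight y \<noteq> None" using minimal_iff_listed[OF y(1)] min by simp
    moreover have "y \<in> {O16a, O16b, O16c, O16d, O16e, O16f, O16g}"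
      using y(2) label_type_sets(17) by blast
    ultimately have "y = O16a \<or> y = O16e" by auto
    moreover have "y \<noteq> O16a"
    proof
      assume "y = O16a"
      then obtain w where w: "w \<in> leech" "u = 2 *\<^sub>R w" using O16a_doubled y(1) by blast
      have "v - u \<in> mult_leech 4" using u mult_leech_swap unfolding K_def class_sphere_def by blast
      then show False using doubled_class[OF w(2,1)] not_doubled by blast
    qed
    ultimately show ?thesis using y(1) by blast
  qed
  have sphereK: "class_sphere u = K" if "u \<in> K" for u
    using that class_sphere_eqI unfolding K_def by blast
  have sum_row: "(\<Sum>a\<in>K. g (u \<bullet> a)) = g 32 + real (orbit_count 2 8 O16e) * g 0 + real d * g (- 16)"
    if "u \<in> K" for u and g :: "real \<Rightarrow> real"
    using sum_class_sphere[OF orbK[OF that], of 16 g] sphereK[OF that]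
    by (simp add: d_def orbit_counts)
  have ip: "u \<bullet> a = 0 \<or> u \<bullet> a = - 16" if "u \<in> K" "a \<in> K" "u \<noteq> a" for u a
  proof -
    \<comment> \<open>Indicator of the values that should not occur: its row sum vanishes, so they
      do not.\<close>
    define g :: "real \<Rightarrow> real" where "g x = (if x = 32 \<or> x = 0 \<or> x = - 16 then 0 else 1)" for x
    have "(\<Sum>a\<in>K. g (u \<bullet> a)) = 0" unfolding sum_row[OF that(1)] by (simp add: g_def)
    then have "g (u \<bullet> a) = 0"
      using that(2) finK by (subst (asm) sum_nonneg_eq_0_iff) (auto simp: g_def)
    then have "u \<bullet> a = 32 \<or> u \<bullet> a = 0 \<or> u \<bullet> a = - 16" by (simp add: g_def split: if_splits)
    moreover have "u \<bullet> a \<noteq> 32"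
    proof
      assume "u \<bullet> a = 32"
      then have "(u - a) \<bullet> (u - a) = 0"
        using normK[OF that(1)] normK[OF that(2)]
        by (simp add: inner_diff_left inner_diff_right inner_commute)
      then show False using that(3) by simp
    qed
    ultimately show ?thesis by blast
  qed
  have deg: "card {a \<in> K. u \<bullet> a = - 16} = d" if "u \<in> K" for u
  proof -
    have "real (card {a \<in> K. u \<bullet> a = - 16}) = (\<Sum>a\<in>K. if u \<bullet> a = - 16 then 1 else 0)"
      using sum.inter_filter[OF finK, of "\<lambda>_. 1 :: real"] by simp
    also have "\<dots> = real d" by (subst sum_row[OF that, of "\<lambda>x. if x = - 16 then 1 else 0"]) simp
    finally show ?thesis by simp
  qed
  have "d \<le> 2"
  proof -
    have "0 \<le> (\<Sum>u\<in>K. u) \<bullet> (\<Sum>a\<in>K. a)" by simp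
    also have "\<dots> = (\<Sum>u\<in>K. \<Sum>a\<in>K. u \<bullet> a)"
      unfolding inner_sum_left inner_sum_right by (rule sum.swap)
    also have "\<dots> = (\<Sum>u\<in>K. 32 - 16 * real d)"
      by (rule sum.cong[OF refl]) (simp add: sum_row[of _ "\<lambda>x. x"])
    finally have "0 \<le> real (card K) * (32 - 16 * real d)" by simp
    moreover have "card K > 0" using finK vK by (auto simp: card_gt_0_iff)
    ultimately show ?thesis by (simp add: zero_le_mult_iff)
  qed
  then consider "d \<le> 1" | "d = 2" by linarith
  then have "card K \<le> 32"
  proof cases
    case 1
    have "1024 * real (card K) \<le> 24 * 1280"
    proof (rule welch_bound)
      show "card K > 0" using finK vK by (auto simp: card_gt_0_iff)
      show "(\<Sum>a\<in>K. (u \<bullet> a)\<^sup>2) \<le> 1280" if "u \<in> K" for u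
        using sum_row[OF that, of "\<lambda>x. x\<^sup>2"] 1 by simp
    qed (rule normK)
    then show ?thesis by simp
  next
    case 2
    show ?thesis
    proof (rule triangle_free_bound)
      show "card {a \<in> K. u \<bullet> a = - 16} = 2" if "u \<in> K" for u using deg[OF that] 2 by simp
      show "a \<bullet> b \<noteq> - 16" if "u \<in> K" "a \<in> K" "b \<in> K" "u \<bullet> a = - 16" "u \<bullet> b = - 16" for u a b
      proof
        assume "a \<bullet> b = - 16"
        then have "(u + a + b) \<bullet> (u + a + b) = 0"
          using that normK by (simp add: inner_add_left inner_add_right inner_commute)
        then have sum0: "u + a + b = 0" by simp
        have cong: "x - v \<in> mult_leech 4" "x \<in> leech" if "x \<in> K" for x
          using that unfolding K_def class_sphere_def by auto
        have "a - u \<in> mult_leech 4" "b - u \<in> mult_leech 4"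
          using mult_leech_trans[OF cong(1) mult_leech_swap[OF cong(1)]] that by blast+
        then obtain y z where yz: "y \<in> leech" "a - u = 4 *\<^sub>R y" "z \<in> leech" "b - u = 4 *\<^sub>R z"
          using mult_leech_iff[of _ 4] by auto
        \<comment> \<open>Substituting a = u + 4 y and b = u + 4 z into u + a + b = 0 gives 3 u = -4
          (y + z), hence u = 4 x, and x has norm 32 / 16 = 2.\<close>
        define x where "x = u + y + z"
        have "u $ i = 4 * x $ i" for i
          using arg_cong[OF yz(2), of "\<lambda>x. x $ i"] arg_cong[OF yz(4), of "\<lambda>x. x $ i"]
            arg_cong[OF sum0, of "\<lambda>x. x $ i"] unfolding x_def by simp
        then have ux: "u = 4 *\<^sub>R x" by (simp add: vec_eq_iff)
        have "x \<in> leech"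
          unfolding x_def by (intro leech_add cong(2)[OF that(1)] yz(1,3))
        moreover have xx: "x \<bullet> x = 2" using normK[OF that(1)] unfolding ux by simp
        ultimately have "4 \<le> x \<bullet> x" by (intro norm_ge_4) auto
        then show False using xx by simp
      qed
    qed (use finK vK normK ip in auto)
  qed
  then show ?thesis unfolding size .
qed

end

section \<open>Conjugate orbits\<close>

context leech_table
begin

lemma Co0_Orb:
  assumes "\<sigma> \<in> Co0" "u \<in> Orb x"
  shows "\<sigma> u \<in> Orb x"
  unfolding Orb_eq_orbit(1)[OF assms(2)] by (rule co0_orbitI[OF assms(1)])

lemma Orb_transitive:
  assumes "u \<in> Orb x" "v \<in> Orb x"
  shows "\<exists>\<sigma>\<in>Co0. u = \<sigma> v"
  using assms(1) unfolding Orb_eq_orbit(1)[OF assms(2)] co0_orbit_def by blast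

lemma card_class_Orb_le:
  assumes s: "\<sigma> \<in> Co0"
  shows "card (class_sphere v \<inter> Orb y) \<le> card (class_sphere (\<sigma> v) \<inter> Orb y)"
proof (rule card_inj_on_le)
  show "inj_on \<sigma> (class_sphere v \<inter> Orb y)" by (rule inj_on_subset[OF Co0_inj[OF s] subset_UNIV])
  show "\<sigma> ` (class_sphere v \<inter> Orb y) \<subseteq> class_sphere (\<sigma> v) \<inter> Orb y"
  proof
    fix w assume "w \<in> \<sigma> ` (class_sphere v \<inter> Orb y)"
    then obtain u where u: "w = \<sigma> u" "u \<in> leech" "u - v \<in> mult_leech 4" "u \<bullet> u = v \<bullet> v" "u \<in> Orb y"
      unfolding class_sphere_def by blast
    have "\<sigma> u \<in> class_sphere (\<sigma> v)"
      unfolding class_sphere_def mem_Collect_eq Co0_inner[OF s]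
      by (intro conjI Co0_leech[OF s] Co0_mult_leech[OF s] u(2,3,4))
    then show "w \<in> class_sphere (\<sigma> v) \<inter> Orb y" using Co0_Orb[OF s u(5)] u(1) by simp
  qed
  show "finite (class_sphere (\<sigma> v) \<inter> Orb y)" using finite_Orb by simp
qed

text \<open>The count runs over vectors as long as the representative, so it detects conjugacy
  between orbits of equal type.\<close>

definition conj_count :: "orbit_label \<Rightarrow> orbit_label \<Rightarrow> nat" where
  "conj_count x y = card (class_sphere (SOME v. v \<in> Orb x) \<inter> Orb y)"

lemma conj_count_eq:
  assumes v: "v \<in> Orb x"
  shows "conj_count x y = card (class_sphere v \<inter> Orb y)"
proof -
  have le: "card (class_sphere u \<inter> Orb y) \<le> card (class_sphere u' \<inter> Orb y)"
    if "u \<in> Orb x" "u' \<in> Orb x" for u u'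
    using Orb_transitive[OF that(2,1)] card_class_Orb_le by blast
  have w: "(SOME v. v \<in> Orb x) \<in> Orb x" using v by (rule someI)
  show ?thesis unfolding conj_count_def using le[OF v w] le[OF w v] by simp
qed

text \<open>Lying in one class sphere defines a biregular bipartite graph between the two orbits;
  both sides count its edges.\<close>

lemma conj_count_double:
  "label_card x * conj_count x y = label_card y * conj_count y x"
proof -
  have card: "card (class_sphere v \<inter> Orb z) = (\<Sum>u\<in>Orb z. if u \<in> class_sphere v then 1 else 0)" for v z
  proof -
    have "class_sphere v \<inter> Orb z = {u \<in> Orb z. u \<in> class_sphere v}" by blast
    then show ?thesis
      using sum.inter_filter[OF finite_Orb, of "\<lambda>_. 1 :: nat" z "\<lambda>u. u \<in> class_sphere v"] by simp
  qed
  have sym: "u \<in> class_sphere v \<longleftrightarrow> v \<in> class_sphere u" if "u \<in> leech" "v \<in> leech" for u v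
    using that class_sphere_eqI class_sphere_refl by metis
  have "label_card x * conj_count x y = (\<Sum>v\<in>Orb x. conj_count x y)" by (simp add: card_Orb)
  also have "\<dots> = (\<Sum>v\<in>Orb x. \<Sum>u\<in>Orb y. if u \<in> class_sphere v then 1 else 0)"
    by (rule sum.cong[OF refl]) (simp only: conj_count_eq card)
  also have "\<dots> = (\<Sum>u\<in>Orb y. \<Sum>v\<in>Orb x. if u \<in> class_sphere v then 1 else 0)" by (rule sum.swap)
  also have "\<dots> = (\<Sum>u\<in>Orb y. \<Sum>v\<in>Orb x. if v \<in> class_sphere u then 1 else 0)"
    by (intro sum.cong refl if_cong sym Orb_eq_orbit(2))
  also have "\<dots> = (\<Sum>u\<in>Orb y. conj_count y x)"
    by (rule sum.cong[OF refl]) (simp only: conj_count_eq card)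
  finally show ?thesis by (simp add: card_Orb)
qed

lemma orbits_conjugate_iff:
  assumes v: "v \<in> Orb x" and u: "u \<in> Orb y" and type: "label_type x = label_type y"
  shows "orbits_conjugate 4 v u \<longleftrightarrow> conj_count x y > 0"
proof
  assume "orbits_conjugate 4 v u"
  then obtain \<sigma> where s: "\<sigma> \<in> Co0" "v - \<sigma> u \<in> mult_leech 4" unfolding orbits_conjugate_def by blast
  have su: "\<sigma> u \<in> Orb y" by (rule Co0_Orb[OF s(1) u])
  then have "\<sigma> u \<in> class_sphere v"
    using mult_leech_swap[OF s(2)] Orb_eq_orbit(2)[OF su] Orb_norm[OF su] Orb_norm[OF v] type
    unfolding class_sphere_def by simp
  with su have "class_sphere v \<inter> Orb y \<noteq> {}" by blast
  then show "conj_count x y > 0" unfolding conj_count_eq[OF v] using finite_Orb by (simp add: card_gt_0_iff)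
next
  assume "conj_count x y > 0"
  then obtain w where w: "w \<in> class_sphere v" "w \<in> Orb y"
    unfolding conj_count_eq[OF v] card_gt_0_iff by blast
  obtain \<sigma> where s: "\<sigma> \<in> Co0" "w = \<sigma> u" using Orb_transitive[OF w(2) u] by blast
  have "v - \<sigma> u \<in> mult_leech 4" using w(1) mult_leech_swap unfolding class_sphere_def s(2) by blast
  then show "orbits_conjugate 4 v u" unfolding orbits_conjugate_def using s(1) by blast
qed

lemma conj_count_self: "conj_count x x > 0"
proof -
  obtain v where v: "v \<in> Orb x" using Orb_nonempty by blast
  then have "v \<in> class_sphere v \<inter> Orb x" using class_sphere_refl[OF Orb_eq_orbit(2)[OF v]] by blast
  then have "class_sphere v \<inter> Orb x \<noteq> {}" by blast
  then show ?thesis unfolding conj_count_eq[OF v] using finite_Orb by (simp add: card_gt_0_iff)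
qed

lemma conj_count_add_le:
  assumes "x \<noteq> y"
  shows "conj_count x x + conj_count x y \<le> class_size x"
proof -
  obtain v where v: "v \<in> Orb x" using Orb_nonempty by blast
  have dis: "(class_sphere v \<inter> Orb x) \<inter> (class_sphere v \<inter> Orb y) = {}" using Orb_inj assms by blast
  have "conj_count x x + conj_count x y = card ((class_sphere v \<inter> Orb x) \<union> (class_sphere v \<inter> Orb y))"
    unfolding conj_count_eq[OF v] by (rule card_Un_disjoint[symmetric]) (use finite_Orb dis in simp_all)
  also have "\<dots> \<le> card (class_sphere v)"
    by (rule card_mono[OF finite_class_sphere[OF v]]) blast
  also have "\<dots> = class_size x" using vector_weight_class_size[OF v] unfolding vector_weight_eq .
  finally show ?thesis .
qed

text \<open>Minimality of \<open>v\<close> excludes shorter conjugates, so a conjugate lies in the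
  class sphere of \<open>v\<close>. There it is minimal as well and has the same 4-weight.\<close>

lemma conjugate_listed:
  assumes v: "v \<in> Orb x" and u: "u \<in> Orb y" and x: "eq_weight x \<noteq> None"
    and conj: "orbits_conjugate 4 v u" and le: "label_type y \<le> label_type x"
  shows "label_type y = label_type x" "eq_weight y \<noteq> None" "class_size y = class_size x"
    "conj_count x y > 0"
proof -
  obtain \<sigma> where s: "\<sigma> \<in> Co0" "v - \<sigma> u \<in> mult_leech 4"
    using conj unfolding orbits_conjugate_def by blast
  have su: "\<sigma> u \<in> Orb y" by (rule Co0_Orb[OF s(1) u])
  have min: "minimal_in_class 4 v" using minimal_iff_listed[OF v] x by simp
  then have "v \<bullet> v \<le> \<sigma> u \<bullet> \<sigma> u"
    using Orb_eq_orbit(2)[OF su] mult_leech_swap[OF s(2)] unfolding minimal_in_class_def by blast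
  then show type: "label_type y = label_type x" using Orb_norm[OF v] Orb_norm[OF su] le by simp
  show cc: "conj_count x y > 0" using orbits_conjugate_iff[OF v u type[symmetric]] conj by simp
  have mem: "\<sigma> u \<in> class_sphere v"
    using mult_leech_swap[OF s(2)] Orb_eq_orbit(2)[OF su] Orb_norm[OF su] Orb_norm[OF v] type
    unfolding class_sphere_def by simp
  show "eq_weight y \<noteq> None" using minimal_class[OF min mem] minimal_iff_listed[OF su] by simp
  have "vector_weight 4 (\<sigma> u) = vector_weight 4 v"
    unfolding vector_weight_eq class_sphere_eqI[OF mem] ..
  then show "class_size y = class_size x"
    using vector_weight_class_size[OF su] vector_weight_class_size[OF v] by simp
qed

section \<open>The number of classes represented by minimal vectors\<close>

definition min_vectors :: "vec24 set" where
  "min_vectors = \<Union> (Orb ` {x. eq_weight x \<noteq> None})"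

lemma listed_labels: "{x. eq_weight x \<noteq> None} =
  {O0, O2, O3, O4, O5, O6a, O6b, O7, O8a, O8b, O8c, O9a, O9b, O10a, O10b, O10c, O11a, O11b, O12a,
   O12c, O12d, O12e, O12f, O13b, O13c, O14b, O14d, O14e, O15b, O15d, O16a, O16e}"
  by (rule set_eqI, case_tac x) simp_all

lemma finite_listed: "finite {x. eq_weight x \<noteq> None}"
  unfolding listed_labels by simp

lemma finite_min_vectors: "finite min_vectors"
  unfolding min_vectors_def using finite_listed finite_Orb by blast

lemma min_vectors_iff: "v \<in> min_vectors \<longleftrightarrow> v \<in> leech \<and> v \<bullet> v \<le> 32 \<and> minimal_in_class 4 v"
proof
  assume "v \<in> min_vectors"
  then obtain x where x: "v \<in> Orb x" "eq_weight x \<noteq> None" unfolding min_vectors_def by blast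
  then show "v \<in> leech \<and> v \<bullet> v \<le> 32 \<and> minimal_in_class 4 v"
    using Orb_eq_orbit(2) Orb_norm[OF x(1)] label_type_le[of x] minimal_iff_listed[OF x(1)] by simp
next
  assume v: "v \<in> leech \<and> v \<bullet> v \<le> 32 \<and> minimal_in_class 4 v"
  then obtain x where x: "v \<in> Orb x" using Orb_exists by blast
  then show "v \<in> min_vectors" unfolding min_vectors_def using minimal_iff_listed[OF x] v by blast
qed

text \<open>Congruent minimal vectors bound each other's norm, so they are equally long and the
  fibre is the set counted by the 4-weight.\<close>

lemma min_vectors_fiber:
  assumes v: "v \<in> min_vectors"
  shows "{u \<in> min_vectors. leech_class u = leech_class v} = class_sphere v"
proof (intro equalityI subsetI)
  fix u assume "u \<in> {u \<in> min_vectors. leech_class u = leech_class v}"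
  then have u: "u \<in> leech" "minimal_in_class 4 u" "leech_class u = leech_class v"
    unfolding min_vectors_iff by auto
  have v': "v \<in> leech" "minimal_in_class 4 v" using v unfolding min_vectors_iff by auto
  have uv: "u - v \<in> mult_leech 4" using leech_class_eq_iff[OF u(1) v'(1)] u(3) by simp
  have "v \<bullet> v \<le> u \<bullet> u" using v'(2) u(1) uv unfolding minimal_in_class_def by blast
  moreover have "u \<bullet> u \<le> v \<bullet> v"
    using u(2) v'(1) mult_leech_swap[OF uv] unfolding minimal_in_class_def by blast
  ultimately show "u \<in> class_sphere v" unfolding class_sphere_def using u(1) uv by simp
next
  fix u assume u: "u \<in> class_sphere v"
  have v': "v \<in> leech" "minimal_in_class 4 v" "v \<bullet> v \<le> 32" using v unfolding min_vectors_iff by auto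
  have "u \<in> leech" "u - v \<in> mult_leech 4" "u \<bullet> u = v \<bullet> v" using u unfolding class_sphere_def by auto
  then show "u \<in> {u \<in> min_vectors. leech_class u = leech_class v}"
    using leech_class_eq_iff[OF _ v'(1)] minimal_class[OF v'(2) u] v'(3) unfolding min_vectors_iff by simp
qed

lemma card_min_classes:
  "real (card (leech_class ` min_vectors))
    = (\<Sum>x | eq_weight x \<noteq> None. real (label_card x) / real (class_size x))"
proof -
  have "real (card (leech_class ` min_vectors))
      = (\<Sum>v\<in>min_vectors. 1 / real (card {u \<in> min_vectors. leech_class u = leech_class v}))"
    by (rule card_image_eq_sum[OF finite_min_vectors])
  also have "\<dots> = (\<Sum>v\<in>min_vectors. 1 / real (vector_weight 4 v))"
    by (rule sum.cong[OF refl]) (simp only: min_vectors_fiber vector_weight_eq)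
  also have "\<dots> = (\<Sum>x | eq_weight x \<noteq> None. \<Sum>v\<in>Orb x. 1 / real (vector_weight 4 v))"
    unfolding min_vectors_def
  proof (rule sum.UNION_disjoint[OF finite_listed])
    show "\<forall>x\<in>{x. eq_weight x \<noteq> None}. \<forall>y\<in>{x. eq_weight x \<noteq> None}. x \<noteq> y \<longrightarrow> Orb x \<inter> Orb y = {}"
      by (auto dest: Orb_inj)
  qed (simp add: finite_Orb)
  also have "\<dots> = (\<Sum>x | eq_weight x \<noteq> None. \<Sum>v\<in>Orb x. 1 / real (class_size x))"
    by (intro sum.cong refl) (simp add: vector_weight_class_size)
  finally show ?thesis by (simp add: card_Orb)
qed

lemma class_size_listed:
  "eq_weight x \<noteq> None \<Longrightarrow> x \<notin> {O15b, O15d, O16a, O16e} \<Longrightarrow> class_size x = the (eq_weight x)"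
  using class_size_eq[of x "the (eq_weight x)"] by auto

text \<open>The subtracted terms are what the four open orbits contribute for class sizes 14, 14, 48
  and 32; in particular (1335398400 + 8012390400) / 14 = 667699200. The other orbits supply the rest
  of 4^24.\<close>

lemma card_min_classes_eq:
  "real (card (leech_class ` min_vectors)) = 4 ^ 24 - 65520 * (667699200 + 6075 / 48 + 5901984000 / 32)
    + 65520 * (1335398400 / real (class_size O15b) + 8012390400 / real (class_size O15d)
      + 6075 / real (class_size O16a) + 5901984000 / real (class_size O16e))"
  unfolding card_min_classes listed_labels by (simp add: class_size_listed)

lemma card_min_classes_le: "card (leech_class ` min_vectors) \<le> 4 ^ 24"
proof -
  have "leech_class ` min_vectors \<subseteq> leech_class ` leech" using min_vectors_iff by blast
  from card_mono[OF card_leech_classes(1) this] card_leech_classes(2) show ?thesis by linarith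
qed

end

section \<open>Determination of the remaining class sizes\<close>

context leech_table
begin

lemma type_15_class:
  assumes v: "v \<in> Orb x" "label_type x = 15" "eq_weight x \<noteq> None"
  shows "class_sphere v \<subseteq> Orb O15b \<union> Orb O15d"
proof
  fix u assume u: "u \<in> class_sphere v"
  have "v \<in> shell 15" using v(1,2) Orb_shell[of x] by auto
  then have "u \<in> shell 15" using u class_sphere_shell by blast
  then obtain y where y: "u \<in> Orb y" "label_type y = 15" using shell_eq_Union[of 15] by auto
  have "minimal_in_class 4 u" using minimal_class[OF _ u] minimal_iff_listed[OF v(1)] v(3) by simp
  then have "eq_weight y \<noteq> None" using minimal_iff_listed[OF y(1)] by simp
  moreover have "y \<in> {O15a, O15b, O15c, O15d, O15e}" using y(2) label_type_sets(16) by blast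
  ultimately show "u \<in> Orb O15b \<union> Orb O15d" using y(1) by auto
qed

lemma type_15_class_size:
  assumes "x \<in> {O15b, O15d}"
  shows "class_size x = conj_count x O15b + conj_count x O15d"
proof -
  obtain v where v: "v \<in> Orb x" using Orb_nonempty by blast
  have "class_sphere v = (class_sphere v \<inter> Orb O15b) \<union> (class_sphere v \<inter> Orb O15d)"
    using type_15_class[OF v] assms by auto
  moreover have "Orb O15b \<inter> Orb O15d = {}" using Orb_inj by blast
  ultimately have "card (class_sphere v)
      = card (class_sphere v \<inter> Orb O15b) + card (class_sphere v \<inter> Orb O15d)"
    using finite_Orb by (subst card_Un_disjoint[symmetric]) auto
  then show ?thesis
    unfolding conj_count_eq[OF v] vector_weight_class_size[OF v, symmetric] vector_weight_eq .
qed

text \<open>If a class is contained in one orbit, then all rows of its Gram matrix have the same sum,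
  which is nonnegative.\<close>

lemma type_15_row_sum:
  assumes x: "x \<in> {O15b, O15d}" and single: "class_size x = conj_count x x"
  shows "orbit_count 2 8 x + 9 * orbit_count 3 12 x \<le> 15"
proof -
  obtain v where v: "v \<in> Orb x" using Orb_nonempty by blast
  have type: "label_type x = 15" "orbit_count 4 16 x = 0" using x by (auto simp: orbit_counts)
  define K where "K = class_sphere v"
  have fin: "finite K" unfolding K_def by (rule finite_class_sphere[OF v])
  have "card (K \<inter> Orb x) = card K"
    using single unfolding conj_count_eq[OF v] vector_weight_class_size[OF v, symmetric]
      vector_weight_eq K_def by simp
  then have "K \<inter> Orb x = K" using fin by (intro card_subset_eq) auto
  then have sub: "u \<in> Orb x" if "u \<in> K" for u using that by blast
  have "0 \<le> (\<Sum>u\<in>K. u) \<bullet> (\<Sum>a\<in>K. a)" by simp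
  also have "\<dots> = (\<Sum>u\<in>K. \<Sum>a\<in>K. u \<bullet> a)"
    unfolding inner_sum_left inner_sum_right by (rule sum.swap)
  \<comment> \<open>For type 15 the Gram entries are 30, and -2 and -18 for \<open>s\<close> of
    types 2 and 3.\<close>
  also have "\<dots> = (\<Sum>u\<in>K. 30 - 2 * real (orbit_count 2 8 x) - 18 * real (orbit_count 3 12 x))"
  proof (rule sum.cong[OF refl])
    fix u assume u: "u \<in> K"
    have "class_sphere u = K" using u class_sphere_eqI unfolding K_def by blast
    then show "(\<Sum>a\<in>K. u \<bullet> a) = 30 - 2 * real (orbit_count 2 8 x) - 18 * real (orbit_count 3 12 x)"
      using sum_class_sphere[OF sub[OF u] type(1), of "\<lambda>x. x"] type(2) by simp
  qed
  finally have "0 \<le> real (card K) * (30 - 2 * real (orbit_count 2 8 x) - 18 * real (orbit_count 3 12 x))"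
    by simp
  moreover have "card K > 0"
    using class_sphere_refl[OF Orb_eq_orbit(2)[OF v]] fin unfolding K_def by (auto simp: card_gt_0_iff)
  ultimately have "0 \<le> 30 - 2 * real (orbit_count 2 8 x) - 18 * real (orbit_count 3 12 x)"
    by (simp add: zero_le_mult_iff)
  then show ?thesis by simp
qed

lemma class_size_pos: "class_size x > 0"
  unfolding class_size_def by simp

text \<open>The bounds 48 and 32 make the contributions \<open>A\<close> and \<open>E\<close> at
  least their expected values, so the contribution \<open>F\<close> of the two orbits of type 15 is
  at most 667699200. This forces the orbits to share classes; a shared class has 7 k elements by
  double counting, and the possible counts place its size between 14 and 18. Then all inequalities
  are equalities.\<close>

lemma class_sizes:
  "class_size O15b = 14" "class_size O15d = 14" "class_size O16a = 48" "class_size O16e = 32"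
  "conj_count O15b O15b = 2" "conj_count O15b O15d = 12" "conj_count O15d O15d = 12"
  "card (leech_class ` min_vectors) = 4 ^ 24"
proof -
  let ?B = "class_size O15b" and ?D = "class_size O15d"
  define F where "F = 1335398400 / real ?B + 8012390400 / real ?D"
  define A where "A = 6075 / real (class_size O16a)"
  define E where "E = 5901984000 / real (class_size O16e)"
  have a: "6075 / 48 \<le> A"
    unfolding A_def using class_size_O16a class_size_pos[of O16a] by (intro divide_left_mono) auto
  have e: "5901984000 / 32 \<le> E"
    unfolding E_def using class_size_O16e class_size_pos[of O16e] by (intro divide_left_mono) auto
  have card: "real (card (leech_class ` min_vectors))
      = 4 ^ 24 - 65520 * (667699200 + 6075 / 48 + 5901984000 / 32) + 65520 * (F + A + E)"
    unfolding F_def A_def E_def by (rule card_min_classes_eq)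
  have "real (card (leech_class ` min_vectors)) \<le> 4 ^ 24"
    using card_min_classes_le by (metis of_nat_le_iff of_nat_numeral of_nat_power)
  then have total: "F + A + E \<le> 667699200 + 6075 / 48 + 5901984000 / 32"
  proof -
    have "s \<le> r" if "c - 65520 * r + 65520 * s \<le> c" for c r s :: real using that by linarith
    then show ?thesis using \<open>real (card (leech_class ` min_vectors)) \<le> 4 ^ 24\<close> unfolding card .
  qed
  then have F: "F \<le> 667699200" using a e by linarith
  \<comment> \<open>The factor 6 is the ratio of the two orbit sizes.\<close>
  have D6: "conj_count O15b O15d = 6 * conj_count O15d O15b"
    using conj_count_double[of O15b O15d] by simp
  have B: "?B = conj_count O15b O15b + conj_count O15b O15d"
    and D: "?D = conj_count O15d O15b + conj_count O15d O15d"
    using type_15_class_size by simp_all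
  have sizes: "?B = 1 + orbit_count 2 8 O15b + orbit_count 3 12 O15b"
    "?D = 1 + orbit_count 2 8 O15d + orbit_count 3 12 O15d"
    by (rule class_size_special)+
  note cases = orbit_count_15_8
  \<comment> \<open>If no class were shared, the row sum bound would apply to each orbit. The size
    pairs are then at most (13, 14), (8, 15) or (2, 16), and each makes \<open>F\<close> exceed its
    bound.\<close>
  have "conj_count O15d O15b \<noteq> 0"
  proof
    assume 0: "conj_count O15d O15b = 0"
    have rb: "orbit_count 2 8 O15b + 9 * orbit_count 3 12 O15b \<le> 15"
      by (rule type_15_row_sum) (use 0 B D6 in simp_all)
    have rd: "orbit_count 2 8 O15d + 9 * orbit_count 3 12 O15d \<le> 15"
      by (rule type_15_row_sum) (use 0 D in simp_all)
    from cases rb rd sizes have "?B \<le> 13 \<and> ?D = 14 \<or> ?B \<le> 8 \<and> ?D = 15 \<or> ?B \<le> 2 \<and> ?D = 16"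
      by linarith
    moreover have "1335398400 / real ?B \<ge> 1335398400 / real k" if "?B \<le> k" for k
      using that class_size_pos[of O15b] by (intro divide_left_mono) auto
    from this[of 13] this[of 8] this[of 2]
    show False using F calculation unfolding F_def by auto
  qed
  then have pos: "conj_count O15d O15b > 0" by simp
  obtain v where v: "v \<in> Orb O15b" using Orb_nonempty by blast
  obtain u where u: "u \<in> class_sphere v" "u \<in> Orb O15d"
  proof -
    have "conj_count O15b O15d > 0" using pos D6 by simp
    then have "class_sphere v \<inter> Orb O15d \<noteq> {}" unfolding conj_count_eq[OF v] card_gt_0_iff by blast
    then show ?thesis using that by blast
  qed
  have uv: "class_sphere u = class_sphere v" by (rule class_sphere_eqI[OF u(1)])
  have BD: "?B = ?D"
    using vector_weight_class_size[OF v] vector_weight_class_size[OF u(2)] uv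
    unfolding vector_weight_eq by simp
  \<comment> \<open>Both numbers count the vectors of \<open>O15b\<close> in one and the same
    class.\<close>
  have same: "conj_count O15b O15b = conj_count O15d O15b"
    unfolding conj_count_eq[OF v] conj_count_eq[OF u(2)] uv ..
  have B7: "?B = 7 * conj_count O15d O15b" using B same D6 by simp
  have "orbit_count 3 12 O15d \<le> 2" using orbit_count_bound[of 3 12 O15d] by simp
  \<comment> \<open>The three solutions give between 13 and 15 vectors \<open>s\<close> of type 2,
    and at most 2 of type 3; add 1 for the vector itself. The only multiple of 7 in this range is
    14.\<close>
  then have "14 \<le> ?D" "?D \<le> 18" using sizes(2) cases by linarith+
  then have two: "conj_count O15d O15b = 2" using B7 BD by linarith
  then show B14: "?B = 14" using B7 by simp
  then show D14: "?D = 14" using BD by simp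
  show "conj_count O15b O15b = 2" using same two by simp
  show "conj_count O15b O15d = 12" using D6 two by simp
  show "conj_count O15d O15d = 12" using D D14 two by simp
  have F_eq: "F = 667699200" unfolding F_def B14 D14 by simp
  have a_eq: "A = 6075 / 48" and e_eq: "E = 5901984000 / 32"
    using total a e F_eq by linarith+
  show "class_size O16a = 48" using a_eq class_size_pos[of O16a] by (simp add: A_def field_simps)
  show "class_size O16e = 32" using e_eq class_size_pos[of O16e] by (simp add: E_def field_simps)
  have "real (card (leech_class ` min_vectors)) = 4 ^ 24"
    unfolding card a_eq e_eq F_eq by simp
  then have "real (card (leech_class ` min_vectors)) = real (4 ^ 24)" by simp
  then show "card (leech_class ` min_vectors) = 4 ^ 24" by (simp only: of_nat_eq_iff)
qed

section \<open>From class sizes to representatives, conjugacy and orbit weights\<close>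

lemma class_size_eq_weight:
  assumes "eq_weight x = Some k"
  shows "class_size x = k"
proof (cases "x \<in> {O15b, O15d, O16a, O16e}")
  case True
  then show ?thesis using assms class_sizes by auto
next
  case False
  then show ?thesis using class_size_eq[OF assms] by simp
qed

lemma every_class_hit:
  assumes v: "v \<in> leech"
  shows "\<exists>u\<in>min_vectors. u - v \<in> mult_leech 4"
proof -
  have sub: "leech_class ` min_vectors \<subseteq> leech_class ` leech" using min_vectors_iff by blast
  have "card (leech_class ` leech) \<le> card (leech_class ` min_vectors)"
    using card_leech_classes(2) class_sizes(8) by simp
  then have "leech_class ` min_vectors = leech_class ` leech"
    by (intro card_seteq[OF card_leech_classes(1) sub])
  then have "leech_class v \<in> leech_class ` min_vectors" using v by blast
  then obtain u where u: "u \<in> min_vectors" "leech_class u = leech_class v" by auto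
  then show ?thesis using leech_class_eq_iff[OF _ v, of u] min_vectors_iff by blast
qed

text \<open>Conjugate listed orbits have equal type and class size. Outside type 15 this leaves
  classes of size 1, which have no room for a second orbit, and the pair \<open>O12a\<close>,
  \<open>O12e\<close> with size 2. There each vector would have exactly one partner in the other
  orbit, but the orbit sizes differ.\<close>

lemma not_conjugate:
  assumes x: "eq_weight x \<noteq> None" "label_type x \<noteq> 15" and y: "y \<noteq> x" "label_type y \<le> label_type x"
    and v: "v \<in> Orb x" and u: "u \<in> Orb y"
  shows "\<not> orbits_conjugate 4 v u"
proof
  assume conj: "orbits_conjugate 4 v u"
  note c = conjugate_listed[OF v u x(1) conj y(2)]
  obtain k where k: "eq_weight x = Some k" using x(1) by auto
  obtain l where l: "eq_weight y = Some l" using c(2) by auto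
  have kl: "class_size x = k" "k = l"
    using class_size_eq_weight[OF k] class_size_eq_weight[OF l] c(3) by simp_all
  have "k = 1 \<or> x = O12a \<and> y = O12e \<or> x = O12e \<and> y = O12a"
    using k l kl(2) x(2) c(1) y(1) by (cases x; cases y) simp_all
  moreover have two: "conj_count x x + conj_count x y \<le> class_size x"
    by (rule conj_count_add_le) (use y(1) in simp)
  moreover have "conj_count x y = 1" "conj_count y x = 1"
    if "x = O12a \<and> y = O12e \<or> x = O12e \<and> y = O12a"
  proof -
    have 2: "class_size x = 2" "class_size y = 2"
      using that class_size_eq_weight[of O12a 2] class_size_eq_weight[of O12e 2] by auto
    show "conj_count x y = 1" using two 2 c(4) conj_count_self[of x] by linarith
    have "conj_count y x > 0" using conj_count_double[of x y] c(4) label_card_pos[of x]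
      by (metis mult_pos_pos nat_0_less_mult_iff)
    then show "conj_count y x = 1"
      using conj_count_add_le[OF y(1)] 2 conj_count_self[of y] by linarith
  qed
  ultimately show False
    using c(4) conj_count_self[of x] conj_count_double[of x y] kl(1) by auto
qed

lemma orbit_weight_eq_conj_count:
  assumes v: "v \<in> Orb x"
  shows "orbit_weight 4 v = conj_count x x"
proof -
  have "{u \<in> co0_orbit v. u - v \<in> mult_leech 4} = class_sphere v \<inter> Orb x"
    using Orb_eq_orbit Orb_norm v unfolding Orb_eq_orbit(1)[OF v, symmetric] class_sphere_def by auto
  then show ?thesis unfolding orbit_weight_def conj_count_eq[OF v] by simp
qed

text \<open>By \<open>not_conjugate\<close> the class sphere stays inside the orbit, so both weights
  count the same set.\<close>

lemma orbit_weight_eq_vector_weight: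
  assumes x: "eq_weight x \<noteq> None" "label_type x \<noteq> 15" and v: "v \<in> Orb x" and u: "u \<in> Orb x"
  shows "orbit_weight 4 v = vector_weight 4 u"
proof -
  have "class_sphere v \<subseteq> Orb x"
  proof
    fix a assume a: "a \<in> class_sphere v"
    have "v \<in> shell (label_type x)" using v Orb_shell by blast
    then have "a \<in> shell (label_type x)" using a class_sphere_shell by blast
    then obtain y where y: "a \<in> Orb y" "label_type y = label_type x"
      using shell_eq_Union[OF label_type_le[of x]] by auto
    have "v - id a \<in> mult_leech 4" using a mult_leech_swap unfolding class_sphere_def by auto
    then have "orbits_conjugate 4 v a" unfolding orbits_conjugate_def using Co0_id by blast
    then have "y = x" using not_conjugate[OF x _ _ v y(1)] y(2) by auto
    then show "a \<in> Orb x" using y(1) by simp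
  qed
  then have "class_sphere v \<inter> Orb x = class_sphere v" by blast
  then have "conj_count x x = vector_weight 4 v" unfolding conj_count_eq[OF v] vector_weight_eq by simp
  then show ?thesis
    using orbit_weight_eq_conj_count[OF v] vector_weight_class_size[OF v] vector_weight_class_size[OF u]
    by simp
qed

end

theorem theorem7p1:
  fixes Orb :: "orbit_label \<Rightarrow> vec24 set"
  assumes table: "leech_orbit_table Orb"
  shows
    "(\<forall>v\<in>leech. \<exists>u\<in>leech. u - v \<in> mult_leech 4 \<and> minimal_in_class 4 u \<and>
         leech_type u \<le> 16 \<and> (\<exists>x. eq_weight x \<noteq> None \<and> u \<in> Orb x))
   \<and> (let N = (\<lambda>x. real (card (Orb x))) in
        4 ^ 24 = 1 + N O2 + N O3 + N O4 + N O5 + N O6a + N O6b + N O7 + 1/2 * N O8a + N O8b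
         + N O8c + N O9a + N O9b + N O10a + 1/2 * N O10b + N O10c + 1/2 * N O11a + N O11b
         + 1/2 * N O12a + N O12c + 1/4 * N O12d + 1/2 * N O12e + N O12f + 1/2 * N O13b
         + 1/3 * N O13c + 1/6 * N O14b + 1/4 * N O14d + 1/8 * N O14e
         + 1/14 * (N O15b + N O15d) + 1/48 * N O16a + 1/32 * N O16e)
   \<and> (\<forall>x k. eq_weight x = Some k \<longrightarrow>
         (\<forall>v\<in>Orb x. minimal_in_class 4 v \<and> vector_weight 4 v = k))
   \<and> (\<forall>v\<in>Orb O15b. \<forall>u\<in>Orb O15d. orbits_conjugate 4 v u)
   \<and> (\<forall>x\<in>{O15b, O15d}. \<forall>y. label_type y = 15 \<and> y \<notin> {O15b, O15d} \<longrightarrow>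
         (\<forall>v\<in>Orb x. \<forall>u\<in>Orb y. \<not> orbits_conjugate 4 v u))
   \<and> (\<forall>x. eq_weight x \<noteq> None \<and> label_type x \<noteq> 15 \<longrightarrow>
         (\<forall>y. y \<noteq> x \<and> label_type y \<le> label_type x \<longrightarrow>
            (\<forall>v\<in>Orb x. \<forall>u\<in>Orb y. \<not> orbits_conjugate 4 v u)) \<and>
         (\<forall>v\<in>Orb x. \<forall>u\<in>Orb x. orbit_weight 4 v = vector_weight 4 u))
   \<and> (\<forall>v\<in>Orb O15b. orbit_weight 4 v = 2 \<and> vector_weight 4 v = 14)
   \<and> (\<forall>v\<in>Orb O15d. orbit_weight 4 v = 12 \<and> vector_weight 4 v = 14)"
proof -
  interpret leech_table Orb by standard (rule table)
  show ?thesis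
  proof (intro conjI)
    show "\<forall>v\<in>leech. \<exists>u\<in>leech. u - v \<in> mult_leech 4 \<and> minimal_in_class 4 u \<and>
        leech_type u \<le> 16 \<and> (\<exists>x. eq_weight x \<noteq> None \<and> u \<in> Orb x)"
    proof
      fix v assume "v \<in> leech"
      then obtain u where u: "u \<in> min_vectors" "u - v \<in> mult_leech 4" using every_class_hit by blast
      then have "u \<in> leech" "u \<bullet> u \<le> 32" "minimal_in_class 4 u" using min_vectors_iff by auto
      moreover obtain x where "u \<in> Orb x" "eq_weight x \<noteq> None" using u(1) unfolding min_vectors_def by blast
      ultimately show "\<exists>u\<in>leech. u - v \<in> mult_leech 4 \<and> minimal_in_class 4 u \<and>
          leech_type u \<le> 16 \<and> (\<exists>x. eq_weight x \<noteq> None \<and> u \<in> Orb x)"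
        using u(2) unfolding leech_type_def by (intro bexI[of _ u] conjI exI[of _ x]) simp_all
    qed
    show "let N = (\<lambda>x. real (card (Orb x))) in
        4 ^ 24 = 1 + N O2 + N O3 + N O4 + N O5 + N O6a + N O6b + N O7 + 1/2 * N O8a + N O8b
         + N O8c + N O9a + N O9b + N O10a + 1/2 * N O10b + N O10c + 1/2 * N O11a + N O11b
         + 1/2 * N O12a + N O12c + 1/4 * N O12d + 1/2 * N O12e + N O12f + 1/2 * N O13b
         + 1/3 * N O13c + 1/6 * N O14b + 1/4 * N O14d + 1/8 * N O14e
         + 1/14 * (N O15b + N O15d) + 1/48 * N O16a + 1/32 * N O16e"
      unfolding Let_def card_Orb by simp
    show "\<forall>x k. eq_weight x = Some k \<longrightarrow>
        (\<forall>v\<in>Orb x. minimal_in_class 4 v \<and> vector_weight 4 v = k)"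
      using minimal_iff_listed vector_weight_class_size class_size_eq_weight by auto
    show "\<forall>v\<in>Orb O15b. \<forall>u\<in>Orb O15d. orbits_conjugate 4 v u"
      using orbits_conjugate_iff class_sizes(6) by simp
    show "\<forall>x\<in>{O15b, O15d}. \<forall>y. label_type y = 15 \<and> y \<notin> {O15b, O15d} \<longrightarrow>
         (\<forall>v\<in>Orb x. \<forall>u\<in>Orb y. \<not> orbits_conjugate 4 v u)"
    proof (intro ballI allI impI notI)
      fix x y v u
      assume x: "x \<in> {O15b, O15d}" and y: "label_type y = 15 \<and> y \<notin> {O15b, O15d}"
        and v: "v \<in> Orb x" and u: "u \<in> Orb y" and conj: "orbits_conjugate 4 v u"
      have "eq_weight y \<noteq> None"
        by (rule conjugate_listed(2)[OF v u _ conj]) (use x y in auto)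
      moreover have "y \<in> {O15a, O15b, O15c, O15d, O15e}" using y label_type_sets(16) by blast
      ultimately show False using y by auto
    qed
    show "\<forall>x. eq_weight x \<noteq> None \<and> label_type x \<noteq> 15 \<longrightarrow>
         (\<forall>y. y \<noteq> x \<and> label_type y \<le> label_type x \<longrightarrow>
            (\<forall>v\<in>Orb x. \<forall>u\<in>Orb y. \<not> orbits_conjugate 4 v u)) \<and>
         (\<forall>v\<in>Orb x. \<forall>u\<in>Orb x. orbit_weight 4 v = vector_weight 4 u)"
      by (intro allI impI conjI ballI; elim conjE;
          (rule not_conjugate | rule orbit_weight_eq_vector_weight); assumption)
    show "\<forall>v\<in>Orb O15b. orbit_weight 4 v = 2 \<and> vector_weight 4 v = 14"
      using orbit_weight_eq_conj_count vector_weight_class_size class_sizes by simp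
    show "\<forall>v\<in>Orb O15d. orbit_weight 4 v = 12 \<and> vector_weight 4 v = 14"
      using orbit_weight_eq_conj_count vector_weight_class_size class_sizes by simp
  qed
qed

end
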